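(* Let $0<p\le\infty$, $r,k\in\mathbb{N}$, and let either $0<\alpha<\min(r,k)$ or $0<\alpha=k=r$. Then there is a constant $C$ such that for every $f\in H_p^{r,\alpha}$ and every $n\in\mathbb{N}$ $$E_n(f)_{H_p^{r,\alpha}}\le C\,\theta_{k,\alpha}\left(f,\tfrac1n\right)_p ,$$ where $C$ is independent of $n$ and $f$.
   Context: $\mathbb{T}\cong[0,2\pi)$ is the torus; functions are complex-valued and $2\pi$-periodic. For $0<p<\infty$, $L_p=L_p(\mathbb{T})$ is the space of measurable functions with $\|f\|_p=\left(\frac1{2\pi}\int_{\mathbb{T}}|f(x)|^p\,dx\right)^{1/p}<\infty$; $L_\infty$ denotes the space of $2\pi$-periodic continuous functions with $\|f\|_\infty=\max|f|$. For $k\in\mathbb{N}=\{1,2,\dots\}$: $\Delta_\delta^k f(x)=\sum_{\nu=0}^k(-1)^\nu\binom k\nu f(x+\nu\delta)$ and $\omega_k(f,t)_p=\sup_{0<\delta<t}\|\Delta_\delta^kf\|_p$. For $0<p\le\infty$, $r\in\mathbb{N}$, $0<\alpha\le r$: $f\in H_p^{r,\alpha}$ if $f\in L_p$ and $\|f\|_{H_p^{r,\alpha}}=\|f\|_p+|f|_{H_p^{r,\alpha}}<\infty$, where $|f|_{H_p^{r,\alpha}}=\sup_{h>0}h^{-\alpha}\|\Delta_h^rf\|_p$. $\mathcal{T}_n$ is the set of trigonometric polynomials $\sum_{\nu=-n}^nc_\nu e^{i\nu x}$, $c_\nu\in\mathbb{C}$, and $E_n(f)_{H_p^{r,\alpha}}=\inf_{T\in\mathcal{T}_n}\|f-T\|_{H_p^{r,\alpha}}$.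 Further, $\theta_{k,\alpha}(f,\delta)_p=\sup_{0<h\le\delta}h^{-\alpha}\omega_k(f,h)_p$. *)

theory Defs
  imports "HOL-Analysis.Analysis"
begin

text \<open>
  Functions on the torus are functions on \<open>\<real>\<close> of period \<open>2 \<pi>\<close>. The exponent \<open>p\<close> ranges over
  the extended nonnegative reals, with \<open>p = \<infinity>\<close> allowed. All norms, seminorms and moduli take
  values in \<^typ>\<open>ennreal\<close>, so that suprema are meaningful even when they are infinite.
\<close>

text \<open>
  For finite \<open>p\<close> this is \<open>((1 / (2 \<pi>)) \<integral>\<^bsub>0\<^esub>\<^bsup>2\<pi>\<^esup> |f|\<^sup>p)\<close> to the power \<open>1 / p\<close>; since \<open>powr\<close> is not available
  on \<^typ>\<open>ennreal\<close>, the value infinity is treated separately. For \<open>p = \<infinity>\<close> it is the true supremum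
  (not an essential one), as that space consists of continuous functions.
\<close>
definition Lp_norm :: "ennreal \<Rightarrow> (real \<Rightarrow> complex) \<Rightarrow> ennreal" where
  "Lp_norm p f =
     (if p = \<infinity> then (SUP x. ennreal (cmod (f x)))
      else
        let I = ennreal (1 / (2 * pi)) *
                  (\<integral>\<^sup>+x\<in>{0..<2 * pi}. ennreal (cmod (f x) powr enn2real p) \<partial>lebesgue)
        in if I = \<infinity> then \<infinity> else ennreal (enn2real I powr (1 / enn2real p)))"

definition Lp_space :: "ennreal \<Rightarrow> (real \<Rightarrow> complex) set" where
  "Lp_space p =
     {f. (\<forall>x. f (x + 2 * pi) = f x) \<and>
         (if p = \<infinity> then continuous_on UNIV f
          else f \<in> borel_measurable lebesgue \<and> Lp_norm p f < \<infinity>)}"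

definition difference :: "nat \<Rightarrow> real \<Rightarrow> (real \<Rightarrow> complex) \<Rightarrow> real \<Rightarrow> complex" where
  "difference k \<delta> f x = (\<Sum>\<nu>=0..k. (-1) ^ \<nu> * of_nat (k choose \<nu>) * f (x + real \<nu> * \<delta>))"

definition modulus :: "nat \<Rightarrow> (real \<Rightarrow> complex) \<Rightarrow> real \<Rightarrow> ennreal \<Rightarrow> ennreal" where
  "modulus k f t p = (SUP \<delta>\<in>{0<..<t}. Lp_norm p (difference k \<delta> f))"

definition Holder_seminorm :: "ennreal \<Rightarrow> nat \<Rightarrow> real \<Rightarrow> (real \<Rightarrow> complex) \<Rightarrow> ennreal" where
  "Holder_seminorm p r \<alpha> f = (SUP h\<in>{0<..}. ennreal (h powr - \<alpha>) * Lp_norm p (difference r h f))"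

definition Holder_norm :: "ennreal \<Rightarrow> nat \<Rightarrow> real \<Rightarrow> (real \<Rightarrow> complex) \<Rightarrow> ennreal" where
  "Holder_norm p r \<alpha> f = Lp_norm p f + Holder_seminorm p r \<alpha> f"

definition Holder_space :: "ennreal \<Rightarrow> nat \<Rightarrow> real \<Rightarrow> (real \<Rightarrow> complex) set" where
  "Holder_space p r \<alpha> = {f \<in> Lp_space p. Holder_norm p r \<alpha> f < \<infinity>}"

definition trig_polys :: "nat \<Rightarrow> (real \<Rightarrow> complex) set" where
  "trig_polys n =
     {T. \<exists>c :: int \<Rightarrow> complex.
           T = (\<lambda>x. \<Sum>\<nu>\<in>{- int n..int n}. c \<nu> * exp (\<i> * of_int \<nu> * of_real x))}"

definition best_approx :: "nat \<Rightarrow> (real \<Rightarrow> complex) \<Rightarrow> ennreal \<Rightarrow> nat \<Rightarrow> real \<Rightarrow> ennreal" where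
  "best_approx n f p r \<alpha> = (INF T\<in>trig_polys n. Holder_norm p r \<alpha> (\<lambda>x. f x - T x))"

definition theta :: "nat \<Rightarrow> real \<Rightarrow> (real \<Rightarrow> complex) \<Rightarrow> real \<Rightarrow> ennreal \<Rightarrow> ennreal" where
  "theta k \<alpha> f \<delta> p = (SUP h\<in>{0<..\<delta>}. ennreal (h powr - \<alpha>) * modulus k f h p)"

end

theory Submission
  imports Defs "HOL-Computational_Algebra.Polynomial"
begin

text \<open>
Write \<open>\<parallel>F\<parallel>\<close> for the (quasi-)norm of \<open>L\<^sub>p\<close>. For \<open>p < 1\<close> the elements of \<open>L\<^sub>p\<close> need not be
integrable, so they cannot be convolved with kernels, and the triangle inequality fails. What replaces both,
for every \<open>p\<close> in \<open>(0, \<infinity>]\<close>, is \<open>Lp_norm_sum\<close>: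
if \<open>\<Sum>w\<^sub>i \<le> S\<close> and \<open>\<parallel>F\<^sub>i\<parallel> \<le> B w\<^sub>i\<^sup>m\<close>, with an integer \<open>m\<close> depending on \<open>p\<close> only, then \<open>\<parallel>\<Sum>F\<^sub>i\<parallel>\<close> is at most a
constant times \<open>B\<close>. In particular a finite sum \<open>\<Sum>v\<^sub>j F(x + s\<^sub>j)\<close> of translates has norm at most a
constant times \<open>\<parallel>F\<parallel>\<close> as soon as the coefficients decay like a high enough power of \<open>1 + |j|\<close>.

Such sums arise from a kernel \<open>V\<close>, a Dirichlet kernel times a power of a normalized geometric sum of
waves. It reproduces trigonometric polynomials of degree at most \<open>n\<close> from their values on any translate of a
grid of mesh comparable to \<open>1 / n\<close>, and it decays polynomially (\<open>vp_kernel_reproduce\<close>, \<open>vp_kernel_bound\<close>,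
\<open>vp_kernel_diff_bound\<close>). Reproducing \<open>T(x + h)\<close> from the grid through \<open>x\<close> writes \<open>T(x) - T(x + h)\<close> as a sum
of translates of \<open>T\<close> with decaying coefficients of size \<open>n h\<close>. This gives a Bernstein inequality
(\<open>bernstein\<close>) and, by a perturbation argument, an inequality of Nikolskii--Stechkin type
(\<open>nikolskii_stechkin\<close>).

The Jackson estimate (\<open>jackson\<close>) is needed only in the form \<open>\<parallel>f - T\<parallel> \<le> C \<Theta> n\<^sup>-\<^sup>\<alpha>\<close> for some \<open>T\<close> of degree
at most \<open>n\<close>, where \<open>\<parallel>\<Delta>\<^sub>\<delta>\<^sup>k f\<parallel> \<le> \<Theta> \<delta>\<^sup>\<alpha>\<close> for all small \<open>\<delta>\<close>. On a grid \<open>l + \<int> \<pi> / H\<close> the operator \<open>X = I - V\<close>,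
with discrete convolution by \<open>V\<close>, satisfies \<open>\<parallel>X\<^sup>k f\<parallel> \<le> C \<parallel>\<Delta>\<^sup>k f\<parallel>\<close> with the step \<open>\<pi> / H\<close>. The samples of
\<open>f - X\<^sup>k f\<close> on the grid extend to a trigonometric polynomial \<open>T\<^sub>l\<close>, and the polynomials belonging to a grid and
to its refinement differ, on the common nodes, by values of \<open>X\<^sup>k f\<close> at the two scales. Summing over dyadic refinements, with
continuity of translation in \<open>L\<^sub>p\<close> identifying the limit, bounds \<open>f(x) - T\<^sub>x\<^sub>+\<^sub>s(x)\<close> in norm
for each fixed \<open>s\<close>. By Fubini the bound holds for \<open>f - T\<^sub>l\<close> with some \<open>l\<close> (\<open>Lp_norm_choose_parameter\<close>).

In the theorem, \<open>T\<close> is the Jackson polynomial of degree \<open>n\<close>. Differences of \<open>f - T\<close> with steps \<open>h\<close> of size at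
least about \<open>1 / n\<close> are bounded by \<open>\<parallel>f - T\<parallel>\<close> itself. For smaller steps and \<open>\<alpha> < r\<close>, one passes from \<open>T\<close> to the
Jackson polynomial of degree about \<open>1 / h\<close> through dyadic levels and applies Bernstein to every increment; the
resulting sum is geometric since \<open>\<alpha> < r\<close> (\<open>Holder_approx_below_order\<close>). For \<open>\<alpha> = k = r\<close> the differences of \<open>f\<close> are
small by hypothesis and those of \<open>T\<close> by Nikolskii--Stechkin (\<open>Holder_approx_at_order\<close>).
\<close>

section \<open>The quasi-norms of L_p\<close>

text \<open>
The integral of \<open>|F|\<^sup>p\<close> over one period, against Lebesgue--Borel measure. By \<open>nn_integral_completion\<close> it equals
the integral against Lebesgue measure, for every \<open>F\<close>.
\<close>

definition Lp_mass :: "ennreal \<Rightarrow> (real \<Rightarrow> complex) \<Rightarrow> ennreal" where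
  "Lp_mass p F = (\<integral>\<^sup>+x\<in>{0..<2 * pi}. ennreal (cmod (F x) powr enn2real p) \<partial>lborel)"

text \<open>
Borel measurable functions of period \<open>2 \<pi>\<close>. Borel rather than Lebesgue measurability makes
\<open>(x, l) \<mapsto> F (x + l)\<close> measurable for the product of the Borel algebras.
\<close>

definition torus_fun :: "(real \<Rightarrow> complex) \<Rightarrow> bool" where
  "torus_fun F \<longleftrightarrow> F \<in> borel_measurable borel \<and> (\<forall>x. F (x + 2 * pi) = F x)"

text \<open>
The decay exponent \<open>m\<close> of \<open>Lp_norm_sum\<close>: an integer with \<open>(m - 1) p \<ge> 1\<close> if \<open>p < \<infinity>\<close>. For \<open>p = \<infinity>\<close>,
\<open>enn2real p = 0\<close>, hence \<open>1 / enn2real p = 0\<close> and \<open>m = 1\<close>.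
\<close>

definition Lp_power :: "ennreal \<Rightarrow> nat" where
  "Lp_power p = nat \<lceil>1 + 1 / enn2real p\<rceil>"

text \<open>
The constant of \<open>Lp_norm_sum\<close>, which is \<open>S\<^sup>1\<^sup>+\<^sup>1\<^sup>/\<^sup>p\<close>, or \<open>S\<close> for \<open>p = \<infinity>\<close>.
\<close>

definition Lp_const :: "ennreal \<Rightarrow> real \<Rightarrow> real" where
  "Lp_const p S = S * S powr (1 / enn2real p)"

lemma enn2real_pos:
  fixes p :: ennreal
  assumes "0 < p" "p \<noteq> \<infinity>"
  shows "0 < enn2real p"
  using assms by (simp add: enn2real_positive_iff top.not_eq_extremum)

lemma Lp_norm_le_iff:
  assumes "0 < p" "p \<noteq> \<infinity>" "0 \<le> B"
  shows "Lp_norm p F \<le> ennreal B \<longleftrightarrow> Lp_mass p F \<le> ennreal (2 * pi * B powr enn2real p)"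
proof -
  define q where "q = enn2real p"
  have q: "0 < q" unfolding q_def by (rule enn2real_pos) fact+
  have M: "(\<integral>\<^sup>+x\<in>{0..<2 * pi}. ennreal (cmod (F x) powr enn2real p) \<partial>lebesgue) = Lp_mass p F"
    unfolding Lp_mass_def by (rule nn_integral_completion)
  show ?thesis
  proof (cases "Lp_mass p F = \<infinity>")
    case True
    then have "ennreal (1 / (2 * pi)) * Lp_mass p F = \<infinity>"
      by (simp add: ennreal_mult_eq_top_iff)
    then show ?thesis
      using True assms(2) unfolding Lp_norm_def M Let_def by (simp add: top_unique)
  next
    case False
    then obtain x where x: "0 \<le> x" "Lp_mass p F = ennreal x"
      by (cases "Lp_mass p F") auto
    then have I: "ennreal (1 / (2 * pi)) * Lp_mass p F = ennreal (x / (2 * pi))"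
      by (simp add: ennreal_mult[symmetric])
    have "Lp_norm p F = ennreal ((x / (2 * pi)) powr (1 / q))"
      using assms(2) x unfolding Lp_norm_def M Let_def I q_def by simp
    then have "Lp_norm p F \<le> ennreal B \<longleftrightarrow> (x / (2 * pi)) powr (1 / q) \<le> B"
      using assms(3) by (simp add: ennreal_le_iff)
    also have "\<dots> \<longleftrightarrow> x / (2 * pi) \<le> B powr q"
    proof
      assume "(x / (2 * pi)) powr (1 / q) \<le> B"
      then have "((x / (2 * pi)) powr (1 / q)) powr q \<le> B powr q"
        using q by (intro powr_mono2) auto
      then show "x / (2 * pi) \<le> B powr q" using q x by (simp add: powr_powr)
    next
      assume "x / (2 * pi) \<le> B powr q"
      then have "(x / (2 * pi)) powr (1 / q) \<le> (B powr q) powr (1 / q)"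
        using q x by (intro powr_mono2) auto
      then show "(x / (2 * pi)) powr (1 / q) \<le> B" using q assms(3) by (simp add: powr_powr)
    qed
    also have "\<dots> \<longleftrightarrow> x \<le> 2 * pi * B powr q" by (simp add: field_simps)
    also have "\<dots> \<longleftrightarrow> Lp_mass p F \<le> ennreal (2 * pi * B powr q)"
      using x by (simp add: ennreal_le_iff)
    finally show ?thesis by (simp add: q_def)
  qed
qed

lemma Lp_norm_infinity_le_iff:
  assumes "p = \<infinity>" "0 \<le> B"
  shows "Lp_norm p F \<le> ennreal B \<longleftrightarrow> (\<forall>x. cmod (F x) \<le> B)"
  using assms unfolding Lp_norm_def by (simp add: SUP_le_iff ennreal_le_iff)

lemma torus_fun_measurable: "torus_fun F \<Longrightarrow> F \<in> borel_measurable borel"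
  by (simp add: torus_fun_def)

lemma torus_fun_periodic: "torus_fun F \<Longrightarrow> F (x + 2 * pi) = F x"
  by (simp add: torus_fun_def)

lemma torus_fun_cmult: "torus_fun F \<Longrightarrow> torus_fun (\<lambda>x. c * F x)"
  unfolding torus_fun_def by auto

lemma torus_fun_add: "torus_fun F \<Longrightarrow> torus_fun G \<Longrightarrow> torus_fun (\<lambda>x. F x + G x)"
  unfolding torus_fun_def by auto

lemma torus_fun_diff: "torus_fun F \<Longrightarrow> torus_fun G \<Longrightarrow> torus_fun (\<lambda>x. F x - G x)"
  unfolding torus_fun_def by auto

lemma torus_fun_sum: "(\<And>i. i \<in> I \<Longrightarrow> torus_fun (F i)) \<Longrightarrow> torus_fun (\<lambda>x. \<Sum>i\<in>I. F i x)"
  unfolding torus_fun_def by (auto intro!: borel_measurable_sum sum.cong)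

lemma torus_fun_shift: 
  assumes "torus_fun F"
  shows "torus_fun (\<lambda>x. F (x + a))"
proof -
  have [measurable]: "F \<in> borel_measurable borel" using assms by (rule torus_fun_measurable)
  have "F (x + 2 * pi + a) = F (x + a)" for x
    using torus_fun_periodic[OF assms, of "x + a"] by (simp add: algebra_simps)
  moreover have "(\<lambda>x. F (x + a)) \<in> borel_measurable borel" by measurable
  ultimately show ?thesis by (simp add: torus_fun_def)
qed

lemma periodic_int:
  fixes F :: "real \<Rightarrow> 'a"
  assumes "\<And>x. F (x + 2 * pi) = F x"
  shows "F (x + 2 * pi * of_int k) = F x"
proof (induction k rule: int_induct[where k = 0])
  case base show ?case by simp
next
  case (step1 i)
  then show ?case using assms[of "x + 2 * pi * of_int i"] by (simp add: algebra_simps)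
next
  case (step2 i)
  then show ?case using assms[of "x + 2 * pi * of_int (i - 1)"] by (simp add: algebra_simps)
qed

lemma nn_integral_periodic_shift:
  fixes g :: "real \<Rightarrow> ennreal"
  assumes [measurable]: "g \<in> borel_measurable borel" and per: "\<And>x. g (x + 2 * pi) = g x"
  shows "(\<integral>\<^sup>+x\<in>{0..<2 * pi}. g (x + a) \<partial>lborel) = (\<integral>\<^sup>+x\<in>{0..<2 * pi}. g x \<partial>lborel)"
proof -
  define k where "k = \<lfloor>a / (2 * pi)\<rfloor>"
  define b where "b = a - 2 * pi * of_int k"
  have "of_int k \<le> a / (2 * pi)" "a / (2 * pi) < of_int k + 1"
    unfolding k_def by linarith+
  then have b: "0 \<le> b" "b < 2 * pi" unfolding b_def by (simp_all add: field_simps)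
  have "g (x + a) = g (x + b)" for x
    using periodic_int[of g "x + b" k, OF per] by (simp add: b_def algebra_simps)
  then have "(\<integral>\<^sup>+x\<in>{0..<2 * pi}. g (x + a) \<partial>lborel) = (\<integral>\<^sup>+x. g (x + b) * indicator {0..<2 * pi} x \<partial>lborel)"
    by simp
  also have "\<dots> = (\<integral>\<^sup>+x. g (x + b) * indicator {b..<b + 2 * pi} (x + b) \<partial>lborel)"
    by (intro nn_integral_cong) (auto simp: indicator_def)
  also have "\<dots> = (\<integral>\<^sup>+x. g x * indicator {b..<b + 2 * pi} x \<partial>lborel)"
    using nn_integral_real_affine[of "\<lambda>x. g x * indicator {b..<b + 2 * pi} x" 1 b] by (simp add: add.commute)
  also have "\<dots> = (\<integral>\<^sup>+x. g x * indicator {b..<2 * pi} x + g x * indicator {2 * pi..<b + 2 * pi} x \<partial>lborel)"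
    using b by (intro nn_integral_cong) (auto simp: indicator_def)
  also have "\<dots> = (\<integral>\<^sup>+x. g x * indicator {b..<2 * pi} x \<partial>lborel) + (\<integral>\<^sup>+x. g x * indicator {2 * pi..<b + 2 * pi} x \<partial>lborel)"
    by (intro nn_integral_add) measurable
  also have "(\<integral>\<^sup>+x. g x * indicator {2 * pi..<b + 2 * pi} x \<partial>lborel) =
      (\<integral>\<^sup>+x. g (x + 2 * pi) * indicator {2 * pi..<b + 2 * pi} (x + 2 * pi) \<partial>lborel)"
    using nn_integral_real_affine[of "\<lambda>x. g x * indicator {2 * pi..<b + 2 * pi} x" 1 "2 * pi"] 
    by (simp add: add.commute)
  also have "\<dots> = (\<integral>\<^sup>+x. g x * indicator {0..<b} x \<partial>lborel)"
    by (intro nn_integral_cong) (auto simp: indicator_def per)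
  also have "(\<integral>\<^sup>+x. g x * indicator {b..<2 * pi} x \<partial>lborel) + \<dots> =
      (\<integral>\<^sup>+x. g x * indicator {b..<2 * pi} x + g x * indicator {0..<b} x \<partial>lborel)"
    by (rule nn_integral_add[symmetric]) measurable
  also have "\<dots> = (\<integral>\<^sup>+x\<in>{0..<2 * pi}. g x \<partial>lborel)"
    using b by (intro nn_integral_cong) (auto simp: indicator_def)
  finally show ?thesis .
qed

context
  fixes p :: ennreal
  assumes p_pos: "0 < p"
begin

lemma Lp_norm_le_cong:
  assumes "\<And>x. cmod (F x) = cmod (G x)"
  shows "Lp_norm p F = Lp_norm p G"
  using assms unfolding Lp_norm_def by simp

lemma Lp_norm_bounded:
  assumes "\<And>x. cmod (F x) \<le> B"
  shows "Lp_norm p F \<le> ennreal B"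
proof -
  have B: "0 \<le> B" using assms[of 0] norm_ge_zero order_trans by blast
  show ?thesis
  proof (cases "p = \<infinity>")
    case True
    then show ?thesis using assms B by (simp add: Lp_norm_infinity_le_iff)
  next
    case False
    have "Lp_mass p F \<le> (\<integral>\<^sup>+x\<in>{0..<2 * pi}. ennreal (B powr enn2real p) \<partial>lborel)"
      unfolding Lp_mass_def
      by (intro nn_integral_mono mult_right_mono ennreal_leI powr_mono2 assms) auto
    also have "\<dots> = ennreal (2 * pi * B powr enn2real p)"
      by (subst nn_integral_cmult_indicator) (auto simp: ennreal_mult' mult.commute)
    finally show ?thesis using B False p_pos by (auto simp: Lp_norm_le_iff)
  qed
qed

lemma Lp_norm_shift:
  assumes "torus_fun F"
  shows "Lp_norm p (\<lambda>x. F (x + a)) = Lp_norm p F"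
proof (cases "p = \<infinity>")
  case True
  have "(\<lambda>x. ennreal (cmod (F (x + a)))) ` UNIV = (\<lambda>x. ennreal (cmod (F x))) ` (range (\<lambda>x. x + a))"
    by (simp only: image_image)
  also have "range (\<lambda>x. x + a) = UNIV" by (rule surjI[of _ "\<lambda>x. x - a"]) simp
  finally show ?thesis using True by (simp add: Lp_norm_def)
next
  case False
  have [measurable]: "F \<in> borel_measurable borel" using assms by (rule torus_fun_measurable)
  have "Lp_mass p (\<lambda>x. F (x + a)) = Lp_mass p F"
    unfolding Lp_mass_def
    by (rule nn_integral_periodic_shift[of "\<lambda>x. ennreal (cmod (F x) powr enn2real p)"])
       (auto simp: torus_fun_periodic[OF assms])
  then show ?thesis
    using False by (simp add: Lp_norm_def nn_integral_completion Lp_mass_def)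
qed

lemma Lp_norm_cmult:
  assumes "torus_fun F" "Lp_norm p F \<le> ennreal B" "0 \<le> B" "cmod c \<le> C"
  shows "Lp_norm p (\<lambda>x. c * F x) \<le> ennreal (C * B)"
proof (cases "p = \<infinity>")
  case True
  then show ?thesis using assms
    by (auto simp: Lp_norm_infinity_le_iff norm_mult order_trans[OF norm_ge_zero] intro!: mult_mono)
next
  case False
  have C: "0 \<le> C" using assms(4) norm_ge_zero order_trans by blast
  have [measurable]: "F \<in> borel_measurable borel" using assms by (simp add: torus_fun_measurable)
  have "Lp_mass p (\<lambda>x. c * F x) \<le> (\<integral>\<^sup>+x. ennreal (C powr enn2real p) * (ennreal (cmod (F x) powr enn2real p) * indicator {0..<2 * pi} x) \<partial>lborel)"
    unfolding Lp_mass_def 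
    by (intro nn_integral_mono)
       (auto simp: norm_mult powr_mult ennreal_mult'[symmetric] indicator_def intro!: ennreal_leI mult_right_mono powr_mono2 assms)
  also have "\<dots> = ennreal (C powr enn2real p) * Lp_mass p F"
    unfolding Lp_mass_def by (subst nn_integral_cmult) auto
  also have "\<dots> \<le> ennreal (C powr enn2real p) * ennreal (2 * pi * B powr enn2real p)"
    using assms False p_pos by (intro mult_left_mono) (auto simp: Lp_norm_le_iff)
  also have "\<dots> = ennreal (2 * pi * (C * B) powr enn2real p)"
    using assms(3) C by (simp add: ennreal_mult'[symmetric] powr_mult mult_ac)
  finally show ?thesis using False p_pos assms C by (auto simp: Lp_norm_le_iff)
qed

text \<open>
The substitute for the triangle inequality: pointwise \<open>|\<Sum>F\<^sub>i| \<le> \<Sum>w\<^sub>i (|F\<^sub>i| / w\<^sub>i)\<close> is at most \<open>S\<close> times the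
largest \<open>|F\<^sub>i| / w\<^sub>i\<close>, and the \<open>p\<close>-th power of a maximum is at most the sum of the \<open>p\<close>-th powers.
\<close>

lemma Lp_norm_sum:
  assumes fin: "finite I" and F: "\<And>i. i \<in> I \<Longrightarrow> torus_fun (F i)"
    and w: "\<And>i. i \<in> I \<Longrightarrow> 0 < w i \<and> w i \<le> 1" and S: "(\<Sum>i\<in>I. w i) \<le> S" "0 < S" and B: "0 \<le> B"
    and le: "\<And>i. i \<in> I \<Longrightarrow> Lp_norm p (F i) \<le> ennreal (B * w i ^ Lp_power p)"
  shows "Lp_norm p (\<lambda>x. \<Sum>i\<in>I. F i x) \<le> ennreal (Lp_const p S * B)"
proof -
  have weighted: "(\<Sum>i\<in>I. cmod (F i x)) \<le> S * y" if "0 \<le> y" "\<And>i. i \<in> I \<Longrightarrow> cmod (F i x) \<le> w i * y" for x y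
  proof -
    have "(\<Sum>i\<in>I. cmod (F i x)) \<le> (\<Sum>i\<in>I. w i * y)" by (intro sum_mono that)
    also have "\<dots> \<le> S * y" using S(1) \<open>0 \<le> y\<close> by (simp add: sum_distrib_right[symmetric] mult_right_mono)
    finally show ?thesis .
  qed
  show ?thesis
  proof (cases "p = \<infinity>")
    case True
    have "cmod (\<Sum>i\<in>I. F i x) \<le> S * B" for x
    proof -
      have "cmod (\<Sum>i\<in>I. F i x) \<le> (\<Sum>i\<in>I. cmod (F i x))" by (rule norm_sum)
      also have "\<dots> \<le> S * B"
      proof (rule weighted[OF B])
        fix i assume "i \<in> I"
        then show "cmod (F i x) \<le> w i * B"
          using le[of i] w[of i] True B by (simp add: Lp_norm_infinity_le_iff Lp_power_def mult.commute)
      qed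
      finally show ?thesis .
    qed
    then show ?thesis using True S B by (simp add: Lp_norm_infinity_le_iff Lp_const_def)
  next
    case False
    define q where "q = enn2real p"
    define m where "m = Lp_power p"
    have q: "0 < q" unfolding q_def using False p_pos by (intro enn2real_pos)
    have [measurable]: "\<And>i. i \<in> I \<Longrightarrow> F i \<in> borel_measurable borel" using F by (simp add: torus_fun_measurable)
    have mq: "real m * q \<ge> 1 + q"
    proof -
      have "real m \<ge> 1 + 1 / q" unfolding m_def Lp_power_def q_def
        by (meson of_nat_ceiling)
      then have "real m * q \<ge> (1 + 1 / q) * q" using q by (intro mult_right_mono) auto
      moreover have "(1 + 1 / q) * q = 1 + q" using q by (simp add: distrib_right)
      ultimately show ?thesis by simp
    qed
    have pointwise: "cmod (\<Sum>i\<in>I. F i x) powr q \<le> (\<Sum>i\<in>I. S powr q * w i powr (- q) * cmod (F i x) powr q)" for x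
    proof (cases "I = {}")
      case True then show ?thesis by simp
    next
      case ne: False
      define y where "y = Max ((\<lambda>i. cmod (F i x) / w i) ` I)"
      have "y \<in> (\<lambda>i. cmod (F i x) / w i) ` I"
        unfolding y_def using fin ne by (intro Max_in) auto
      then obtain i0 where i0: "i0 \<in> I" "y = cmod (F i0 x) / w i0" by auto
      have y0: "0 \<le> y" using i0 w[of i0] by simp
      have "cmod (F i x) / w i \<le> y" if "i \<in> I" for i unfolding y_def using fin that by (intro Max_ge) auto
      from this w have yi: "cmod (F i x) \<le> w i * y" if "i \<in> I" for i
        using that by (metis mult.commute pos_divide_le_eq)
      have "cmod (\<Sum>i\<in>I. F i x) \<le> (\<Sum>i\<in>I. cmod (F i x))" by (rule norm_sum)
      also have "\<dots> \<le> S * y" by (rule weighted[OF y0 yi])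
      finally have "cmod (\<Sum>i\<in>I. F i x) powr q \<le> (S * y) powr q" using q by (intro powr_mono2) auto
      also have "\<dots> = S powr q * w i0 powr (- q) * cmod (F i0 x) powr q"
        unfolding i0(2) using i0(1) w[of i0] S by (simp add: powr_mult powr_minus inverse_powr divide_inverse mult_ac)
      also have "\<dots> \<le> (\<Sum>i\<in>I. S powr q * w i powr (- q) * cmod (F i x) powr q)"
        using fin i0(1) by (intro member_le_sum[where f = "\<lambda>i. S powr q * w i powr (- q) * cmod (F i x) powr q"]) auto
      finally show ?thesis .
    qed
    have "Lp_mass p (\<lambda>x. \<Sum>i\<in>I. F i x) \<le> 
        (\<integral>\<^sup>+x. (\<Sum>i\<in>I. ennreal (S powr q * w i powr (- q)) * (ennreal (cmod (F i x) powr q) * indicator {0..<2 * pi} x)) \<partial>lborel)"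
      unfolding Lp_mass_def q_def[symmetric]
    proof (intro nn_integral_mono)
      fix x
      have "ennreal (cmod (\<Sum>i\<in>I. F i x) powr q) \<le> (\<Sum>i\<in>I. ennreal (S powr q * w i powr (- q)) * ennreal (cmod (F i x) powr q))"
        using pointwise[of x] by (subst ennreal_mult'[symmetric]) (auto intro!: ennreal_leI)
      then show "ennreal (cmod (\<Sum>i\<in>I. F i x) powr q) * indicator {0..<2 * pi} x \<le>
        (\<Sum>i\<in>I. ennreal (S powr q * w i powr (- q)) * (ennreal (cmod (F i x) powr q) * indicator {0..<2 * pi} x))"
        by (auto simp: indicator_def)
    qed
    also have "\<dots> = (\<Sum>i\<in>I. ennreal (S powr q * w i powr (- q)) * Lp_mass p (F i))"
      unfolding Lp_mass_def q_def[symmetric]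
      by (subst nn_integral_sum, measurable) (intro sum.cong refl nn_integral_cmult, measurable)
    also have "\<dots> \<le> (\<Sum>i\<in>I. ennreal (2 * pi * S powr q * B powr q * w i))"
    proof (intro sum_mono)
      fix i assume i: "i \<in> I"
      have wi: "0 < w i" "w i \<le> 1" using w[OF i] by auto
      have "Lp_mass p (F i) \<le> ennreal (2 * pi * (B * w i ^ m) powr q)"
        using le[OF i] B wi False p_pos by (simp add: Lp_norm_le_iff q_def m_def)
      then have "ennreal (S powr q * w i powr (- q)) * Lp_mass p (F i) \<le> ennreal (S powr q * w i powr (- q)) * ennreal (2 * pi * (B * w i ^ m) powr q)"
        by (intro mult_left_mono) auto
      also have "\<dots> = ennreal (2 * pi * S powr q * B powr q * (w i powr (- q) * (w i ^ m) powr q))"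
        using B wi by (simp add: ennreal_mult'[symmetric] powr_mult mult_ac)
      also have "w i powr (- q) * (w i ^ m) powr q = w i powr (real m * q - q)"
        using wi by (simp add: powr_realpow[symmetric] powr_powr powr_add[symmetric])
      also have "ennreal (2 * pi * S powr q * B powr q * w i powr (real m * q - q)) \<le> ennreal (2 * pi * S powr q * B powr q * w i powr 1)"
        using mq wi by (intro ennreal_leI mult_left_mono powr_mono') auto
      finally show "ennreal (S powr q * w i powr (- q)) * Lp_mass p (F i) \<le> ennreal (2 * pi * S powr q * B powr q * w i)"
        using wi by simp
    qed
    also have "\<dots> = ennreal (2 * pi * S powr q * B powr q * (\<Sum>i\<in>I. w i))"
      using w by (subst sum_ennreal) (auto simp: sum_distrib_left less_imp_le)
    also have "\<dots> \<le> ennreal (2 * pi * S powr q * B powr q * S)"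
      using S by (intro ennreal_leI mult_left_mono) auto
    also have "\<dots> = ennreal (2 * pi * (Lp_const p S * B) powr q)"
      using S B q by (simp add: Lp_const_def q_def[symmetric] powr_mult powr_powr mult_ac)
    finally show ?thesis using False p_pos S B by (simp add: Lp_norm_le_iff q_def Lp_const_def)
  qed
qed

end

section \<open>Differences and sums of translates\<close>

text \<open>
The first difference, with the sign convention of \<^const>\<open>difference\<close>: the \<open>k\<close>-th difference is its \<open>k\<close>-th iterate.
\<close>

definition fdiff :: "real \<Rightarrow> (real \<Rightarrow> complex) \<Rightarrow> real \<Rightarrow> complex" where
  "fdiff \<delta> F = (\<lambda>x. F x - F (x + \<delta>))"

lemma difference_Suc:
  "difference (Suc k) \<delta> F x = difference k \<delta> F x - difference k \<delta> F (x + \<delta>)"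
proof -
  define t where "t = (\<lambda>\<nu>. F (x + real \<nu> * \<delta>))"
  have shift: "F (x + \<delta> + real \<nu> * \<delta>) = t (Suc \<nu>)" for \<nu>
    by (simp add: t_def algebra_simps)
  have "difference (Suc k) \<delta> F x = t 0 + (\<Sum>\<nu>=0..k. (-1) ^ Suc \<nu> * of_nat (Suc k choose Suc \<nu>) * t (Suc \<nu>))"
    unfolding difference_def by (subst sum.atLeast0_atMost_Suc_shift) (simp add: comp_def t_def)
  also have "\<dots> = t 0 + (\<Sum>\<nu>=0..k. (-1) ^ Suc \<nu> * of_nat (k choose Suc \<nu>) * t (Suc \<nu>))
      - (\<Sum>\<nu>=0..k. (-1) ^ \<nu> * of_nat (k choose \<nu>) * t (Suc \<nu>))"
    by (simp add: sum.distrib[symmetric] sum_negf[symmetric] sum_subtractf[symmetric] algebra_simps)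
  also have "t 0 + (\<Sum>\<nu>=0..k. (-1) ^ Suc \<nu> * of_nat (k choose Suc \<nu>) * t (Suc \<nu>)) = (\<Sum>\<nu>=0..Suc k. (-1) ^ \<nu> * of_nat (k choose \<nu>) * t \<nu>)"
    by (subst sum.atLeast0_atMost_Suc_shift) (simp add: comp_def)
  also have "\<dots> = difference k \<delta> F x"
    by (simp add: difference_def t_def)
  finally show ?thesis by (simp add: difference_def shift)
qed

lemma difference_0 [simp]: "difference 0 \<delta> F = F"
  by (rule ext) (simp add: difference_def)

lemma difference_eq_funpow: "difference k \<delta> F = (fdiff \<delta> ^^ k) F"
proof (induction k)
  case 0
  show ?case by (simp add: difference_def)
next
  case (Suc k)
  have "difference (Suc k) \<delta> F = fdiff \<delta> (difference k \<delta> F)"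
    by (rule ext) (simp add: fdiff_def difference_Suc)
  then show ?case by (simp add: Suc)
qed

lemma torus_fun_fdiff: "torus_fun F \<Longrightarrow> torus_fun (fdiff \<delta> F)"
  unfolding fdiff_def by (intro torus_fun_diff torus_fun_shift)

lemma torus_fun_difference: "torus_fun F \<Longrightarrow> torus_fun (difference k \<delta> F)"
  unfolding difference_eq_funpow by (induction k) (auto intro: torus_fun_fdiff)

lemma difference_sum: "difference k \<delta> (\<lambda>x. \<Sum>i\<in>I. c i * F i x) = (\<lambda>x. \<Sum>i\<in>I. c i * difference k \<delta> (F i) x)"
  unfolding difference_def sum_distrib_left
  by (subst sum.swap) (simp add: mult_ac)

lemma difference_diff: "difference k \<delta> (\<lambda>x. F x - G x) = (\<lambda>x. difference k \<delta> F x - difference k \<delta> G x)"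
  unfolding difference_def by (simp add: algebra_simps sum_subtractf)

lemma difference_shift: "difference k \<delta> (\<lambda>x. F (x + a)) = (\<lambda>x. difference k \<delta> F (x + a))"
  unfolding difference_def by (simp add: add_ac)

lemma sum_inverse_square_int:
  fixes I :: "int set"
  assumes "finite I"
  shows "(\<Sum>j\<in>I. 1 / (1 + real_of_int \<bar>j\<bar>) ^ 2) \<le> 3"
proof -
  have sym: "(\<Sum>j\<in>{- int K..int K}. 1 / (1 + real_of_int \<bar>j\<bar>) ^ 2) \<le> 3 - 2 / (real K + 1)" for K
  proof (induction K)
    case 0
    show ?case by simp
  next
    case (Suc K)
    have "{- int (Suc K)..int (Suc K)} = insert (- int (Suc K)) (insert (int (Suc K)) {- int K..int K})"
      by auto
    then have "(\<Sum>j\<in>{- int (Suc K)..int (Suc K)}. 1 / (1 + real_of_int \<bar>j\<bar>) ^ 2)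
        = 2 / (real K + 2) ^ 2 + (\<Sum>j\<in>{- int K..int K}. 1 / (1 + real_of_int \<bar>j\<bar>) ^ 2)"
      by (simp add: add.commute)
    also have "\<dots> \<le> 2 / (real K + 2) ^ 2 + (3 - 2 / (real K + 1))" using Suc by simp
    also have "2 / (real K + 2) ^ 2 \<le> 2 / ((real K + 1) * (real K + 2))"
      by (intro divide_left_mono) (auto simp: power2_eq_square intro!: mult_right_mono)
    also have "2 / ((real K + 1) * (real K + 2)) = 2 / (real K + 1) - 2 / (real K + 2)"
      by (simp add: field_simps)
    finally show ?case by (simp add: add.commute)
  qed
  define K where "K = nat (Max (insert 0 (abs ` I)))"
  have "I \<subseteq> {- int K..int K}"
  proof
    fix j assume "j \<in> I"
    then have "\<bar>j\<bar> \<le> Max (insert 0 (abs ` I))" using assms by (intro Max_ge) auto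
    then show "j \<in> {- int K..int K}" by (auto simp: K_def)
  qed
  then have "(\<Sum>j\<in>I. 1 / (1 + real_of_int \<bar>j\<bar>) ^ 2) \<le> (\<Sum>j\<in>{- int K..int K}. 1 / (1 + real_of_int \<bar>j\<bar>) ^ 2)"
    by (intro sum_mono2) auto
  also have "\<dots> \<le> 3" using sym[of K] by (rule order_trans) simp
  finally show ?thesis .
qed

text \<open>
The operator \<open>I - V\<close>, where \<open>V\<close> is the discrete convolution \<open>\<Sum>v\<^sub>j F(x + j \<delta>)\<close>. It commutes with differences.
\<close>

definition residual :: "int set \<Rightarrow> (int \<Rightarrow> complex) \<Rightarrow> real \<Rightarrow> (real \<Rightarrow> complex) \<Rightarrow> real \<Rightarrow> complex" where
  "residual I v \<delta> F = (\<lambda>x. F x - (\<Sum>j\<in>I. v j * F (x + of_int j * \<delta>)))"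

lemma torus_fun_residual: "torus_fun F \<Longrightarrow> torus_fun (residual I v \<delta> F)"
  unfolding residual_def by (intro torus_fun_diff torus_fun_sum torus_fun_cmult torus_fun_shift)

lemma difference_residual: "difference k h (residual I v \<delta> F) = residual I v \<delta> (difference k h F)"
  unfolding residual_def by (simp add: difference_diff difference_sum difference_shift)

lemma Lp_const_nonneg: "0 \<le> S \<Longrightarrow> 0 \<le> Lp_const p S"
  by (simp add: Lp_const_def)

lemma Lp_const_ge: "1 \<le> S \<Longrightarrow> 1 \<le> Lp_const p S"
  unfolding Lp_const_def using ge_one_powr_ge_zero[of S "1 / enn2real p"]
  by (metis (no_types) divide_nonneg_nonneg enn2real_nonneg mult_mono' mult_1 zero_le_one)

lemma Lp_const_1 [simp]: "Lp_const p 1 = 1"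
  by (simp add: Lp_const_def)

lemma Lp_power_pos: "1 \<le> Lp_power p"
proof -
  have "(1::real) \<le> 1 + 1 / enn2real p" by simp
  then have "1 \<le> \<lceil>1 + 1 / enn2real p\<rceil>" by linarith
  then have "nat 1 \<le> Lp_power p" unfolding Lp_power_def by (rule nat_mono)
  then show ?thesis by simp
qed

context
  fixes p :: ennreal
  assumes p_pos: "0 < p"
begin

text \<open>
The weights are \<open>w\<^sub>j = (1 + |j|)\<^sup>-\<^sup>2\<close>, so decay of order \<open>2 m\<close> suffices for sums over integers.
\<close>

lemma Lp_norm_sum_int:
  assumes "finite (I :: int set)" "\<And>j. j \<in> I \<Longrightarrow> torus_fun (F j)" "0 \<le> B"
    and "\<And>j. j \<in> I \<Longrightarrow> Lp_norm p (F j) \<le> ennreal (B / (1 + real_of_int \<bar>j\<bar>) ^ (2 * Lp_power p))"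
  shows "Lp_norm p (\<lambda>x. \<Sum>j\<in>I. F j x) \<le> ennreal (Lp_const p 3 * B)"
proof (rule Lp_norm_sum[OF p_pos assms(1,2), where w = "\<lambda>j. 1 / (1 + real_of_int \<bar>j\<bar>) ^ 2"])
  show "0 < 1 / (1 + real_of_int \<bar>j\<bar>) ^ 2 \<and> 1 / (1 + real_of_int \<bar>j\<bar>) ^ 2 \<le> 1" for j
    by (simp add: one_le_power)
  show "(\<Sum>j\<in>I. 1 / (1 + real_of_int \<bar>j\<bar>) ^ 2) \<le> 3" by (rule sum_inverse_square_int) fact
qed (use assms in \<open>auto simp: power_divide power_mult\<close>)

lemma Lp_norm_conv:
  assumes "finite (I :: int set)" "torus_fun F" "Lp_norm p F \<le> ennreal B" "0 \<le> B" "0 \<le> A"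
    and v: "\<And>j. j \<in> I \<Longrightarrow> cmod (v j) \<le> A / (1 + real_of_int \<bar>j\<bar>) ^ (2 * Lp_power p)"
  shows "Lp_norm p (\<lambda>x. \<Sum>j\<in>I. v j * F (x + s j)) \<le> ennreal (Lp_const p 3 * (A * B))"
proof (rule Lp_norm_sum_int)
  fix j assume j: "j \<in> I"
  have "Lp_norm p (\<lambda>x. v j * F (x + s j)) \<le> ennreal (A / (1 + real_of_int \<bar>j\<bar>) ^ (2 * Lp_power p) * B)"
    using assms(2-4) v[OF j] by (intro Lp_norm_cmult torus_fun_shift) (auto simp: p_pos Lp_norm_shift)
  then show "Lp_norm p (\<lambda>x. v j * F (x + s j)) \<le> ennreal (A * B / (1 + real_of_int \<bar>j\<bar>) ^ (2 * Lp_power p))"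
    by simp
qed (use assms in \<open>auto intro!: torus_fun_cmult torus_fun_shift\<close>)

lemma Lp_norm_add:
  assumes "torus_fun F" "torus_fun G" "Lp_norm p F \<le> ennreal A" "Lp_norm p G \<le> ennreal B" "0 \<le> A" "0 \<le> B"
  shows "Lp_norm p (\<lambda>x. F x + G x) \<le> ennreal (Lp_const p 2 * (A + B))"
proof -
  have "Lp_norm p (\<lambda>x. \<Sum>i\<in>UNIV. (if i then F else G) x) \<le> ennreal (Lp_const p 2 * (A + B))"
  proof (rule Lp_norm_sum[OF p_pos, where w = "\<lambda>_. 1"])
    fix i :: bool
    show "Lp_norm p (if i then F else G) \<le> ennreal ((A + B) * 1 ^ Lp_power p)"
      using assms(3-6) by (auto intro: order_trans intro!: ennreal_leI)
  qed (use assms in auto)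
  then show ?thesis by (simp add: UNIV_bool add.commute)
qed

lemma Lp_norm_diff:
  assumes "torus_fun F" "torus_fun G" "Lp_norm p F \<le> ennreal A" "Lp_norm p G \<le> ennreal B" "0 \<le> A" "0 \<le> B"
  shows "Lp_norm p (\<lambda>x. F x - G x) \<le> ennreal (Lp_const p 2 * (A + B))"
proof -
  have "Lp_norm p (\<lambda>x. (-1) * G x) = Lp_norm p G" by (intro Lp_norm_le_cong p_pos) simp
  then show ?thesis
    using Lp_norm_add[of F "\<lambda>x. (-1) * G x" A B] assms torus_fun_cmult[of G "-1"] by simp
qed

lemma Lp_norm_difference_le:
  assumes "torus_fun F" "Lp_norm p F \<le> ennreal B" "0 \<le> B"
  shows "Lp_norm p (difference k \<delta> F) \<le> ennreal ((2 * Lp_const p 2) ^ k * B)"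
proof (induction k)
  case 0
  show ?case using assms by (simp add: difference_def)
next
  case (Suc k)
  have eq: "difference (Suc k) \<delta> F = (\<lambda>x. difference k \<delta> F x - difference k \<delta> F (x + \<delta>))"
    by (rule ext) (rule difference_Suc)
  let ?B = "(2 * Lp_const p 2) ^ k * B"
  have "Lp_norm p (\<lambda>x. difference k \<delta> F x - difference k \<delta> F (x + \<delta>)) \<le> ennreal (Lp_const p 2 * (?B + ?B))"
    using Suc assms
    by (intro Lp_norm_diff torus_fun_shift torus_fun_difference) 
       (auto simp: p_pos Lp_norm_shift torus_fun_difference Lp_const_nonneg)
  then show ?case unfolding eq by (simp add: mult_ac)
qed

text \<open>
A difference with step \<open>j \<delta>\<close> is a sum of \<open>|j|\<close> translates of the difference with step \<open>\<delta>\<close>; equal weights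
\<open>1 / |j|\<close> give the loss \<open>|j|\<^sup>m\<close>.
\<close>

lemma Lp_norm_multiple_step:
  assumes F: "torus_fun F" "Lp_norm p (fdiff \<delta> F) \<le> ennreal B" "0 \<le> B"
  shows "Lp_norm p (fdiff (of_int j * \<delta>) F) \<le> ennreal ((1 + real_of_int \<bar>j\<bar>) ^ Lp_power p * B)"
proof -
  have nat: "Lp_norm p (fdiff (real l * \<delta>) F) \<le> ennreal ((1 + real l) ^ Lp_power p * B)" for l
  proof (cases "l = 0")
    case True
    have "Lp_norm p (fdiff (real l * \<delta>) F) \<le> ennreal 0"
      using True by (intro Lp_norm_bounded p_pos) (simp add: fdiff_def)
    then show ?thesis by (rule order_trans) (simp add: F(3))
  next
    case False
    have "fdiff (real l * \<delta>) F = (\<lambda>x. \<Sum>i<l. fdiff \<delta> F (x + real i * \<delta>))"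
    proof
      fix x
      have "(\<Sum>i<l. fdiff \<delta> F (x + real i * \<delta>)) = (\<Sum>i<l. F (x + real i * \<delta>) - F (x + real (Suc i) * \<delta>))"
        by (simp add: fdiff_def algebra_simps)
      also have "\<dots> = F x - F (x + real l * \<delta>)" by (subst sum_lessThan_telescope') simp
      finally show "fdiff (real l * \<delta>) F x = (\<Sum>i<l. fdiff \<delta> F (x + real i * \<delta>))" by (simp add: fdiff_def)
    qed
    moreover have "Lp_norm p (\<lambda>x. \<Sum>i<l. fdiff \<delta> F (x + real i * \<delta>)) \<le> ennreal (Lp_const p 1 * (real l ^ Lp_power p * B))"
    proof (rule Lp_norm_sum[OF p_pos, where w = "\<lambda>_. 1 / real l"])
      fix i
      have "Lp_norm p (\<lambda>x. fdiff \<delta> F (x + real i * \<delta>)) = Lp_norm p (fdiff \<delta> F)"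
        by (intro Lp_norm_shift p_pos torus_fun_fdiff F)
      then show "Lp_norm p (\<lambda>x. fdiff \<delta> F (x + real i * \<delta>)) \<le> ennreal (real l ^ Lp_power p * B * (1 / real l) ^ Lp_power p)"
        using F False by (simp add: power_divide)
    qed (use F False in \<open>auto intro!: torus_fun_fdiff torus_fun_shift\<close>)
    ultimately have "Lp_norm p (fdiff (real l * \<delta>) F) \<le> ennreal (real l ^ Lp_power p * B)" by simp
    also have "\<dots> \<le> ennreal ((1 + real l) ^ Lp_power p * B)"
      using F by (intro ennreal_leI mult_right_mono power_mono) auto
    finally show ?thesis .
  qed
  show ?thesis
  proof (cases "0 \<le> j")
    case True
    then show ?thesis using nat[of "nat j"] by simp
  next
    case False
    define l where "l = nat (- j)"
    have j: "real_of_int j = - real l" using False by (simp add: l_def)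
    have "Lp_norm p (fdiff (of_int j * \<delta>) F) = Lp_norm p (\<lambda>x. fdiff (real l * \<delta>) F (x + - (real l * \<delta>)))"
      by (intro Lp_norm_le_cong p_pos) (simp add: fdiff_def j norm_minus_commute)
    also have "\<dots> = Lp_norm p (fdiff (real l * \<delta>) F)"
      by (intro Lp_norm_shift p_pos torus_fun_fdiff F)
    finally show ?thesis using nat[of l] False j by simp
  qed
qed

text \<open>
If the \<open>v\<^sub>j\<close> sum to \<open>1\<close>, then \<open>(I - V) F\<close> is the sum of the \<open>v\<^sub>j (F - F(\<cdot> + j \<delta>))\<close>; of the decay \<open>3 m\<close> of the
coefficients, \<open>m\<close> is spent on the differences with step \<open>j \<delta>\<close>.
\<close>

lemma Lp_norm_residual_le:
  assumes I: "finite I" and F: "torus_fun F" and v1: "(\<Sum>j\<in>I. v j) = 1"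
    and v: "\<And>j. j \<in> I \<Longrightarrow> cmod (v j) \<le> A / (1 + real_of_int \<bar>j\<bar>) ^ (3 * Lp_power p)"
    and A: "0 \<le> A" and B: "0 \<le> B" "Lp_norm p (fdiff \<delta> F) \<le> ennreal B"
  shows "Lp_norm p (residual I v \<delta> F) \<le> ennreal (Lp_const p 3 * A * B)"
proof -
  let ?m = "Lp_power p"
  have "residual I v \<delta> F x = (\<Sum>j\<in>I. v j) * F x - (\<Sum>j\<in>I. v j * F (x + of_int j * \<delta>))" for x
    by (simp add: residual_def v1)
  then have eq: "residual I v \<delta> F = (\<lambda>x. \<Sum>j\<in>I. v j * fdiff (of_int j * \<delta>) F x)"
    by (simp add: fun_eq_iff fdiff_def sum_distrib_right sum_subtractf[symmetric] right_diff_distrib)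
  have "Lp_norm p (\<lambda>x. \<Sum>j\<in>I. v j * fdiff (of_int j * \<delta>) F x) \<le> ennreal (Lp_const p 3 * (A * B))"
  proof (rule Lp_norm_sum_int[OF I])
    fix j assume j: "j \<in> I"
    let ?d = "1 + real_of_int \<bar>j\<bar>"
    have "Lp_norm p (\<lambda>x. v j * fdiff (of_int j * \<delta>) F x) \<le> ennreal (A / ?d ^ (3 * ?m) * (?d ^ ?m * B))"
      using F B v[OF j] by (intro Lp_norm_cmult p_pos torus_fun_fdiff Lp_norm_multiple_step) auto
    also have "?d ^ (3 * ?m) = ?d ^ (2 * ?m) * ?d ^ ?m" by (simp flip: power_add)
    also have "A / (?d ^ (2 * ?m) * ?d ^ ?m) * (?d ^ ?m * B) = A * B / ?d ^ (2 * ?m)" by simp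
    finally show "Lp_norm p (\<lambda>x. v j * fdiff (of_int j * \<delta>) F x) \<le> ennreal (A * B / ?d ^ (2 * ?m))" .
  qed (use F A B in \<open>auto intro!: torus_fun_fdiff torus_fun_cmult\<close>)
  then show ?thesis by (simp add: eq mult.assoc)
qed

lemma Lp_norm_residual_power_le:
  assumes I: "finite I" and F: "torus_fun F" and v1: "(\<Sum>j\<in>I. v j) = 1"
    and v: "\<And>j. j \<in> I \<Longrightarrow> cmod (v j) \<le> A / (1 + real_of_int \<bar>j\<bar>) ^ (3 * Lp_power p)"
    and A: "0 \<le> A" and B: "0 \<le> B" "Lp_norm p (difference k \<delta> F) \<le> ennreal B"
  shows "Lp_norm p ((residual I v \<delta> ^^ k) F) \<le> ennreal ((Lp_const p 3 * A) ^ k * B)"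
  using F B
proof (induction k arbitrary: F B)
  case 0
  then show ?case by (simp add: difference_def)
next
  case (Suc k)
  have "difference (Suc k) \<delta> F = fdiff \<delta> (difference k \<delta> F)"
    by (simp add: difference_eq_funpow)
  then have "Lp_norm p (residual I v \<delta> (difference k \<delta> F)) \<le> ennreal (Lp_const p 3 * A * B)"
    using Suc.prems by (intro Lp_norm_residual_le I v1 v A torus_fun_difference) auto
  then have "Lp_norm p ((residual I v \<delta> ^^ k) (residual I v \<delta> F)) \<le> ennreal ((Lp_const p 3 * A) ^ k * (Lp_const p 3 * A * B))"
    using Suc.prems A by (intro Suc.IH torus_fun_residual) (auto simp: difference_residual Lp_const_nonneg)
  then show ?case by (simp add: funpow_swap1 mult_ac)
qed

end

section \<open>Choosing a shift, continuity of translation, Borel representatives\<close>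

lemma AE_shift:
  fixes P :: "real \<Rightarrow> bool"
  assumes "AE x in lborel. P x"
  shows "AE x in lborel. P (x + a)"
proof -
  obtain N where N: "N \<in> null_sets lborel" "{x. \<not> P x} \<subseteq> N"
    using assms by (auto simp: eventually_ae_filter)
  have [measurable]: "N \<in> sets borel" using N(1) by auto
  have "AE x in lborel. x \<notin> N" using N(1) by (rule AE_not_in)
  then have "AE x in lborel. a + 1 * x \<notin> N" by (intro AE_borel_affine) auto
  then show ?thesis using N(2) by (auto elim!: eventually_mono simp: add.commute)
qed

lemma Lp_norm_difference_cong_AE:
  assumes "p \<noteq> \<infinity>" "AE x in lborel. f x = g x"
  shows "Lp_norm p (difference k \<delta> f) = Lp_norm p (difference k \<delta> g)"
proof -
  have "AE x in lborel. \<forall>\<nu>\<in>{0..k}. f (x + real \<nu> * \<delta>) = g (x + real \<nu> * \<delta>)"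
    using AE_shift[OF assms(2)] by (intro AE_finite_allI) auto
  then have "AE x in lborel. difference k \<delta> f x = difference k \<delta> g x"
    by eventually_elim (auto simp: difference_def intro!: sum.cong)
  then have "(\<integral>\<^sup>+x\<in>{0..<2 * pi}. ennreal (cmod (difference k \<delta> f x) powr enn2real p) \<partial>lborel)
      = (\<integral>\<^sup>+x\<in>{0..<2 * pi}. ennreal (cmod (difference k \<delta> g x) powr enn2real p) \<partial>lborel)"
    by (intro nn_integral_cong_AE) auto
  then show ?thesis using assms(1) by (simp add: Lp_norm_def nn_integral_completion)
qed

text \<open>
A Borel function equal to \<open>f\<close> almost everywhere becomes periodic when each \<open>x\<close> is replaced by its representative
in \<open>[0, 2 \<pi>)\<close>; only countably many translates of a null set are lost.
\<close>

lemma torus_fun_representative: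
  assumes f: "f \<in> borel_measurable lebesgue" and per: "\<And>x. f (x + 2 * pi) = f x"
  obtains g where "torus_fun g" "AE x in lborel. f x = g x"
proof -
  have "(\<lambda>x. Re (f x)) \<in> borel_measurable lebesgue" "(\<lambda>x. Im (f x)) \<in> borel_measurable lebesgue"
    using f by measurable
  then obtain u v where [measurable]: "u \<in> borel_measurable lborel" "v \<in> borel_measurable lborel"
    and uv: "AE x in lborel. Re (f x) = u x" "AE x in lborel. Im (f x) = v x"
    using completion_ex_borel_measurable_real by metis
  define g0 where "g0 = (\<lambda>x. Complex (u x) (v x))"
  have "g0 = (\<lambda>x. complex_of_real (u x) + \<i> * complex_of_real (v x))" 
    by (simp add: g0_def fun_eq_iff complex_eq_iff)
  then have [measurable]: "g0 \<in> borel_measurable borel" by simp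
  have "AE x in lborel. f x = g0 x"
    using uv by eventually_elim (simp add: g0_def complex_eq_iff)
  then have "AE x in lborel. \<forall>k::int. f (x + 2 * pi * of_int k) = g0 (x + 2 * pi * of_int k)"
    unfolding AE_all_countable by (intro allI AE_shift)
  moreover define g where "g = (\<lambda>x. g0 (x + 2 * pi * of_int (- \<lfloor>x / (2 * pi)\<rfloor>)))"
  ultimately have "AE x in lborel. f x = g x"
    by (auto elim!: eventually_mono simp: periodic_int[of f, OF per] simp del: of_int_minus)
  moreover have "torus_fun g"
  proof -
    have "g (x + 2 * pi) = g x" for x
    proof -
      have "(x + 2 * pi) / (2 * pi) = x / (2 * pi) + 1" by (simp add: field_simps)
      then have "\<lfloor>(x + 2 * pi) / (2 * pi)\<rfloor> = \<lfloor>x / (2 * pi)\<rfloor> + 1" by simp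
      then show ?thesis by (simp add: g_def algebra_simps)
    qed
    then show ?thesis unfolding torus_fun_def g_def by simp
  qed
  ultimately show ?thesis using that by blast
qed

lemma powr_norm_add3_le:
  fixes a b c :: real
  assumes "0 \<le> a" "0 \<le> b" "0 \<le> c" "0 < q"
  shows "(a + b + c) powr q \<le> 3 powr q * (a powr q + b powr q + c powr q)"
proof -
  define y where "y = max a (max b c)"
  have "(a + b + c) powr q \<le> (3 * y) powr q" using assms by (intro powr_mono2) (auto simp: y_def)
  also have "\<dots> = 3 powr q * y powr q" using assms by (simp add: powr_mult y_def)
  also have "y powr q \<le> a powr q + b powr q + c powr q"
    unfolding y_def max_def by auto
  finally show ?thesis by simp
qed

lemma measurable_pair_compose:
  assumes "case_prod H \<in> borel_measurable (borel \<Otimes>\<^sub>M borel)"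
    and "u \<in> borel_measurable M" "v \<in> borel_measurable M"
  shows "(\<lambda>x. H (u x) (v x)) \<in> borel_measurable M"
  using measurable_compose[OF measurable_Pair[OF assms(2,3)] assms(1)] by simp

context
  fixes p :: ennreal
  assumes p_pos: "0 < p"
begin

text \<open>
If the norm along every diagonal \<open>l = x + s\<close> is at most \<open>B\<close>, so is the norm along some line \<open>l\<close> constant: for
\<open>p < \<infinity>\<close> the two families have the same average of \<open>p\<close>-th powers, by Fubini and periodicity in \<open>l\<close>.
\<close>

lemma Lp_norm_choose_parameter:
  assumes G: "case_prod G \<in> borel_measurable (borel \<Otimes>\<^sub>M borel)"
    and per: "\<And>x l. G x (l + 2 * pi) = G x l"
    and B: "0 \<le> B" "\<And>s. Lp_norm p (\<lambda>x. G x (x + s)) \<le> ennreal B"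
  obtains l where "Lp_norm p (\<lambda>x. G x l) \<le> ennreal B"
proof (cases "p = \<infinity>")
  case True
  have "cmod (G x 0) \<le> B" for x
    using B(2)[of "-x"] B(1) True by (auto simp: Lp_norm_infinity_le_iff dest: spec[of _ x])
  then have "Lp_norm p (\<lambda>x. G x 0) \<le> ennreal B" by (rule Lp_norm_bounded[OF p_pos])
  then show ?thesis by (rule that)
next
  case False
  define q where "q = enn2real p"
  define c where "c = 2 * pi * B powr q"
  define I where "I = {0..<2 * pi}"
  define g where "g x l = ennreal (cmod (G x l) powr q)" for x l
  have G'[measurable]: "(\<lambda>z. G (fst z) (snd z)) \<in> borel_measurable (borel \<Otimes>\<^sub>M borel)"
    using G by (simp add: case_prod_beta)
  have gm: "case_prod g \<in> borel_measurable (borel \<Otimes>\<^sub>M borel)"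
    unfolding g_def case_prod_beta by measurable
  note g2 = measurable_pair_compose[OF gm]
  have [measurable]: "I \<in> sets borel" by (simp add: I_def)
  define \<phi> where "\<phi> l = (\<integral>\<^sup>+x. g x l * indicator I x \<partial>lborel)" for l
  have \<phi>_meas[measurable]: "\<phi> \<in> borel_measurable borel"
    unfolding \<phi>_def by (intro lborel.borel_measurable_nn_integral)
       (auto simp: case_prod_beta' intro!: borel_measurable_times_ennreal g2)
  have "(\<integral>\<^sup>+l. \<phi> l * indicator I l \<partial>lborel) = (\<integral>\<^sup>+l. (\<integral>\<^sup>+x. g x l * indicator I x * indicator I l \<partial>lborel) \<partial>lborel)"
    unfolding \<phi>_def by (intro nn_integral_cong nn_integral_multc[symmetric]) (auto intro!: borel_measurable_times_ennreal g2)
  also have "\<dots> = (\<integral>\<^sup>+x. (\<integral>\<^sup>+l. g x l * indicator I x * indicator I l \<partial>lborel) \<partial>lborel)"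
    by (rule lborel_pair.Fubini') (auto simp: case_prod_beta' intro!: borel_measurable_times_ennreal g2)
  also have "\<dots> = (\<integral>\<^sup>+x. (\<integral>\<^sup>+s. g x (x + s) * indicator I x * indicator I s \<partial>lborel) \<partial>lborel)"
  proof (rule nn_integral_cong)
    fix x
    have "(\<integral>\<^sup>+s. (g x (s + x) * indicator I x) * indicator I s \<partial>lborel) = (\<integral>\<^sup>+l. (g x l * indicator I x) * indicator I l \<partial>lborel)"
      unfolding I_def 
      by (rule nn_integral_periodic_shift[of "\<lambda>l. g x l * indicator {0..<2 * pi} x"])
         (auto simp: g_def[of x] per intro!: borel_measurable_times_ennreal g2[unfolded g_def])
    then show "(\<integral>\<^sup>+l. g x l * indicator I x * indicator I l \<partial>lborel) = (\<integral>\<^sup>+s. g x (x + s) * indicator I x * indicator I s \<partial>lborel)"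
      by (simp add: add.commute)
  qed
  also have "\<dots> = (\<integral>\<^sup>+s. (\<integral>\<^sup>+x. g x (x + s) * indicator I x * indicator I s \<partial>lborel) \<partial>lborel)"
    by (rule lborel_pair.Fubini'[symmetric]) (auto simp: case_prod_beta' intro!: borel_measurable_times_ennreal g2)
  also have "\<dots> \<le> (\<integral>\<^sup>+s. ennreal c * indicator I s \<partial>lborel)"
  proof (intro nn_integral_mono)
    fix s
    have "(\<integral>\<^sup>+x. g x (x + s) * indicator I x * indicator I s \<partial>lborel) = (\<integral>\<^sup>+x. g x (x + s) * indicator I x \<partial>lborel) * indicator I s"
      by (rule nn_integral_multc) (auto intro!: borel_measurable_times_ennreal g2)
    also have "(\<integral>\<^sup>+x. g x (x + s) * indicator I x \<partial>lborel) = Lp_mass p (\<lambda>x. G x (x + s))"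
      by (simp add: Lp_mass_def g_def q_def I_def)
    also have "Lp_mass p (\<lambda>x. G x (x + s)) \<le> ennreal c"
      using B False p_pos by (simp add: c_def q_def Lp_norm_le_iff)
    finally show "(\<integral>\<^sup>+x. g x (x + s) * indicator I x * indicator I s \<partial>lborel) \<le> ennreal c * indicator I s"
      by (simp add: mult_right_mono)
  qed
  finally have le: "(\<integral>\<^sup>+l. \<phi> l * indicator I l \<partial>lborel) \<le> (\<integral>\<^sup>+l. ennreal c * indicator I l \<partial>lborel)" .
  have cI: "(\<integral>\<^sup>+l. ennreal c * indicator I l \<partial>lborel) = ennreal (c * (2 * pi))"
  proof -
    have "emeasure lborel I = ennreal (2 * pi)" by (simp add: I_def)
    moreover have "0 \<le> c" by (simp add: c_def)
    ultimately show ?thesis by (subst nn_integral_cmult_indicator) (simp_all only: ennreal_mult', measurable)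
  qed
  have "\<exists>l. \<phi> l \<le> ennreal c"
  proof (rule ccontr)
    assume "\<nexists>l. \<phi> l \<le> ennreal c"
    then have gt: "ennreal c < \<phi> l" for l by (simp add: not_le)
    have "(\<integral>\<^sup>+l. \<phi> l * indicator I l - ennreal c * indicator I l \<partial>lborel) = 
        (\<integral>\<^sup>+l. \<phi> l * indicator I l \<partial>lborel) - (\<integral>\<^sup>+l. ennreal c * indicator I l \<partial>lborel)"
    proof (rule nn_integral_diff)
      show "(\<integral>\<^sup>+l. ennreal c * indicator I l \<partial>lborel) \<noteq> \<infinity>" unfolding cI by simp
      show "AE l in lborel. ennreal c * indicator I l \<le> \<phi> l * indicator I l"
        by (intro always_eventually allI mult_right_mono less_imp_le[OF gt]) auto
    qed auto
    also have "\<dots> = 0" using le by (metis cI diff_eq_0_iff_ennreal ennreal_less_top order_le_less_trans)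
    finally have "emeasure lborel {l \<in> space lborel. \<phi> l * indicator I l - ennreal c * indicator I l \<noteq> 0} = 0"
      by (subst (asm) nn_integral_0_iff) auto
    also have "{l \<in> space lborel. \<phi> l * indicator I l - ennreal c * indicator I l \<noteq> 0} = I"
    proof -
      have "\<phi> l - ennreal c \<noteq> 0" for l using gt[of l] by (simp add: diff_eq_0_iff_ennreal not_le)
      then show ?thesis by (auto simp: indicator_def)
    qed
    finally show False by (simp add: I_def)
  qed
  then obtain l where "\<phi> l \<le> ennreal c" ..
  then have "Lp_norm p (\<lambda>x. G x l) \<le> ennreal B"
    using B False p_pos by (simp add: Lp_norm_le_iff Lp_mass_def \<phi>_def g_def q_def I_def c_def)
  then show ?thesis by (rule that)
qed

text \<open>
Measurable functions are limits almost everywhere of continuous ones, so a bounded \<open>F\<close> is close in \<open>L\<^sub>p\<close> to a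
continuous function on a neighbourhood \<open>W\<close> of a period. That function need not be periodic.
\<close>

lemma Lp_norm_shift_small_bounded:
  assumes p: "p \<noteq> \<infinity>" and F: "torus_fun F" and M: "\<And>x. cmod (F x) \<le> M" and e: "0 < \<epsilon>"
  shows "\<exists>d>0. \<forall>u. \<bar>u\<bar> \<le> d \<longrightarrow> Lp_norm p (fdiff u F) \<le> ennreal \<epsilon>"
proof -
  define q where "q = enn2real p"
  have q: "0 < q" unfolding q_def using p p_pos by (intro enn2real_pos)
  have M0: "0 \<le> M" using M[of 0] norm_ge_zero order_trans by blast
  define W where "W = {- 1..2 * pi + 1}"
  \<comment> \<open>Three terms, each of mass at most \<open>2 \<pi> \<eta>\<^sup>q\<close>, and the factor \<open>3\<^sup>q\<close> of \<open>powr_norm_add3_le\<close>.\<close>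
  define \<eta> where "\<eta> = \<epsilon> / 3 / 3 powr (1 / q)"
  have \<eta>: "0 < \<eta>" using e by (simp add: \<eta>_def)
  have Fm[measurable]: "F \<in> borel_measurable borel" using F by (rule torus_fun_measurable)
  have Wm[measurable]: "W \<in> sets borel" by (simp add: W_def)
  have "F \<in> borel_measurable lebesgue" by (simp add: measurable_completion)
  then have "F measurable_on UNIV" by (intro lebesgue_measurable_imp_measurable_on) auto
  then obtain N g where N: "negligible N" and g: "\<And>n::nat. continuous_on UNIV (g n)"
    and lim: "\<And>x. x \<notin> N \<Longrightarrow> (\<lambda>n. g n x) \<longlonglongrightarrow> F x"
    unfolding measurable_on_def by auto
  define h where "h n x = closest_point (cball 0 M) (g n x)" for n x
  have hc: "continuous_on UNIV (h n)" for n
    unfolding h_def using M0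
    by (intro continuous_on_compose2[OF continuous_on_closest_point[of "cball 0 M" UNIV] g]) auto
  have hb: "cmod (h n x) \<le> M" for n x
    using closest_point_in_set[of "cball (0::complex) M" "g n x"] M0 by (simp add: h_def)
  have hlim: "(\<lambda>n. h n x) \<longlonglongrightarrow> F x" if "x \<notin> N" for x
  proof -
    have "continuous_on UNIV (closest_point (cball (0::complex) M))"
      using M0 by (intro continuous_on_closest_point) auto
    then have "isCont (closest_point (cball (0::complex) M)) (F x)"
      by (simp add: continuous_on_eq_continuous_at)
    from isCont_tendsto_compose[OF this lim[OF that]]
    have "(\<lambda>n. h n x) \<longlonglongrightarrow> closest_point (cball 0 M) (F x)" by (simp add: h_def)
    also have "closest_point (cball 0 M) (F x) = F x" using M by (intro closest_point_self) simp
    finally show ?thesis .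
  qed
  have hm[measurable]: "h n \<in> borel_measurable borel" for n using hc by (rule borel_measurable_continuous_onI)
  have "(\<lambda>n. \<integral>\<^sup>+x. ennreal (cmod (F x - h n x) powr q) * indicator W x \<partial>lborel) \<longlonglongrightarrow> (\<integral>\<^sup>+(x::real). 0 \<partial>lborel)"
  proof (rule nn_integral_dominated_convergence[where w = "\<lambda>x. ennreal ((2 * M) powr q) * indicator W x"])
    show "AE x in lborel. ennreal (cmod (F x - h n x) powr q) * indicator W x \<le> ennreal ((2 * M) powr q) * indicator W x" for n
    proof (intro always_eventually allI mult_right_mono ennreal_leI powr_mono2)
      fix x show "cmod (F x - h n x) \<le> 2 * M"
        using norm_triangle_ineq4[of "F x" "h n x"] M[of x] hb[of n x] by simp
    qed (use q in auto)
    have "AE x in lebesgue. x \<notin> N" using N by (intro AE_not_in) (simp add: negligible_iff_null_sets)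
    then have "AE x in lborel. x \<notin> N" by (simp add: AE_completion_iff)
    then show "AE x in lborel. (\<lambda>n. ennreal (cmod (F x - h n x) powr q) * indicator W x) \<longlonglongrightarrow> 0"
    proof eventually_elim
      case (elim x)
      have "(\<lambda>n. cmod (F x - h n x)) \<longlonglongrightarrow> cmod (F x - F x)" by (intro tendsto_intros hlim elim)
      then have "(\<lambda>n. cmod (F x - h n x)) \<longlonglongrightarrow> 0" by simp
      then have "(\<lambda>n. cmod (F x - h n x) powr q) \<longlonglongrightarrow> 0"
        using q by (intro tendsto_zero_powrI[where b = q]) auto
      then have "(\<lambda>n. ennreal (cmod (F x - h n x) powr q)) \<longlonglongrightarrow> ennreal 0" by (rule tendsto_ennrealI)
      then show ?case by (cases "x \<in> W") auto
    qed
    show "(\<integral>\<^sup>+x. ennreal ((2 * M) powr q) * indicator W x \<partial>lborel) < \<infinity>"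
      by (subst nn_integral_cmult_indicator) (auto simp: W_def ennreal_mult_less_top)
  qed auto
  then have "(\<lambda>n. \<integral>\<^sup>+x. ennreal (cmod (F x - h n x) powr q) * indicator W x \<partial>lborel) \<longlonglongrightarrow> 0" by simp
  moreover have "0 < ennreal (2 * pi * \<eta> powr q)" using \<eta> by simp
  ultimately have "eventually (\<lambda>n. (\<integral>\<^sup>+x. ennreal (cmod (F x - h n x) powr q) * indicator W x \<partial>lborel) < ennreal (2 * pi * \<eta> powr q)) sequentially"
    by (rule order_tendstoD)
  then obtain n where n: "(\<integral>\<^sup>+x. ennreal (cmod (F x - h n x) powr q) * indicator W x \<partial>lborel) \<le> ennreal (2 * pi * \<eta> powr q)"
    by (auto simp: eventually_sequentially intro: less_imp_le)
  have "uniformly_continuous_on W (h n)"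
    using hc by (intro compact_uniformly_continuous) (auto simp: W_def intro: continuous_on_subset)
  then obtain d where d: "0 < d" "\<And>x y. x \<in> W \<Longrightarrow> y \<in> W \<Longrightarrow> dist y x < d \<Longrightarrow> dist (h n y) (h n x) < \<eta>"
    using \<eta> unfolding uniformly_continuous_on_def by metis
  define e where "e x = ennreal (cmod (F x - h n x) powr q)" for x
  have [measurable]: "e \<in> borel_measurable borel" unfolding e_def by measurable
  have "Lp_norm p (fdiff u F) \<le> ennreal \<epsilon>" if u: "\<bar>u\<bar> \<le> min 1 (d / 2)" for u
  proof -
    have ud: "\<bar>u\<bar> < d" "\<bar>u\<bar> \<le> 1" using u d(1) by auto
    have "Lp_mass p (fdiff u F) \<le> (\<integral>\<^sup>+x. ennreal (3 powr q) * (e x * indicator W x + ennreal (\<eta> powr q) * indicator {0..<2 * pi} x + e (u + 1 * x) * indicator W (u + 1 * x)) \<partial>lborel)"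
      unfolding Lp_mass_def q_def[symmetric]
    proof (intro nn_integral_mono)
      fix x
      show "ennreal (cmod (fdiff u F x) powr q) * indicator {0..<2 * pi} x \<le> ennreal (3 powr q) * (e x * indicator W x + ennreal (\<eta> powr q) * indicator {0..<2 * pi} x + e (u + 1 * x) * indicator W (u + 1 * x))"
      proof (cases "x \<in> {0..<2 * pi}")
        case True
        then have xW: "x \<in> W" "x + u \<in> W" using ud by (auto simp: W_def)
        have hx: "cmod (h n x - h n (x + u)) \<le> \<eta>"
          using d(2)[OF xW(2) xW(1)] ud by (auto simp: dist_norm)
        have "cmod (fdiff u F x) \<le> cmod (F x - h n x) + \<eta> + cmod (F (x + u) - h n (x + u))"
        proof -
          have "fdiff u F x = (F x - h n x) + (h n x - h n (x + u)) - (F (x + u) - h n (x + u))"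
            by (simp add: fdiff_def)
          also have "cmod \<dots> \<le> cmod (F x - h n x) + cmod (h n x - h n (x + u)) + cmod (F (x + u) - h n (x + u))"
            by (meson add_right_mono norm_triangle_ineq norm_triangle_ineq4 order_trans)
          finally show ?thesis using hx by linarith
        qed
        then have "cmod (fdiff u F x) powr q \<le> (cmod (F x - h n x) + \<eta> + cmod (F (x + u) - h n (x + u))) powr q"
          using q by (intro powr_mono2) auto
        also have "\<dots> \<le> 3 powr q * (cmod (F x - h n x) powr q + \<eta> powr q + cmod (F (x + u) - h n (x + u)) powr q)"
          using q \<eta> by (intro powr_norm_add3_le) auto
        finally have "ennreal (cmod (fdiff u F x) powr q) \<le> ennreal (3 powr q) * (e x + ennreal (\<eta> powr q) + e (x + u))"
          unfolding e_def by (simp add: ennreal_plus[symmetric] ennreal_mult'[symmetric] ennreal_leI del: ennreal_plus)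
        then show ?thesis using True xW by (simp add: add.commute)
      qed simp
    qed
    also have "\<dots> = ennreal (3 powr q) * ((\<integral>\<^sup>+x. e x * indicator W x \<partial>lborel) + (\<integral>\<^sup>+x. ennreal (\<eta> powr q) * indicator {0..<2 * pi} x \<partial>lborel) + (\<integral>\<^sup>+x. e (u + 1 * x) * indicator W (u + 1 * x) \<partial>lborel))"
      by (subst nn_integral_cmult, measurable) (subst nn_integral_add, measurable)+
    also have "(\<integral>\<^sup>+x. e (u + 1 * x) * indicator W (u + 1 * x) \<partial>lborel) = (\<integral>\<^sup>+x. e x * indicator W x \<partial>lborel)"
      using nn_integral_real_affine[of "\<lambda>x. e x * indicator W x" 1 u] by simp
    also have "(\<integral>\<^sup>+x. ennreal (\<eta> powr q) * indicator {0..<2 * pi} x \<partial>lborel) = ennreal (2 * pi * \<eta> powr q)"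
      by (subst nn_integral_cmult_indicator) (auto simp: ennreal_mult' mult.commute)
    also have "ennreal (3 powr q) * ((\<integral>\<^sup>+x. e x * indicator W x \<partial>lborel) + ennreal (2 * pi * \<eta> powr q) + (\<integral>\<^sup>+x. e x * indicator W x \<partial>lborel))
        \<le> ennreal (3 powr q) * (ennreal (2 * pi * \<eta> powr q) + ennreal (2 * pi * \<eta> powr q) + ennreal (2 * pi * \<eta> powr q))"
      using n unfolding e_def by (intro mult_left_mono add_mono order_refl) auto
    also have "\<dots> = ennreal (2 * pi * (3 * 3 powr q * \<eta> powr q))"
      by (simp add: ennreal_plus[symmetric] ennreal_mult'[symmetric] mult_ac del: ennreal_plus)
    also have "3 * 3 powr q * \<eta> powr q = \<epsilon> powr q"
    proof -
      have "\<epsilon> = 3 * 3 powr (1 / q) * \<eta>" by (simp add: \<eta>_def)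
      then have "\<epsilon> powr q = 3 powr q * (3 powr (1 / q)) powr q * \<eta> powr q" using \<eta> by (simp add: powr_mult)
      then show ?thesis using q by (simp add: powr_powr mult_ac)
    qed
    finally show ?thesis using p p_pos e by (simp add: Lp_norm_le_iff q_def)
  qed
  then show ?thesis using d(1) by (intro exI[of _ "min 1 (d / 2)"]) auto
qed

text \<open>
Continuity of translation in \<open>L\<^sub>p\<close>, and in the space of continuous periodic functions for \<open>p = \<infinity>\<close>.
\<close>

lemma Lp_norm_shift_small:
  assumes F: "torus_fun F" and fin: "Lp_norm p F < \<infinity>" and cont: "p = \<infinity> \<Longrightarrow> continuous_on UNIV F" and e: "0 < \<epsilon>"
  shows "\<exists>d>0. \<forall>u. \<bar>u\<bar> \<le> d \<longrightarrow> Lp_norm p (fdiff u F) \<le> ennreal \<epsilon>"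
proof (cases "p = \<infinity>")
  case True
  define W where "W = {- 1..2 * pi + 1}"
  have "uniformly_continuous_on W F"
    using cont[OF True] by (intro compact_uniformly_continuous) (auto simp: W_def intro: continuous_on_subset)
  then obtain d where d: "0 < d" "\<And>x y. x \<in> W \<Longrightarrow> y \<in> W \<Longrightarrow> dist y x < d \<Longrightarrow> dist (F y) (F x) < \<epsilon>"
    using e unfolding uniformly_continuous_on_def by metis
  have "cmod (fdiff u F x) \<le> \<epsilon>" if u: "\<bar>u\<bar> \<le> min 1 (d / 2)" for u x
  proof -
    define k where "k = \<lfloor>x / (2 * pi)\<rfloor>"
    define y where "y = x - 2 * pi * of_int k"
    have "of_int k \<le> x / (2 * pi)" "x / (2 * pi) < of_int k + 1"
      unfolding k_def by linarith+
    then have y: "0 \<le> y" "y < 2 * pi" unfolding y_def by (simp_all add: field_simps)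
    have "F x = F y" "F (x + u) = F (y + u)"
      using periodic_int[of F y k] periodic_int[of F "y + u" k] torus_fun_periodic[OF F]
      by (simp_all add: y_def algebra_simps)
    moreover have "dist (F y) (F (y + u)) < \<epsilon>"
      using y u d(1) by (intro d(2)) (auto simp: W_def dist_norm)
    ultimately show ?thesis by (simp add: fdiff_def dist_norm)
  qed
  then show ?thesis using d(1) by (intro exI[of _ "min 1 (d / 2)"]) (auto intro!: Lp_norm_bounded p_pos)
next
  case False
  define q where "q = enn2real p"
  have q: "0 < q" unfolding q_def using False p_pos by (intro enn2real_pos)
  define c where "c = 2 * Lp_const p 2"
  have c: "2 \<le> c" using Lp_const_ge[of 2 p] by (simp add: c_def)
  define \<eta> where "\<eta> = \<epsilon> / (2 * c * c)"
  have \<eta>: "0 < \<eta>" using e c by (simp add: \<eta>_def)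
  have [measurable]: "F \<in> borel_measurable borel" using F by (rule torus_fun_measurable)
  obtain B where B: "0 \<le> B" "Lp_norm p F \<le> ennreal B"
    using fin by (cases "Lp_norm p F") auto
  then have mass: "Lp_mass p F < \<infinity>"
    using False p_pos by (auto simp: Lp_norm_le_iff intro: order_le_less_trans)
  \<comment> \<open>Truncation reduces to bounded functions.\<close>
  define T where "T M x = (if cmod (F x) \<le> real M then F x else 0)" for M x
  have T: "torus_fun (T M)" for M
  proof -
    have "T M \<in> borel_measurable borel" unfolding T_def by measurable
    then show ?thesis by (simp add: torus_fun_def T_def torus_fun_periodic[OF F])
  qed
  have [measurable]: "T M \<in> borel_measurable borel" for M using T by (rule torus_fun_measurable)
  have "(\<lambda>M. \<integral>\<^sup>+x. ennreal (cmod (F x - T M x) powr q) * indicator {0..<2 * pi} x \<partial>lborel) \<longlonglongrightarrow> (\<integral>\<^sup>+(x::real). 0 \<partial>lborel)"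
  proof (rule nn_integral_dominated_convergence[where w = "\<lambda>x. ennreal (cmod (F x) powr q) * indicator {0..<2 * pi} x"])
    show "AE x in lborel. ennreal (cmod (F x - T M x) powr q) * indicator {0..<2 * pi} x \<le> ennreal (cmod (F x) powr q) * indicator {0..<2 * pi} x" for M
      using q by (intro always_eventually allI mult_right_mono ennreal_leI powr_mono2) (auto simp: T_def)
    show "AE x in lborel. (\<lambda>M. ennreal (cmod (F x - T M x) powr q) * indicator {0..<2 * pi} x) \<longlonglongrightarrow> 0"
    proof (rule always_eventually, rule allI, rule tendsto_eventually)
      fix x
      obtain M0 where "cmod (F x) \<le> real M0" using real_arch_simple by blast
      then show "\<forall>\<^sub>F M in sequentially. ennreal (cmod (F x - T M x) powr q) * indicator {0..<2 * pi} x = 0"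
        by (intro eventually_sequentiallyI[of M0]) (auto simp: T_def)
    qed
    show "(\<integral>\<^sup>+x. ennreal (cmod (F x) powr q) * indicator {0..<2 * pi} x \<partial>lborel) < \<infinity>"
      using mass by (simp add: Lp_mass_def q_def)
  qed auto
  then have "(\<lambda>M. Lp_mass p (\<lambda>x. F x - T M x)) \<longlonglongrightarrow> 0" by (simp add: Lp_mass_def q_def)
  moreover have "0 < ennreal (2 * pi * \<eta> powr q)" using \<eta> by simp
  ultimately have "eventually (\<lambda>M. Lp_mass p (\<lambda>x. F x - T M x) < ennreal (2 * pi * \<eta> powr q)) sequentially"
    by (rule order_tendstoD)
  then obtain M where "Lp_mass p (\<lambda>x. F x - T M x) \<le> ennreal (2 * pi * \<eta> powr q)"
    by (auto simp: eventually_sequentially intro: less_imp_le)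
  then have M: "Lp_norm p (\<lambda>x. F x - T M x) \<le> ennreal \<eta>"
    using False p_pos \<eta> by (simp add: Lp_norm_le_iff q_def)
  have "0 < \<epsilon> / c" using e c by simp
  then obtain d where d: "0 < d" "\<And>u. \<bar>u\<bar> \<le> d \<Longrightarrow> Lp_norm p (fdiff u (T M)) \<le> ennreal (\<epsilon> / c)"
  proof -
    have "cmod (T M x) \<le> real M" for x by (simp add: T_def)
    from Lp_norm_shift_small_bounded[OF False T this \<open>0 < \<epsilon> / c\<close>] show ?thesis using that by blast
  qed
  have "Lp_norm p (fdiff u F) \<le> ennreal \<epsilon>" if u: "\<bar>u\<bar> \<le> d" for u
  proof -
    have "Lp_norm p (difference 1 u (\<lambda>x. F x - T M x)) \<le> ennreal (c ^ 1 * \<eta>)"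
      unfolding c_def using M \<eta> F T by (intro Lp_norm_difference_le p_pos torus_fun_diff) auto
    then have r: "Lp_norm p (fdiff u (\<lambda>x. F x - T M x)) \<le> ennreal (c * \<eta>)"
      by (simp add: difference_eq_funpow)
    have "fdiff u F = (\<lambda>x. fdiff u (T M) x + fdiff u (\<lambda>x. F x - T M x) x)"
      by (simp add: fdiff_def fun_eq_iff)
    moreover have "Lp_norm p (\<lambda>x. fdiff u (T M) x + fdiff u (\<lambda>x. F x - T M x) x) \<le> ennreal (Lp_const p 2 * (\<epsilon> / c + c * \<eta>))"
      using d(2)[OF u] r F T e c \<eta> by (intro Lp_norm_add p_pos torus_fun_fdiff torus_fun_diff) auto
    moreover have "Lp_const p 2 * (\<epsilon> / c + c * \<eta>) \<le> \<epsilon>"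
    proof -
      have "Lp_const p 2 = c / 2" by (simp add: c_def)
      moreover have "c * \<eta> = \<epsilon> / c / 2" using c by (simp add: \<eta>_def field_simps)
      ultimately have "Lp_const p 2 * (\<epsilon> / c + c * \<eta>) = c / 2 * (\<epsilon> / c + \<epsilon> / c / 2)" by (simp only:)
      also have "\<dots> = \<epsilon> * (3 / 4)" using c by (simp add: field_simps)
      also have "\<dots> \<le> \<epsilon>" using e by simp
      finally show ?thesis .
    qed
    ultimately show ?thesis by (metis ennreal_leI order_trans)
  qed
  then show ?thesis using d(1) by blast
qed

end

section \<open>A localized kernel reproducing trigonometric polynomials\<close>

text \<open>
The character \<open>x \<mapsto> e\<^sup>i\<^sup>k\<^sup>x\<close> of the torus.
\<close>

definition wave :: "int \<Rightarrow> real \<Rightarrow> complex" where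
  "wave k x = exp (\<i> * of_int k * of_real x)"

lemma wave_add: "wave (k + l) x = wave k x * wave l x"
  by (simp add: wave_def exp_add[symmetric] algebra_simps)

lemma wave_plus: "wave k (x + y) = wave k x * wave k y"
  by (simp add: wave_def exp_add[symmetric] algebra_simps)

lemma wave_0 [simp]: "wave 0 x = 1" "wave k 0 = 1"
  by (simp_all add: wave_def)

lemma wave_mult: "wave k x = wave 1 (of_int k * x)"
  by (simp add: wave_def mult_ac)

lemma wave_nat: "wave (int i) x = wave 1 x ^ i"
  by (simp add: wave_def exp_of_nat_mult[symmetric] mult_ac)

lemma norm_wave [simp]: "cmod (wave k x) = 1"
proof -
  have "wave k x = exp (\<i> * of_real (of_int k * x))" by (simp add: wave_def mult_ac)
  then show ?thesis by (simp only: norm_exp_i_times)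
qed

lemma norm_wave_1_minus_1: "cmod (wave 1 x - 1) = 2 * \<bar>sin (x / 2)\<bar>"
  using dist_exp_i_1[of x] by (simp add: wave_def)

lemma norm_wave_diff_le: "cmod (wave k x - wave k y) \<le> real_of_int \<bar>k\<bar> * \<bar>x - y\<bar>"
proof -
  have "wave k x = wave k (x - y) * wave k y" by (simp flip: wave_plus)
  then have "wave k x - wave k y = (wave 1 (of_int k * (x - y)) - 1) * wave k y"
    by (simp add: wave_mult[of k "x - y"] algebra_simps)
  then have "cmod (wave k x - wave k y) = 2 * \<bar>sin (of_int k * (x - y) / 2)\<bar>"
    by (simp add: norm_mult norm_wave_1_minus_1)
  also have "\<dots> \<le> 2 * \<bar>of_int k * (x - y) / 2\<bar>" by (intro mult_left_mono abs_sin_x_le_abs_x) auto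
  finally show ?thesis by (simp add: abs_mult)
qed

lemma wave_2pi: "wave k (2 * pi * of_int j) = 1"
proof -
  show ?thesis unfolding wave_def exp_eq_1 by (auto intro!: exI[of _ "k * j"])
qed

lemma trig_polys_iff: "T \<in> trig_polys n \<longleftrightarrow> (\<exists>c. T = (\<lambda>x. \<Sum>\<nu>\<in>{- int n..int n}. c \<nu> * wave \<nu> x))"
  by (simp add: trig_polys_def wave_def)

lemma trig_polys_cmult: 
  assumes "T \<in> trig_polys n" shows "(\<lambda>x. c * T x) \<in> trig_polys n"
proof -
  obtain a where "T = (\<lambda>x. \<Sum>\<nu>\<in>{- int n..int n}. a \<nu> * wave \<nu> x)" using assms by (auto simp: trig_polys_iff)
  then show ?thesis unfolding trig_polys_iff
    by (intro exI[of _ "\<lambda>\<nu>. c * a \<nu>"]) (simp add: sum_distrib_left mult_ac)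
qed

lemma trig_polys_add: 
  assumes "T \<in> trig_polys n" "U \<in> trig_polys n" shows "(\<lambda>x. T x + U x) \<in> trig_polys n"
proof -
  obtain a b where "T = (\<lambda>x. \<Sum>\<nu>\<in>{- int n..int n}. a \<nu> * wave \<nu> x)" "U = (\<lambda>x. \<Sum>\<nu>\<in>{- int n..int n}. b \<nu> * wave \<nu> x)"
    using assms by (auto simp: trig_polys_iff)
  then show ?thesis unfolding trig_polys_iff
    by (intro exI[of _ "\<lambda>\<nu>. a \<nu> + b \<nu>"]) (simp add: sum.distrib[symmetric] algebra_simps)
qed

lemma trig_polys_0: "(\<lambda>x. 0) \<in> trig_polys n"
  unfolding trig_polys_iff by (intro exI[of _ "\<lambda>_. 0"]) simp

lemma trig_polys_diff: "T \<in> trig_polys n \<Longrightarrow> U \<in> trig_polys n \<Longrightarrow> (\<lambda>x. T x - U x) \<in> trig_polys n"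
  using trig_polys_add[of T n "\<lambda>x. (-1) * U x"] trig_polys_cmult[of U n "-1"] by simp

lemma trig_polys_sum: "(\<And>i. i \<in> I \<Longrightarrow> T i \<in> trig_polys n) \<Longrightarrow> (\<lambda>x. \<Sum>i\<in>I. T i x) \<in> trig_polys n"
  by (induction I rule: infinite_finite_induct) (auto intro: trig_polys_0 trig_polys_add)

lemma trig_polys_wave: "\<bar>k\<bar> \<le> int n \<Longrightarrow> wave k \<in> trig_polys n"
  unfolding trig_polys_iff
  by (intro exI[of _ "\<lambda>\<nu>. if \<nu> = k then 1 else 0"]) (auto simp: fun_eq_iff if_distrib[of "\<lambda>z. z * _"] sum.delta cong: if_cong)

lemma trig_polys_shift: 
  assumes "T \<in> trig_polys n" shows "(\<lambda>x. T (x + a)) \<in> trig_polys n"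
proof -
  obtain c where "T = (\<lambda>x. \<Sum>\<nu>\<in>{- int n..int n}. c \<nu> * wave \<nu> x)" using assms by (auto simp: trig_polys_iff)
  then show ?thesis unfolding trig_polys_iff
    by (intro exI[of _ "\<lambda>\<nu>. c \<nu> * wave \<nu> a"]) (simp add: wave_plus mult_ac)
qed

lemma trig_polys_mono: 
  assumes "T \<in> trig_polys n" "n \<le> m" shows "T \<in> trig_polys m"
proof -
  obtain c where "T = (\<lambda>x. \<Sum>\<nu>\<in>{- int n..int n}. c \<nu> * wave \<nu> x)" using assms by (auto simp: trig_polys_iff)
  moreover have "(\<lambda>x. \<Sum>\<nu>\<in>{- int n..int n}. c \<nu> * wave \<nu> x) \<in> trig_polys m"
    using assms(2) by (intro trig_polys_sum trig_polys_cmult trig_polys_wave) auto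
  ultimately show ?thesis by simp
qed

lemma continuous_on_wave [continuous_intros]: 
  "continuous_on S f \<Longrightarrow> continuous_on S (\<lambda>x. wave k (f x))"
  unfolding wave_def by (intro continuous_intros)

lemma trig_polys_continuous: 
  assumes "T \<in> trig_polys n" shows "continuous_on UNIV T"
proof -
  obtain c where "T = (\<lambda>x. \<Sum>\<nu>\<in>{- int n..int n}. c \<nu> * wave \<nu> x)" using assms by (auto simp: trig_polys_iff)
  then show ?thesis by (auto intro!: continuous_intros)
qed

lemma trig_polys_torus_fun: 
  assumes "T \<in> trig_polys n" shows "torus_fun T"
proof -
  obtain c where c: "T = (\<lambda>x. \<Sum>\<nu>\<in>{- int n..int n}. c \<nu> * wave \<nu> x)" using assms by (auto simp: trig_polys_iff)
  have "T (x + 2 * pi) = T x" for x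
    unfolding c using wave_2pi[of _ 1] by (simp add: wave_plus)
  then show ?thesis using trig_polys_continuous[OF assms] 
    by (simp add: torus_fun_def borel_measurable_continuous_onI)
qed

lemma trig_polys_fdiff: "T \<in> trig_polys n \<Longrightarrow> fdiff h T \<in> trig_polys n"
  unfolding fdiff_def by (intro trig_polys_diff trig_polys_shift)

lemma trig_polys_difference: "T \<in> trig_polys n \<Longrightarrow> difference k h T \<in> trig_polys n"
  unfolding difference_eq_funpow by (induction k) (auto intro: trig_polys_fdiff)

text \<open>
The indices \<open>-H, \<dots>, H - 1\<close> of the \<open>2 H\<close> nodes \<open>\<pi> j / H\<close> of one period. They are centred so that \<open>|j|\<close> measures
the distance of the node to \<open>0\<close> modulo \<open>2 \<pi>\<close>.
\<close>

definition grid :: "nat \<Rightarrow> int set" where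
  "grid H = {- int H..<int H}"

definition node :: "nat \<Rightarrow> int \<Rightarrow> real" where
  "node H j = of_int j * (pi / real H)"

lemma finite_grid [simp]: "finite (grid H)" by (simp add: grid_def)

lemma node_add: "node H (i + j) = node H i + node H j"
  by (simp add: node_def algebra_simps)

lemma node_period: "0 < H \<Longrightarrow> node H (j + 2 * int H) = node H j + 2 * pi"
  by (simp add: node_def field_simps)

lemma sum_grid_shift:
  fixes \<phi> :: "int \<Rightarrow> 'a :: comm_monoid_add"
  assumes per: "\<And>j. \<phi> (j + 2 * int H) = \<phi> j"
  shows "(\<Sum>j\<in>grid H. \<phi> (j + i)) = (\<Sum>j\<in>grid H. \<phi> j)"
proof -
  have step: "(\<Sum>j\<in>grid H. \<psi> (j + 1)) = (\<Sum>j\<in>grid H. \<psi> j)" if per: "\<And>j. \<psi> (j + 2 * int H) = \<psi> j" for \<psi> :: "int \<Rightarrow> 'a"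
  proof (cases "H = 0")
    case False
    have "(\<Sum>j\<in>grid H. \<psi> (j + 1)) = (\<Sum>j\<in>{- int H + 1..<int H + 1}. \<psi> j)"
      unfolding grid_def by (rule sum.reindex_bij_witness[of _ "\<lambda>j. j - 1" "\<lambda>j. j + 1"]) auto
    also have "{- int H + 1..<int H + 1} = insert (int H) {- int H + 1..<int H}" using False by auto
    also have "(\<Sum>j\<in>insert (int H) {- int H + 1..<int H}. \<psi> j) = \<psi> (int H) + (\<Sum>j\<in>{- int H + 1..<int H}. \<psi> j)" by simp
    also have "\<psi> (int H) = \<psi> (- int H)" using per[of "- int H"] by simp
    also have "\<psi> (- int H) + (\<Sum>j\<in>{- int H + 1..<int H}. \<psi> j) = (\<Sum>j\<in>insert (- int H) {- int H + 1..<int H}. \<psi> j)" by simp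
    also have "insert (- int H) {- int H + 1..<int H} = grid H" using False by (auto simp: grid_def)
    finally show ?thesis .
  qed (simp add: grid_def)
  have per': "\<phi> (j + 2 * int H + i) = \<phi> (j + i)" for i j
    using per[of "j + i"] by (simp add: ac_simps)
  show ?thesis
  proof (induction i rule: int_induct[where k = 0])
    case base show ?case by simp
  next
    case (step1 i)
    have "(\<Sum>j\<in>grid H. \<phi> (j + 1 + i)) = (\<Sum>j\<in>grid H. \<phi> (j + i))"
      using per' by (intro step[of "\<lambda>j. \<phi> (j + i)"])
    then show ?case using step1 by (simp add: ac_simps)
  next
    case (step2 i)
    have "(\<Sum>j\<in>grid H. \<phi> (j + 1 + (i - 1))) = (\<Sum>j\<in>grid H. \<phi> (j + (i - 1)))"
      using per' by (intro step[of "\<lambda>j. \<phi> (j + (i - 1))"])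
    then show ?case using step2 by (simp add: ac_simps)
  qed
qed

text \<open>
Discrete orthogonality of the characters.
\<close>

lemma sum_wave_grid:
  assumes "\<bar>k\<bar> < 2 * int H"
  shows "(\<Sum>j\<in>grid H. wave k (node H j)) = (if k = 0 then of_nat (2 * H) else 0)"
proof (cases "k = 0")
  case True
  then show ?thesis by (simp add: grid_def)
next
  case False
  define S where "S = (\<Sum>j\<in>grid H. wave k (node H j))"
  have H: "0 < H" using assms by auto
  have "(\<Sum>j\<in>grid H. wave k (node H (j + 1))) = S"
    unfolding S_def using H wave_2pi[of k 1] by (intro sum_grid_shift) (simp add: node_period wave_plus)
  then have "wave k (pi / real H) * S = S"
    by (simp add: S_def node_add wave_plus sum_distrib_left mult.commute) (simp add: node_def)
  moreover have "wave k (pi / real H) \<noteq> 1"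
  proof
    assume "wave k (pi / real H) = 1"
    then have "sin (of_int k * (pi / real H) / 2) = 0"
      using norm_wave_1_minus_1[of "of_int k * (pi / real H)"] by (simp add: wave_mult[of k])
    then obtain i where "of_int k * (pi / real H) / 2 = of_int i * pi" by (auto simp: sin_zero_iff_int2)
    then have "real_of_int k = 2 * real H * real_of_int i" using H by (simp add: field_simps)
    then have "real_of_int k = real_of_int (2 * int H * i)" by simp
    then have k: "k = 2 * int H * i" by (simp only: of_int_eq_iff)
    then have "i \<noteq> 0" using False by auto
    then have "2 * int H * 1 \<le> 2 * int H * \<bar>i\<bar>" by (intro mult_left_mono) auto
    then show False using assms k by (simp add: abs_mult)
  qed
  ultimately show ?thesis using False by (simp add: S_def[symmetric])
qed

text \<open>
The mean \<open>(1 / n) \<Sum>\<^sub>j\<^sub><\<^sub>n e\<^sup>i\<^sup>j\<^sup>x\<close> for \<open>n \<ge> 1\<close>, equal to \<open>1\<close> at \<open>0\<close> and bounded by \<open>1 / (n |sin (x / 2)|)\<close>.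
\<close>

definition mean_wave :: "nat \<Rightarrow> real \<Rightarrow> complex" where
  "mean_wave n x = (\<Sum>j<n. wave (int j) x) / of_nat n"

lemma norm_mean_wave_le_1: "cmod (mean_wave n x) \<le> 1"
proof -
  have "cmod (\<Sum>j<n. wave (int j) x) \<le> (\<Sum>j<n. cmod (wave (int j) x))" by (rule norm_sum)
  then show ?thesis by (simp add: mean_wave_def norm_divide divide_le_eq)
qed

lemma norm_mean_wave_decay: "real n * \<bar>sin (x / 2)\<bar> * cmod (mean_wave n x) \<le> 1"
proof (cases "n = 0")
  case False
  have "(wave 1 x - 1) * (\<Sum>j<n. wave (int j) x) = wave 1 x ^ n - 1"
    unfolding wave_nat using power_diff_1_eq[of "wave 1 x" n] by simp
  then have "(wave 1 x - 1) * (of_nat n * mean_wave n x) = wave 1 x ^ n - 1"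
    using False by (simp add: mean_wave_def)
  then have "cmod (wave 1 x - 1) * (real n * cmod (mean_wave n x)) = cmod (wave 1 x ^ n - 1)"
    by (metis norm_mult norm_of_nat)
  also have "\<dots> \<le> cmod (wave 1 x ^ n) + 1" using norm_triangle_ineq4[of "wave 1 x ^ n" 1] by simp
  also have "\<dots> = 2" by (simp add: norm_power)
  finally show ?thesis by (simp add: norm_wave_1_minus_1 mult_ac)
qed simp

lemma mean_wave_lipschitz: "cmod (mean_wave n x - mean_wave n y) \<le> real n * \<bar>x - y\<bar>"
proof (cases "n = 0")
  case False
  have "cmod (\<Sum>j<n. wave (int j) x - wave (int j) y) \<le> (\<Sum>j<n. real n * \<bar>x - y\<bar>)"
  proof (intro sum_norm_le)
    fix j assume "j \<in> {..<n}"
    then have "real_of_int \<bar>int j\<bar> * \<bar>x - y\<bar> \<le> real n * \<bar>x - y\<bar>" by (intro mult_right_mono) auto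
    then show "cmod (wave (int j) x - wave (int j) y) \<le> real n * \<bar>x - y\<bar>"
      using norm_wave_diff_le[of "int j" x y] by linarith
  qed
  then show ?thesis using False
    by (simp add: mean_wave_def diff_divide_distrib[symmetric] sum_subtractf norm_divide divide_le_eq mult_ac)
qed (simp add: mean_wave_def)

text \<open>
Powers of the mean are trigonometric polynomials with coefficients of sum \<open>1\<close>, namely those of a power of an
ordinary polynomial in \<open>e\<^sup>i\<^sup>x\<close>.
\<close>

lemma mean_wave_power_eq:
  assumes "1 \<le> n"
  obtains g where "\<And>x. mean_wave n x ^ e = (\<Sum>i\<le>e * n. g i * wave (int i) x)" "(\<Sum>i\<le>e * n. g i) = 1"
proof -
  define P :: "complex poly" where "P = (\<Sum>j<n. monom (1 / of_nat n) j)"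
  have P: "poly P (wave 1 x) = mean_wave n x" for x
    by (simp add: P_def mean_wave_def poly_sum poly_monom wave_nat sum_divide_distrib)
  have "degree P \<le> n" unfolding P_def
    by (intro degree_sum_le order_trans[OF degree_monom_le]) auto
  then have deg: "degree (P ^ e) \<le> e * n"
    by (intro order_trans[OF degree_power_le]) (simp add: mult.commute)
  have eval: "poly (P ^ e) z = (\<Sum>i\<le>e * n. coeff (P ^ e) i * z ^ i)" for z
    unfolding poly_altdef using deg by (intro sum.mono_neutral_left) (auto simp: coeff_eq_0)
  show ?thesis
  proof (rule that)
    show "mean_wave n x ^ e = (\<Sum>i\<le>e * n. coeff (P ^ e) i * wave (int i) x)" for x
      using eval[of "wave 1 x"] by (simp add: P wave_nat)
    have "mean_wave n 0 = 1" using assms by (simp add: mean_wave_def)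
    then show "(\<Sum>i\<le>e * n. coeff (P ^ e) i) = 1" using eval[of 1] P[of 0] by simp
  qed
qed

lemma card_symmetric_interval: "card {- int N..int N} = 2 * N + 1"
  unfolding card_atLeastAtMost_int by linarith

text \<open>
A kernel of de la Vallee Poussin type: the Dirichlet kernel of degree \<open>(e + 1) n\<close> times the \<open>e\<close>-th power of the
mean. The Fourier coefficients of the product at frequencies \<open>|k| \<le> n\<close> are full sums of the coefficients
of the power, hence \<open>1\<close>.
\<close>

definition vp_kernel :: "nat \<Rightarrow> nat \<Rightarrow> real \<Rightarrow> complex" where
  "vp_kernel e n x = (\<Sum>l\<in>{- int ((e + 1) * n)..int ((e + 1) * n)}. wave l x) * mean_wave n x ^ e"

lemma vp_kernel_expand:
  assumes "1 \<le> n"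
  obtains g where "\<And>x. vp_kernel e n x = (\<Sum>l\<in>{- int ((e + 1) * n)..int ((e + 1) * n)}. \<Sum>i\<le>e * n. g i * wave (l + int i) x)"
    "(\<Sum>i\<le>e * n. g i) = 1"
proof -
  obtain g where g: "\<And>x. mean_wave n x ^ e = (\<Sum>i\<le>e * n. g i * wave (int i) x)" "(\<Sum>i\<le>e * n. g i) = 1"
    using mean_wave_power_eq[OF assms] by blast
  have "vp_kernel e n x = (\<Sum>l\<in>{- int ((e + 1) * n)..int ((e + 1) * n)}. \<Sum>i\<le>e * n. g i * wave (l + int i) x)" for x
    unfolding vp_kernel_def g sum_product by (simp add: wave_add mult_ac)
  then show ?thesis using that g(2) by blast
qed

lemma vp_kernel_trig_poly:
  assumes "1 \<le> n"
  shows "vp_kernel e n \<in> trig_polys ((2 * e + 1) * n)"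
proof -
  obtain g where g: "\<And>x. vp_kernel e n x = (\<Sum>l\<in>{- int ((e + 1) * n)..int ((e + 1) * n)}. \<Sum>i\<le>e * n. g i * wave (l + int i) x)"
    using vp_kernel_expand[OF assms] by blast
  have "(\<lambda>x. \<Sum>l\<in>{- int ((e + 1) * n)..int ((e + 1) * n)}. \<Sum>i\<le>e * n. g i * wave (l + int i) x) \<in> trig_polys ((2 * e + 1) * n)"
  proof (intro trig_polys_sum trig_polys_cmult trig_polys_wave)
    fix l i assume "l \<in> {- int ((e + 1) * n)..int ((e + 1) * n)}" "i \<in> {..e * n}"
    moreover have "int ((2 * e + 1) * n) = int ((e + 1) * n) + int (e * n)" by (simp add: algebra_simps)
    ultimately show "\<bar>l + int i\<bar> \<le> int ((2 * e + 1) * n)" unfolding atLeastAtMost_iff atMost_iff by linarith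
  qed
  then show ?thesis by (simp add: g[abs_def])
qed

lemma vp_kernel_reproduce_wave:
  assumes n: "1 \<le> n" and H: "(2 * e + 2) * n < 2 * H" and k: "\<bar>k\<bar> \<le> int n"
  shows "(\<Sum>j\<in>grid H. vp_kernel e n (x - y - node H j) / of_nat (2 * H) * wave k (y + node H j)) = wave k x"
proof -
  obtain g where g: "\<And>x. vp_kernel e n x = (\<Sum>l\<in>{- int ((e + 1) * n)..int ((e + 1) * n)}. \<Sum>i\<le>e * n. g i * wave (l + int i) x)"
    and g1: "(\<Sum>i\<le>e * n. g i) = 1"
    using vp_kernel_expand[OF n] by blast
  let ?L = "{- int ((e + 1) * n)..int ((e + 1) * n)}"
  have split: "(2 * e + 2) * n = (e + 1) * n + e * n + n" by (simp add: algebra_simps)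
  have H0: "0 < H" using H by auto
  have "(\<Sum>j\<in>grid H. vp_kernel e n (x - y - node H j) / of_nat (2 * H) * wave k (y + node H j))
      = (\<Sum>j\<in>grid H. \<Sum>l\<in>?L. \<Sum>i\<le>e * n. g i * wave (l + int i) (x - y - node H j) * wave k (y + node H j) / of_nat (2 * H))"
    unfolding g by (simp add: sum_distrib_right sum_distrib_left sum_divide_distrib mult_ac)
  also have "\<dots> = (\<Sum>l\<in>?L. \<Sum>i\<le>e * n. \<Sum>j\<in>grid H. g i * wave (l + int i) (x - y - node H j) * wave k (y + node H j) / of_nat (2 * H))"
    by (subst sum.swap) (intro sum.cong refl sum.swap)
  also have "\<dots> = (\<Sum>l\<in>?L. \<Sum>i\<le>e * n. if l = k - int i then g i * wave k x else 0)"
  proof (intro sum.cong refl)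
    fix l i assume l: "l \<in> ?L" and i: "i \<in> {..e * n}"
    have "wave (l + int i) (x - y - node H j) * wave k (y + node H j)
        = wave (l + int i) (x - y) * wave k y * wave (k - (l + int i)) (node H j)" for j
    proof -
      have "wave (l + int i) (x - y) = wave (l + int i) (x - y - node H j) * wave (l + int i) (node H j)"
        by (simp flip: wave_plus)
      moreover have "wave k (node H j) = wave (k - (l + int i)) (node H j) * wave (l + int i) (node H j)"
        by (simp flip: wave_add)
      ultimately show ?thesis by (simp add: wave_plus)
    qed
    then have "(\<Sum>j\<in>grid H. g i * wave (l + int i) (x - y - node H j) * wave k (y + node H j) / of_nat (2 * H))
        = g i * wave (l + int i) (x - y) * wave k y / of_nat (2 * H) * (\<Sum>j\<in>grid H. wave (k - (l + int i)) (node H j))"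
      by (simp add: sum_distrib_left sum_divide_distrib mult_ac)
    also have "(\<Sum>j\<in>grid H. wave (k - (l + int i)) (node H j)) = (if k - (l + int i) = 0 then of_nat (2 * H) else 0)"
    proof (rule sum_wave_grid)
      have "int ((e + 1) * n) + int (e * n) + int n < 2 * int H" using H split by linarith
      moreover have "int i \<le> int (e * n)" using i by (simp only: atMost_iff of_nat_le_iff)
      ultimately show "\<bar>k - (l + int i)\<bar> < 2 * int H" using l k unfolding atLeastAtMost_iff by linarith
    qed
    also have "g i * wave (l + int i) (x - y) * wave k y / of_nat (2 * H) * \<dots> = (if l = k - int i then g i * wave k x else 0)"
      using H0 by (auto simp: wave_plus[symmetric])
    finally show "(\<Sum>j\<in>grid H. g i * wave (l + int i) (x - y - node H j) * wave k (y + node H j) / of_nat (2 * H))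
      = (if l = k - int i then g i * wave k x else 0)" .
  qed
  also have "\<dots> = (\<Sum>i\<le>e * n. \<Sum>l\<in>?L. if l = k - int i then g i * wave k x else 0)" by (rule sum.swap)
  also have "\<dots> = (\<Sum>i\<le>e * n. g i * wave k x)"
  proof (intro sum.cong refl)
    fix i assume i: "i \<in> {..e * n}"
    have "int i \<le> int (e * n)" using i by (simp only: atMost_iff of_nat_le_iff)
    moreover have "int ((e + 1) * n) = int (e * n) + int n" by (simp add: algebra_simps)
    ultimately have "k - int i \<in> ?L" using k unfolding atLeastAtMost_iff by linarith
    then show "(\<Sum>l\<in>?L. if l = k - int i then g i * wave k x else 0) = g i * wave k x"
      by (simp add: sum.delta')
  qed
  also have "\<dots> = wave k x" by (simp add: sum_distrib_right[symmetric] g1)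
  finally show ?thesis .
qed

text \<open>
The condition on \<open>H\<close> excludes aliasing: the kernel has degree at most \<open>(2 e + 1) n\<close>, and \<open>2 H\<close> exceeds this degree plus \<open>n\<close>.
\<close>

lemma vp_kernel_reproduce:
  assumes n: "1 \<le> n" and H: "(2 * e + 2) * n < 2 * H" and T: "T \<in> trig_polys n"
  shows "(\<Sum>j\<in>grid H. vp_kernel e n (x - y - node H j) / of_nat (2 * H) * T (y + node H j)) = T x"
proof -
  obtain c where c: "T = (\<lambda>x. \<Sum>\<nu>\<in>{- int n..int n}. c \<nu> * wave \<nu> x)" using T by (auto simp: trig_polys_iff)
  have "(\<Sum>j\<in>grid H. vp_kernel e n (x - y - node H j) / of_nat (2 * H) * T (y + node H j))
      = (\<Sum>\<nu>\<in>{- int n..int n}. c \<nu> * (\<Sum>j\<in>grid H. vp_kernel e n (x - y - node H j) / of_nat (2 * H) * wave \<nu> (y + node H j)))"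
    unfolding c sum_distrib_left by (subst sum.swap) (simp add: mult_ac)
  also have "\<dots> = (\<Sum>\<nu>\<in>{- int n..int n}. c \<nu> * wave \<nu> x)"
    using n H by (intro sum.cong refl) (subst vp_kernel_reproduce_wave, auto)
  finally show ?thesis by (simp add: c)
qed

lemma sin_ge_cubic: "0 \<le> x \<Longrightarrow> x - x ^ 3 / 6 \<le> sin x" for x :: real
proof -
  assume x: "0 \<le> x"
  let ?g = "\<lambda>x::real. sin x - (x - x ^ 3 / 6)"
  have "?g 0 \<le> ?g x"
  proof (rule DERIV_nonneg_imp_nondecreasing[OF x])
    fix t :: real
    have "(?g has_real_derivative (cos t - (1 - t ^ 2 / 2))) (at t)"
      by (auto intro!: derivative_eq_intros simp: power2_eq_square)
    moreover have "0 \<le> cos t - (1 - t ^ 2 / 2)"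
    proof -
      have "cos t = 1 - 2 * (sin (t / 2)) ^ 2" using cos_double_sin[of "t / 2"] by simp
      moreover have "(sin (t / 2)) ^ 2 \<le> (t / 2) ^ 2"
        using abs_sin_x_le_abs_x[of "t / 2"] abs_le_square_iff by blast
      ultimately show ?thesis by (simp add: power_divide)
    qed
    ultimately show "\<exists>y. (?g has_real_derivative y) (at t) \<and> 0 \<le> y" by blast
  qed
  then show ?thesis by simp
qed

text \<open>
The range extends beyond \<open>\<pi> / 2\<close>, since a node may be moved by up to one mesh width; the constant is not sharp.
\<close>

lemma abs_sin_ge:
  fixes v :: real
  assumes "\<bar>v\<bar> \<le> 9 / 4"
  shows "\<bar>v\<bar> / 7 \<le> \<bar>sin v\<bar>"
proof -
  have "\<bar>v\<bar> ^ 2 \<le> (9 / 4) ^ 2" using assms by (intro power_mono) auto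
  then have "\<bar>v\<bar> * (\<bar>v\<bar> ^ 2) \<le> \<bar>v\<bar> * (81 / 16)" by (intro mult_left_mono) (auto simp: power2_eq_square)
  then have "\<bar>v\<bar> ^ 3 \<le> \<bar>v\<bar> * (81 / 16)" by (simp add: power3_eq_cube power2_eq_square mult_ac)
  then have "\<bar>v\<bar> / 7 \<le> \<bar>v\<bar> - \<bar>v\<bar> ^ 3 / 6" by simp
  also have "\<dots> \<le> sin \<bar>v\<bar>" by (rule sin_ge_cubic) simp
  also have "\<dots> \<le> \<bar>sin v\<bar>" by (cases "0 \<le> v") auto
  finally show ?thesis .
qed

text \<open>
Decay of the mean along the grid, uniformly over shifts \<open>t\<close> by at most one mesh width. The parameter \<open>c\<close> bounds the number of
nodes per unit of degree.
\<close>

lemma norm_mean_wave_node_le: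
  assumes n: "1 \<le> n" and H: "8 \<le> H" "2 * real H \<le> c * real n" "1 \<le> c" and t: "\<bar>t\<bar> \<le> pi / real H" and j: "j \<in> grid H"
  shows "cmod (mean_wave n (t - node H j)) \<le> 7 * c / (1 + real_of_int \<bar>j\<bar>)"
proof (cases "\<bar>j\<bar> \<le> 1")
  case True
  then have "(1 + real_of_int \<bar>j\<bar>) \<le> 7 * c" using H(3) by auto
  moreover have "0 < 1 + real_of_int \<bar>j\<bar>" by linarith
  ultimately have "1 \<le> 7 * c / (1 + real_of_int \<bar>j\<bar>)" by (simp only: pos_le_divide_eq mult_1)
  then show ?thesis using norm_mean_wave_le_1[of n "t - node H j"] by linarith
next
  case False
  define a where "a = real_of_int \<bar>j\<bar>"
  define v where "v = (t - node H j) / 2"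
  define \<delta> where "\<delta> = pi / real H"
  have \<delta>: "0 < \<delta>" "real H * \<delta> = pi" using H by (auto simp: \<delta>_def)
  have a: "2 \<le> a" "a \<le> real H" using False j by (auto simp: a_def grid_def)
  have nj: "\<bar>node H j\<bar> = a * \<delta>" using \<delta>(1) by (simp add: node_def a_def \<delta>_def abs_mult)
  have t': "\<bar>t\<bar> \<le> \<delta>" using t by (simp add: \<delta>_def)
  have v: "2 * \<bar>v\<bar> = \<bar>t - node H j\<bar>" by (simp add: v_def)
  define A where "A = a * \<delta>"
  have A: "(a - 1) * \<delta> / 2 = (A - \<delta>) / 2" "(a + 1) * \<delta> / 2 = (A + \<delta>) / 2" by (simp_all add: A_def algebra_simps)
  have "\<bar>node H j\<bar> = A" using nj by (simp add: A_def)
  then have "(A - \<delta>) / 2 \<le> \<bar>v\<bar>" "\<bar>v\<bar> \<le> (A + \<delta>) / 2"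
    using t' v by (auto simp: abs_if split: if_splits)
  then have lower: "(a - 1) * \<delta> / 2 \<le> \<bar>v\<bar>" and "\<bar>v\<bar> \<le> (a + 1) * \<delta> / 2"
    unfolding A by auto
  note this(2)
  also have "\<dots> \<le> (real H + 1) * \<delta> / 2" using a \<delta> by (intro divide_right_mono mult_right_mono) auto
  also have "\<dots> = (pi + \<delta>) / 2" using \<delta> by (simp add: distrib_right)
  also have "\<dots> \<le> 9 / 4"
  proof -
    have "\<delta> \<le> pi / 8" unfolding \<delta>_def using H by (intro divide_left_mono) auto
    moreover have "pi / 8 \<le> 1 / 2" using pi_less_4 by simp
    ultimately have "\<delta> \<le> 1 / 2" by (rule order_trans)
    then show ?thesis using pi_less_4 by simp
  qed
  finally have "\<bar>v\<bar> / 7 \<le> \<bar>sin v\<bar>" by (rule abs_sin_ge)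
  with lower have "(a - 1) * \<delta> / 14 \<le> \<bar>sin v\<bar>" by linarith
  moreover have "(1 + a) * \<delta> / 42 \<le> (a - 1) * \<delta> / 14"
  proof -
    have "(1 + a) * \<delta> \<le> (3 * (a - 1)) * \<delta>" using a \<delta> by (intro mult_right_mono) auto
    then have "(1 + a) * \<delta> / 42 \<le> (3 * (a - 1)) * \<delta> / 42" by (rule divide_right_mono) simp
    also have "(3 * (a - 1)) * \<delta> / 42 = (a - 1) * \<delta> / 14" by (simp only: mult.assoc)
    finally show ?thesis .
  qed
  ultimately have s: "(1 + a) * \<delta> / 42 \<le> \<bar>sin v\<bar>" by linarith
  define g where "g = cmod (mean_wave n (t - node H j))"
  have g0: "0 \<le> g" by (simp add: g_def)
  have "real n * ((1 + a) * \<delta> / 42) * g \<le> real n * \<bar>sin v\<bar> * g"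
    using s g0 by (intro mult_right_mono mult_left_mono) auto
  also have "\<dots> \<le> 1" using norm_mean_wave_decay[of n "t - node H j"] by (simp add: g_def v_def)
  finally have le1: "real n * ((1 + a) * \<delta> / 42) * g \<le> 1" .
  have "6 / (c * real n) \<le> \<delta>"
  proof -
    have "3 / real H \<le> \<delta>" unfolding \<delta>_def using pi_gt3 by (intro divide_right_mono) auto
    moreover have "3 / (c * real n / 2) \<le> 3 / real H" using H n by (intro divide_left_mono) auto
    ultimately show ?thesis by (simp add: field_simps)
  qed
  then have "real n * ((1 + a) * (6 / (c * real n)) / 42) * g \<le> real n * ((1 + a) * \<delta> / 42) * g"
    using a g0 by (intro mult_right_mono mult_left_mono divide_right_mono) auto
  with le1 have "real n * ((1 + a) * (6 / (c * real n)) / 42) * g \<le> 1" by linarith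
  moreover have "real n * ((1 + a) * (6 / (c * real n)) / 42) = (1 + a) / (7 * c)"
    using n H(3) by (simp add: field_simps)
  ultimately have "(1 + a) / (7 * c) * g \<le> 1" by simp
  then have "g \<le> 7 * c / (1 + a)" using H(3) a by (simp add: field_simps)
  then show ?thesis by (simp add: g_def a_def)
qed

lemma norm_power_diff_scaled:
  fixes z w :: complex
  assumes "cmod z \<le> g" "cmod w \<le> g" "0 < g"
  shows "cmod (z ^ m - w ^ m) \<le> real m * g ^ (m - 1) * cmod (z - w)"
proof (cases m)
  case (Suc k)
  let ?g = "complex_of_real g"
  have "cmod ((z / ?g) ^ m - (w / ?g) ^ m) \<le> real m * cmod (z / ?g - w / ?g)"
    using assms by (intro norm_power_diff) (auto simp: norm_divide)
  moreover have "(z / ?g) ^ m - (w / ?g) ^ m = (z ^ m - w ^ m) / ?g ^ m"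
    by (simp add: power_divide diff_divide_distrib)
  moreover have "cmod ((z ^ m - w ^ m) / ?g ^ m) = cmod (z ^ m - w ^ m) / g ^ m"
    using assms(3) by (simp add: norm_divide norm_power)
  moreover have "cmod (z / ?g - w / ?g) = cmod (z - w) / g"
    using assms(3) by (simp add: norm_divide flip: diff_divide_distrib)
  ultimately have "cmod (z ^ m - w ^ m) / g ^ m \<le> real m * (cmod (z - w) / g)" by simp
  then show ?thesis using assms(3) Suc by (simp add: field_simps)
qed simp

lemma vp_kernel_bound:
  assumes n: "1 \<le> n" and H: "8 \<le> H" "2 * real H \<le> c * real n" "1 \<le> c" "(2 * e + 2) * n < 2 * H"
    and t: "\<bar>t\<bar> \<le> pi / real H" and j: "j \<in> grid H"
  shows "cmod (vp_kernel e n (t - node H j) / of_nat (2 * H)) \<le> (7 * c) ^ e / (1 + real_of_int \<bar>j\<bar>) ^ e"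
proof -
  let ?L = "{- int ((e + 1) * n)..int ((e + 1) * n)}"
  let ?x = "t - node H j"
  have "cmod (\<Sum>l\<in>?L. wave l ?x) \<le> (\<Sum>l\<in>?L. cmod (wave l ?x))" by (rule norm_sum)
  also have "\<dots> = real (card ?L)" by simp
  also have "\<dots> = real (2 * ((e + 1) * n) + 1)" unfolding card_symmetric_interval ..
  also have "\<dots> \<le> real (2 * H)" using H(4) by (intro of_nat_mono) auto
  finally have D: "cmod (\<Sum>l\<in>?L. wave l ?x) \<le> real (2 * H)" .
  have "cmod (mean_wave n ?x) ^ e \<le> (7 * c / (1 + real_of_int \<bar>j\<bar>)) ^ e"
    using assms by (intro power_mono norm_mean_wave_node_le) auto
  then have "cmod (vp_kernel e n ?x) \<le> real (2 * H) * ((7 * c) ^ e / (1 + real_of_int \<bar>j\<bar>) ^ e)"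
    unfolding vp_kernel_def norm_mult norm_power power_divide[symmetric] using D by (intro mult_mono) auto
  then show ?thesis using H by (simp add: norm_divide divide_le_eq mult_ac)
qed

lemma vp_kernel_diff_bound:
  assumes n: "1 \<le> n" and H: "8 \<le> H" "2 * real H \<le> c * real n" "1 \<le> c" "(2 * e + 2) * n < 2 * H" and e: "1 \<le> e"
    and t: "\<bar>t\<bar> \<le> pi / real H" "\<bar>u\<bar> \<le> pi / real H" and j: "j \<in> grid H"
  shows "cmod ((vp_kernel e n (t - node H j) - vp_kernel e n (u - node H j)) / of_nat (2 * H))
    \<le> real (2 * e + 1) * (7 * c) ^ (e - 1) * real n * \<bar>t - u\<bar> / (1 + real_of_int \<bar>j\<bar>) ^ (e - 1)"
proof -
  let ?L = "{- int ((e + 1) * n)..int ((e + 1) * n)}"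
  let ?x = "t - node H j" and ?y = "u - node H j"
  define d where "d = \<bar>t - u\<bar>"
  have d: "d = \<bar>?x - ?y\<bar>" by (simp add: d_def)
  define g where "g = 7 * c / (1 + real_of_int \<bar>j\<bar>)"
  have g: "0 < g" using H by (simp add: g_def)
  define D where "D = (\<lambda>x. \<Sum>l\<in>?L. wave l x)"
  define G where "G = mean_wave n"
  have card: "real (card ?L) \<le> real (2 * H)" 
  proof -
    have "(2 * e + 2) * n = 2 * ((e + 1) * n)" by simp
    then have "2 * ((e + 1) * n) + 1 \<le> 2 * H" using H(4) by linarith
    then show ?thesis unfolding card_symmetric_interval of_nat_le_iff .
  qed
  have "cmod (D ?y) \<le> (\<Sum>l\<in>?L. cmod (wave l ?y))" unfolding D_def by (rule norm_sum)
  then have D: "cmod (D ?y) \<le> real (2 * H)" using card by simp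
  have "cmod (D ?x - D ?y) = cmod (\<Sum>l\<in>?L. wave l ?x - wave l ?y)" by (simp add: D_def sum_subtractf)
  also have "\<dots> \<le> (\<Sum>l\<in>?L. real ((e + 1) * n) * d)"
  proof (intro sum_norm_le)
    fix l assume "l \<in> ?L"
    then have "\<bar>l\<bar> \<le> int ((e + 1) * n)" unfolding atLeastAtMost_iff by linarith
    then have "real_of_int \<bar>l\<bar> \<le> real_of_int (int ((e + 1) * n))" by (simp only: of_int_le_iff)
    then have "real_of_int \<bar>l\<bar> \<le> real ((e + 1) * n)" by (simp only: of_int_of_nat_eq)
    then show "cmod (wave l ?x - wave l ?y) \<le> real ((e + 1) * n) * d"
      unfolding d by (intro order_trans[OF norm_wave_diff_le] mult_right_mono) auto
  qed
  also have "\<dots> = real (card ?L) * (real ((e + 1) * n) * d)" by simp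
  also have "\<dots> \<le> real (2 * H) * (real ((e + 1) * n) * d)"
    using card by (intro mult_right_mono) (auto simp: d_def)
  finally have DD: "cmod (D ?x - D ?y) \<le> real (2 * H) * (real ((e + 1) * n) * d)" .
  have Gx: "cmod (G ?x) \<le> g" and Gy: "cmod (G ?y) \<le> g"
    unfolding G_def g_def
    using norm_mean_wave_node_le[OF n H(1-3) t(1) j] norm_mean_wave_node_le[OF n H(1-3) t(2) j] by auto
  have "cmod (G ?x) ^ e = cmod (G ?x) ^ (e - 1) * cmod (G ?x)" using e by (metis Suc_diff_1 mult.commute power_Suc less_le_trans zero_less_one)
  also have "\<dots> \<le> g ^ (e - 1) * 1" using Gx g norm_mean_wave_le_1[of n ?x]
    by (intro mult_mono power_mono) (auto simp: G_def)
  finally have Gp: "cmod (G ?x) ^ e \<le> g ^ (e - 1)" by simp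
  have GG: "cmod (G ?x ^ e - G ?y ^ e) \<le> real e * g ^ (e - 1) * (real n * d)"
  proof -
    have "cmod (G ?x ^ e - G ?y ^ e) \<le> real e * g ^ (e - 1) * cmod (G ?x - G ?y)"
      using Gx Gy g by (rule norm_power_diff_scaled)
    also have "\<dots> \<le> real e * g ^ (e - 1) * (real n * d)"
      unfolding d G_def using g by (intro mult_left_mono mean_wave_lipschitz) auto
    finally show ?thesis .
  qed
  have "vp_kernel e n ?x - vp_kernel e n ?y = (D ?x - D ?y) * G ?x ^ e + D ?y * (G ?x ^ e - G ?y ^ e)"
    by (simp add: vp_kernel_def D_def G_def algebra_simps)
  also have "cmod \<dots> \<le> cmod (D ?x - D ?y) * cmod (G ?x) ^ e + cmod (D ?y) * cmod (G ?x ^ e - G ?y ^ e)"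
    by (rule order_trans[OF norm_triangle_ineq]) (simp add: norm_mult norm_power)
  also have "\<dots> \<le> real (2 * H) * (real ((e + 1) * n) * d) * g ^ (e - 1) + real (2 * H) * (real e * g ^ (e - 1) * (real n * d))"
    using DD Gp D GG g by (intro add_mono mult_mono) (auto simp: d_def)
  also have "\<dots> = real (2 * H) * (real (2 * e + 1) * g ^ (e - 1) * real n * d)"
    by (simp add: algebra_simps)
  finally have "cmod (vp_kernel e n ?x - vp_kernel e n ?y) \<le> real (2 * H) * (real (2 * e + 1) * g ^ (e - 1) * real n * d)" .
  then have "cmod ((vp_kernel e n ?x - vp_kernel e n ?y) / of_nat (2 * H)) \<le> real (2 * e + 1) * g ^ (e - 1) * real n * d"
    using H by (simp add: norm_divide divide_le_eq mult_ac)
  then show ?thesis by (simp add: g_def d_def power_divide)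
qed

section \<open>Sampling operators on a grid\<close>

text \<open>
For fixed \<open>s\<close> this is a sum of translates of \<open>F\<close>; for fixed \<open>l = x + s\<close> it depends on \<open>F\<close> only through its samples
on the grid \<open>l + \<int> \<pi> / H\<close> and is a trigonometric polynomial in \<open>x\<close>.
\<close>

definition grid_conv :: "nat \<Rightarrow> nat \<Rightarrow> nat \<Rightarrow> real \<Rightarrow> (real \<Rightarrow> complex) \<Rightarrow> real \<Rightarrow> complex" where
  "grid_conv e n H s F x = (\<Sum>j\<in>grid H. vp_kernel e n (- s - node H j) / of_nat (2 * H) * F (x + s + node H j))"

text \<open>
The operator \<open>X = I - V\<close> on the grid of mesh \<open>\<pi> / H\<close>.
\<close>

definition grid_residual :: "nat \<Rightarrow> nat \<Rightarrow> nat \<Rightarrow> (real \<Rightarrow> complex) \<Rightarrow> real \<Rightarrow> complex" where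
  "grid_residual e n H = residual (grid H) (\<lambda>j. vp_kernel e n (- node H j) / of_nat (2 * H)) (pi / real H)"

text \<open>
The operator \<open>U = I + X + \<dots> + X\<^sup>k\<^sup>-\<^sup>1\<close>, chosen so that \<open>V U = I - X\<^sup>k\<close>.
\<close>

definition residual_sum :: "nat \<Rightarrow> nat \<Rightarrow> nat \<Rightarrow> nat \<Rightarrow> (real \<Rightarrow> complex) \<Rightarrow> real \<Rightarrow> complex" where
  "residual_sum e n H k F x = (\<Sum>a<k. (grid_residual e n H ^^ a) F x)"

text \<open>
The trigonometric polynomial, in the last argument \<open>x\<close>, that takes the values of \<open>F - X\<^sup>k F\<close> on the grid
\<open>l + \<int> \<pi> / H\<close>.
\<close>

definition sampled_poly :: "nat \<Rightarrow> nat \<Rightarrow> nat \<Rightarrow> nat \<Rightarrow> (real \<Rightarrow> complex) \<Rightarrow> real \<Rightarrow> real \<Rightarrow> complex" where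
  "sampled_poly e n H k F l x = (\<Sum>j\<in>grid H. vp_kernel e n (x - l - node H j) / of_nat (2 * H) * residual_sum e n H k F (l + node H j))"

text \<open>
The conditions relating the degree \<open>n\<close> and the grid size \<open>2 H\<close>: the grid is fine enough for the reproducing property
and has at most \<open>c n\<close> nodes.
\<close>

definition admissible :: "nat \<Rightarrow> real \<Rightarrow> nat \<Rightarrow> nat \<Rightarrow> bool" where
  "admissible e c n H \<longleftrightarrow> 1 \<le> n \<and> 8 \<le> H \<and> 1 \<le> c \<and> 2 * real H \<le> c * real n \<and> (2 * e + 2) * n < 2 * H"

lemma sampled_poly_eq_grid_conv: "sampled_poly e n H k F (x + s) x = grid_conv e n H s (residual_sum e n H k F) x"
  by (simp add: sampled_poly_def grid_conv_def algebra_simps)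

lemma grid_residual_eq_grid_conv: "grid_residual e n H F x = F x - grid_conv e n H 0 F x"
  by (simp add: grid_residual_def residual_def grid_conv_def node_def)

lemma torus_fun_grid_residual: "torus_fun F \<Longrightarrow> torus_fun (grid_residual e n H F)"
  unfolding grid_residual_def by (rule torus_fun_residual)

lemma torus_fun_grid_residual_power: "torus_fun F \<Longrightarrow> torus_fun ((grid_residual e n H ^^ a) F)"
  by (induction a) (auto intro: torus_fun_grid_residual)

lemma torus_fun_residual_sum: "torus_fun F \<Longrightarrow> torus_fun (residual_sum e n H k F)"
  unfolding residual_sum_def[abs_def] by (intro torus_fun_sum torus_fun_grid_residual_power)

lemma torus_fun_grid_conv: "torus_fun F \<Longrightarrow> torus_fun (grid_conv e n H s F)"
  unfolding grid_conv_def[abs_def] add.assoc by (intro torus_fun_sum torus_fun_cmult torus_fun_shift)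

lemma vp_kernel_periodic: "1 \<le> n \<Longrightarrow> vp_kernel e n (x + 2 * pi) = vp_kernel e n x"
  using trig_polys_torus_fun[OF vp_kernel_trig_poly] torus_fun_periodic by blast

lemma grid_conv_shift_node:
  assumes F: "torus_fun F" and n: "1 \<le> n" and H: "0 < H"
  shows "grid_conv e n H (s + node H i) F x = grid_conv e n H s F x"
proof -
  define \<phi> where "\<phi> j = vp_kernel e n (- s - node H j) / of_nat (2 * H) * F (x + s + node H j)" for j
  have "\<phi> (j + 2 * int H) = \<phi> j" for j
  proof -
    have "vp_kernel e n (- s - node H (j + 2 * int H)) = vp_kernel e n (- s - node H j)"
      using vp_kernel_periodic[OF n, of e "- s - node H (j + 2 * int H)"] H by (simp add: node_period)
    moreover have "F (x + s + node H (j + 2 * int H)) = F (x + s + node H j)"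
      using torus_fun_periodic[OF F, of "x + s + node H j"] H by (simp add: node_period add_ac)
    ultimately show ?thesis by (simp add: \<phi>_def)
  qed
  then have "(\<Sum>j\<in>grid H. \<phi> (j + i)) = (\<Sum>j\<in>grid H. \<phi> j)" by (rule sum_grid_shift)
  then show ?thesis by (simp add: grid_conv_def \<phi>_def node_add algebra_simps)
qed

text \<open>
Moving \<open>s\<close> by a node only permutes the summands, so \<open>s\<close> may be taken in one mesh width, where the
decay estimates for the kernel apply.
\<close>

lemma grid_conv_reduce:
  assumes F: "torus_fun F" and n: "1 \<le> n" and H: "0 < H"
  obtains s' where "0 \<le> s'" "s' < pi / real H" "grid_conv e n H s F = grid_conv e n H s' F"
proof
  define i where "i = \<lfloor>s / (pi / real H)\<rfloor>"
  have \<delta>: "0 < pi / real H" using H by simp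
  have "of_int i \<le> s / (pi / real H)" "s / (pi / real H) < of_int i + 1" unfolding i_def by linarith+
  then have "of_int i * (pi / real H) \<le> s" "s < (of_int i + 1) * (pi / real H)"
    using \<delta> by (simp_all only: pos_le_divide_eq pos_divide_less_eq)
  then show "0 \<le> s - node H i" "s - node H i < pi / real H" 
    unfolding node_def distrib_right by linarith+
  show "grid_conv e n H s F = grid_conv e n H (s - node H i) F"
    using grid_conv_shift_node[OF F n H, of e "s - node H i" i] by (simp add: fun_eq_iff)
qed

lemma grid_conv_add: "grid_conv e n H s (\<lambda>x. F x + G x) x = grid_conv e n H s F x + grid_conv e n H s G x"
  by (simp add: grid_conv_def distrib_left sum.distrib)

lemma residual_sum_Suc: "residual_sum e n H (Suc k) F = (\<lambda>x. residual_sum e n H k F x + (grid_residual e n H ^^ k) F x)"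
  by (simp add: residual_sum_def[abs_def])

lemma grid_conv_0_residual_sum: "grid_conv e n H 0 (residual_sum e n H k F) x = F x - (grid_residual e n H ^^ k) F x"
proof (induction k)
  case 0
  show ?case by (simp add: grid_conv_def residual_sum_def)
next
  case (Suc k)
  have "(grid_residual e n H ^^ Suc k) F x = (grid_residual e n H ^^ k) F x - grid_conv e n H 0 ((grid_residual e n H ^^ k) F) x"
    by (simp add: grid_residual_eq_grid_conv)
  then show ?case by (simp add: residual_sum_Suc grid_conv_add Suc)
qed

lemma sampled_poly_at_node:
  assumes F: "torus_fun F" and n: "1 \<le> n" and H: "0 < H"
  shows "sampled_poly e n H k F l (l + node H i) = F (l + node H i) - (grid_residual e n H ^^ k) F (l + node H i)"
proof -
  let ?x = "l + node H i"
  have "sampled_poly e n H k F l ?x = grid_conv e n H (- node H i) (residual_sum e n H k F) ?x"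
    using sampled_poly_eq_grid_conv[of e n H k F ?x "- node H i"] by simp
  also have "\<dots> = grid_conv e n H (- node H i + node H i) (residual_sum e n H k F) ?x"
    by (rule grid_conv_shift_node[symmetric]) (use F n H torus_fun_residual_sum in auto)
  finally show ?thesis by (simp add: grid_conv_0_residual_sum)
qed

lemma trig_polys_vp_kernel_sum:
  assumes "1 \<le> n"
  shows "(\<lambda>x. \<Sum>j\<in>J. vp_kernel e n (x - l - y j) / b * a j) \<in> trig_polys ((2 * e + 1) * n)"
proof -
  have "(\<lambda>x. \<Sum>j\<in>J. (a j / b) * vp_kernel e n (x + (- l - y j))) \<in> trig_polys ((2 * e + 1) * n)"
    using assms by (intro trig_polys_sum trig_polys_cmult trig_polys_shift vp_kernel_trig_poly)
  then show ?thesis by (simp add: algebra_simps)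
qed

lemma sampled_poly_trig_poly: "1 \<le> n \<Longrightarrow> sampled_poly e n H k F l \<in> trig_polys ((2 * e + 1) * n)"
  unfolding sampled_poly_def[abs_def] by (rule trig_polys_vp_kernel_sum)

text \<open>
The difference of the polynomials of two consecutive levels has degree at most \<open>2 (2 e + 1) n\<close>. It is
reproduced, by the kernel of that degree, from its values on the coarser grid, where it equals the difference of
the two \<open>X\<^sup>k F\<close>.
\<close>

lemma sampled_poly_refine:
  assumes F: "torus_fun F" and n: "1 \<le> n" and H: "0 < H" and H2: "(2 * e + 2) * (2 * (2 * e + 1) * n) < 2 * H"
  shows "sampled_poly e (2 * n) (2 * H) k F (x + s) x - sampled_poly e n H k F (x + s) x
    = grid_conv e (2 * (2 * e + 1) * n) H s (\<lambda>x. (grid_residual e n H ^^ k) F x - (grid_residual e (2 * n) (2 * H) ^^ k) F x) x"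
proof -
  define l where "l = x + s"
  define D where "D = (\<lambda>y. sampled_poly e (2 * n) (2 * H) k F l y - sampled_poly e n H k F l y)"
  have D: "D \<in> trig_polys (2 * (2 * e + 1) * n)"
    unfolding D_def using n sampled_poly_trig_poly[of "2 * n" e "2 * H" k F l] trig_polys_mono[OF sampled_poly_trig_poly[of n e H k F l], of "2 * (2 * e + 1) * n"]
    by (intro trig_polys_diff) (simp_all add: mult_ac)
  have "node H j = node (2 * H) (2 * j)" for j using H by (simp add: node_def)
  then have Dj: "D (l + node H j) = (grid_residual e n H ^^ k) F (l + node H j) - (grid_residual e (2 * n) (2 * H) ^^ k) F (l + node H j)" for j
    unfolding D_def using sampled_poly_at_node[OF F n H, of e k l j] sampled_poly_at_node[OF F, of "2 * n" "2 * H" e k l "2 * j"] n H by simp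
  have "D x = (\<Sum>j\<in>grid H. vp_kernel e (2 * (2 * e + 1) * n) (x - l - node H j) / of_nat (2 * H) * D (l + node H j))"
    using n by (intro vp_kernel_reproduce[symmetric] D H2) auto
  then show ?thesis unfolding Dj by (simp add: D_def grid_conv_def l_def algebra_simps)
qed

lemma sampled_poly_periodic:
  assumes F: "torus_fun F" and n: "1 \<le> n"
  shows "sampled_poly e n H k F (l + 2 * pi) x = sampled_poly e n H k F l x"
proof -
  have "vp_kernel e n (x - (l + 2 * pi) - y) = vp_kernel e n (x - l - y)" for y
    using vp_kernel_periodic[OF n, of e "x - (l + 2 * pi) - y"] by (simp add: algebra_simps)
  moreover have "residual_sum e n H k F (l + 2 * pi + y) = residual_sum e n H k F (l + y)" for y
    using torus_fun_periodic[OF torus_fun_residual_sum[OF F], of e n H k "l + y"] by (simp add: add_ac)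
  ultimately show ?thesis by (simp add: sampled_poly_def)
qed

lemma sampled_poly_measurable:
  assumes F: "torus_fun F" and n: "1 \<le> n"
  shows "case_prod (\<lambda>x l. F x - sampled_poly e n H k F l x) \<in> borel_measurable (borel \<Otimes>\<^sub>M borel)"
proof -
  have [measurable]: "vp_kernel e n \<in> borel_measurable borel" "residual_sum e n H k F \<in> borel_measurable borel" "F \<in> borel_measurable borel"
    using torus_fun_measurable trig_polys_torus_fun[OF vp_kernel_trig_poly[OF n]] torus_fun_residual_sum[OF F] F by blast+
  show ?thesis unfolding sampled_poly_def case_prod_beta' by measurable
qed

lemma sum_vp_kernel_grid:
  assumes "1 \<le> n" "(2 * e + 2) * n < 2 * H"
  shows "(\<Sum>j\<in>grid H. vp_kernel e n (- s - node H j) / of_nat (2 * H)) = 1"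
proof -
  have "(\<lambda>x. 1) \<in> trig_polys n" using trig_polys_wave[of 0 n] by (simp add: wave_def[abs_def])
  then show ?thesis using vp_kernel_reproduce[OF assms, of "\<lambda>x. 1" 0 s] by simp
qed

lemma weaken_decay:
  assumes "0 \<le> A" "a \<le> b"
  shows "A / (1 + real_of_int \<bar>j\<bar>) ^ b \<le> A / (1 + real_of_int \<bar>j\<bar>) ^ a"
  using assms by (intro divide_left_mono power_increasing) (auto intro!: mult_pos_pos zero_less_power add_pos_nonneg)

context
  fixes p :: ennreal and c :: real
  assumes p_pos: "0 < p"
begin

text \<open>
The kernel of order \<open>3 m\<close> has exactly the decay that \<open>Lp_norm_residual_le\<close> needs.
\<close>

private abbreviation "mp \<equiv> Lp_power p"
private abbreviation "ep \<equiv> 3 * Lp_power p"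
private abbreviation "Kp \<equiv> Lp_const p 3 * (7 * c) ^ (3 * Lp_power p)"

lemma vp_kernel_node_le:
  assumes "admissible ep c n H" "\<bar>t\<bar> \<le> pi / real H" "j \<in> grid H"
  shows "cmod (vp_kernel ep n (t - node H j) / of_nat (2 * H)) \<le> (7 * c) ^ ep / (1 + real_of_int \<bar>j\<bar>) ^ ep"
  using assms by (intro vp_kernel_bound) (auto simp: admissible_def)

lemma Lp_norm_grid_conv_le:
  assumes ok: "admissible ep c n H" and F: "torus_fun F" "Lp_norm p F \<le> ennreal B" "0 \<le> B"
  shows "Lp_norm p (grid_conv ep n H s F) \<le> ennreal (Kp * B)"
proof -
  have n: "1 \<le> n" "0 < H" "1 \<le> c" using ok by (auto simp: admissible_def)
  obtain s' where s': "0 \<le> s'" "s' < pi / real H" and eq: "grid_conv ep n H s F = grid_conv ep n H s' F"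
    using grid_conv_reduce[OF F(1) n(1,2)] by metis
  have "Lp_norm p (\<lambda>x. \<Sum>j\<in>grid H. vp_kernel ep n (- s' - node H j) / of_nat (2 * H) * F (x + (s' + node H j))) \<le> ennreal (Lp_const p 3 * ((7 * c) ^ ep * B))"
  proof (rule Lp_norm_conv[OF p_pos finite_grid F])
    fix j assume "j \<in> grid H"
    then have "cmod (vp_kernel ep n (- s' - node H j) / of_nat (2 * H)) \<le> (7 * c) ^ ep / (1 + real_of_int \<bar>j\<bar>) ^ ep"
      using s' by (intro vp_kernel_node_le ok) auto
    also have "\<dots> \<le> (7 * c) ^ ep / (1 + real_of_int \<bar>j\<bar>) ^ (2 * mp)"
      using n by (intro weaken_decay) auto
    finally show "cmod (vp_kernel ep n (- s' - node H j) / of_nat (2 * H)) \<le> (7 * c) ^ ep / (1 + real_of_int \<bar>j\<bar>) ^ (2 * mp)" .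
  qed (use n in auto)
  then show ?thesis unfolding eq unfolding grid_conv_def[abs_def] by (simp add: add.assoc mult.assoc)
qed

lemma Lp_norm_grid_residual_power_le:
  assumes ok: "admissible ep c n H" and F: "torus_fun F" "Lp_norm p (difference k (pi / real H) F) \<le> ennreal B" "0 \<le> B"
  shows "Lp_norm p ((grid_residual ep n H ^^ k) F) \<le> ennreal (Kp ^ k * B)"
  unfolding grid_residual_def
proof (rule Lp_norm_residual_power_le[OF p_pos finite_grid F(1) _ _ _ F(3,2)])
  show "(\<Sum>j\<in>grid H. vp_kernel ep n (- node H j) / of_nat (2 * H)) = 1"
    using ok sum_vp_kernel_grid[of n ep H 0] by (simp add: admissible_def)
  show "cmod (vp_kernel ep n (- node H j) / of_nat (2 * H)) \<le> (7 * c) ^ ep / (1 + real_of_int \<bar>j\<bar>) ^ ep" if "j \<in> grid H" for j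
    using vp_kernel_node_le[OF ok, of 0 j] that by simp
qed (use ok in \<open>auto simp: admissible_def\<close>)

text \<open>
Continuity of translation controls the nodes near \<open>0\<close>, and the decay of the kernel the remaining ones.
\<close>

lemma Lp_norm_grid_conv_diff_le:
  assumes ok: "admissible ep c n H" and F: "torus_fun F" "Lp_norm p F \<le> ennreal B" "0 \<le> B"
    and d: "0 < d" "0 \<le> \<eta>" "\<And>u. \<bar>u\<bar> \<le> d \<Longrightarrow> Lp_norm p (fdiff u F) \<le> ennreal \<eta>"
    and small: "2 * Lp_const p 2 * B * (pi / real H) \<le> \<eta> * d"
  shows "Lp_norm p (\<lambda>x. F x - grid_conv ep n H s F x) \<le> ennreal (Kp * \<eta>)"
proof -
  have n: "1 \<le> n" "0 < H" "1 \<le> c" using ok by (auto simp: admissible_def)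
  obtain s' where s': "0 \<le> s'" "s' < pi / real H" and eq: "grid_conv ep n H s F = grid_conv ep n H s' F"
    using grid_conv_reduce[OF F(1) n(1,2)] by metis
  define v where "v j = vp_kernel ep n (- s' - node H j) / of_nat (2 * H)" for j
  have v1: "(\<Sum>j\<in>grid H. v j) = 1"
    unfolding v_def using ok by (intro sum_vp_kernel_grid) (auto simp: admissible_def)
  have "F x - grid_conv ep n H s' F x = (\<Sum>j\<in>grid H. v j) * F x - (\<Sum>j\<in>grid H. v j * F (x + (s' + node H j)))" for x
    by (simp add: v1) (simp add: grid_conv_def v_def add.assoc)
  then have eq2: "(\<lambda>x. F x - grid_conv ep n H s F x) = (\<lambda>x. \<Sum>j\<in>grid H. v j * fdiff (s' + node H j) F x)"
    by (simp add: eq fun_eq_iff fdiff_def sum_distrib_right sum_subtractf[symmetric] right_diff_distrib)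
  have "Lp_norm p (\<lambda>x. \<Sum>j\<in>grid H. v j * fdiff (s' + node H j) F x) \<le> ennreal (Lp_const p 3 * ((7 * c) ^ ep * \<eta>))"
  proof (rule Lp_norm_sum_int[OF p_pos finite_grid])
    fix j assume j: "j \<in> grid H"
    define a where "a = 1 + real_of_int \<bar>j\<bar>"
    have a: "1 \<le> a" by (simp add: a_def)
    have step: "Lp_norm p (fdiff (s' + node H j) F) \<le> ennreal (a * \<eta>)"
    proof (cases "\<bar>s' + node H j\<bar> \<le> d")
      case True
      have "\<eta> \<le> a * \<eta>" using a d mult_right_mono[of 1 a \<eta>] by simp
      then show ?thesis using d(3)[OF True] by (meson ennreal_leI order_trans)
    next
      case False
      have "\<bar>s' + node H j\<bar> \<le> pi / real H + real_of_int \<bar>j\<bar> * (pi / real H)"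
        using s' abs_triangle_ineq[of s' "node H j"] by (simp add: node_def abs_mult)
      also have "\<dots> = a * (pi / real H)" by (simp only: a_def distrib_right mult_1)
      finally have "d \<le> a * (pi / real H)" using False by simp
      then have "\<eta> * d \<le> \<eta> * (a * (pi / real H))" using d by (intro mult_left_mono) auto
      with small have "2 * Lp_const p 2 * B * (pi / real H) \<le> (a * \<eta>) * (pi / real H)" by (simp add: mult_ac)
      then have le: "2 * Lp_const p 2 * B \<le> a * \<eta>" using n by (simp add: divide_le_cancel)
      have "Lp_norm p (difference 1 (s' + node H j) F) \<le> ennreal ((2 * Lp_const p 2) ^ 1 * B)"
        by (intro Lp_norm_difference_le p_pos F)
      then show ?thesis using le by (simp add: difference_eq_funpow) (meson ennreal_leI order_trans)
    qed
    have "Lp_norm p (\<lambda>x. v j * fdiff (s' + node H j) F x) \<le> ennreal ((7 * c) ^ ep / a ^ ep * (a * \<eta>))"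
      using step s' j a d unfolding v_def a_def
      by (intro Lp_norm_cmult p_pos torus_fun_fdiff F vp_kernel_node_le ok) auto
    also have "(7 * c) ^ ep / a ^ ep * (a * \<eta>) \<le> (7 * c) ^ ep * \<eta> / a ^ (2 * mp)"
    proof -
      have "ep = 2 * mp + (mp - 1) + 1" using Lp_power_pos[of p] by simp
      then have "a ^ ep = a ^ (2 * mp) * a ^ (mp - 1) * a" by (metis power_add power_one_right)
      then have "(7 * c) ^ ep / a ^ ep * (a * \<eta>) = (7 * c) ^ ep * \<eta> / a ^ (2 * mp) / a ^ (mp - 1)"
        using a by simp
      also have "\<dots> \<le> (7 * c) ^ ep * \<eta> / a ^ (2 * mp) / 1"
        using a n d by (intro divide_left_mono) (auto simp: one_le_power)
      finally show ?thesis by simp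
    qed
    finally show "Lp_norm p (\<lambda>x. v j * fdiff (s' + node H j) F x) \<le> ennreal ((7 * c) ^ ep * \<eta> / (1 + real_of_int \<bar>j\<bar>) ^ (2 * mp))"
      by (simp add: a_def ennreal_leI)
  qed (use F n d in \<open>auto intro!: torus_fun_cmult torus_fun_fdiff\<close>)
  then show ?thesis by (simp add: eq2 mult.assoc)
qed

lemma K_ge_1: "1 \<le> c \<Longrightarrow> 1 \<le> Kp"
proof -
  assume "1 \<le> c"
  then have "1 \<le> (7 * c) ^ ep" by (intro one_le_power) simp
  moreover have "1 \<le> Lp_const p 3" by (intro Lp_const_ge) simp
  ultimately show ?thesis using mult_mono[of 1 "Lp_const p 3" 1 "(7 * c) ^ ep"] by simp
qed

text \<open>
If convolution with the kernel is close to the identity on \<open>F\<close>, then \<open>X\<^sup>i F\<close> is small for \<open>i \<ge> 1\<close>, so the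
additional terms in \<open>U F\<close> do not matter. The exponent \<open>Suc k\<close> records \<open>i \<ge> 1\<close>.
\<close>

lemma Lp_norm_sampled_poly_limit:
  assumes c: "1 \<le> c"
  shows "\<exists>C\<ge>0. \<forall>n H F \<eta> s. admissible ep c n H \<longrightarrow> torus_fun F \<longrightarrow> 0 \<le> \<eta> \<longrightarrow>
    (\<forall>s. Lp_norm p (\<lambda>x. F x - grid_conv ep n H s F x) \<le> ennreal \<eta>) \<longrightarrow>
    Lp_norm p (\<lambda>x. F x - grid_conv ep n H s (residual_sum ep n H (Suc k) F) x) \<le> ennreal (C * \<eta>) \<and>
    Lp_norm p ((grid_residual ep n H ^^ Suc k) F) \<le> ennreal (C * \<eta>)"
proof (induction k)
  case 0
  have "grid_residual ep n H F = (\<lambda>x. F x - grid_conv ep n H 0 F x)" for F n H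
    by (rule ext) (rule grid_residual_eq_grid_conv)
  moreover have "residual_sum ep n H (Suc 0) F = F" for F n H by (simp add: residual_sum_def fun_eq_iff)
  ultimately show ?case by (intro exI[of _ 1]) auto
next
  case (Suc k)
  then obtain C where C: "0 \<le> C" and 
    IH: "\<And>n H F \<eta> s. admissible ep c n H \<Longrightarrow> torus_fun F \<Longrightarrow> 0 \<le> \<eta> \<Longrightarrow>
    (\<forall>s. Lp_norm p (\<lambda>x. F x - grid_conv ep n H s F x) \<le> ennreal \<eta>) \<Longrightarrow>
    Lp_norm p (\<lambda>x. F x - grid_conv ep n H s (residual_sum ep n H (Suc k) F) x) \<le> ennreal (C * \<eta>) \<and>
    Lp_norm p ((grid_residual ep n H ^^ Suc k) F) \<le> ennreal (C * \<eta>)"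
    by blast
  define C' where "C' = Lp_const p 2 * (C + Kp * C)"
  have Kp: "1 \<le> Kp" by (rule K_ge_1[OF c])
  show ?case
  proof (intro exI[of _ C'] conjI allI impI)
    show "0 \<le> C'" using C Kp by (simp add: C'_def Lp_const_nonneg)
    fix n H F \<eta> s
    assume ok: "admissible ep c n H" and F: "torus_fun F" and \<eta>: "0 \<le> \<eta>"
      and le: "\<forall>s. Lp_norm p (\<lambda>x. F x - grid_conv ep n H s F x) \<le> ennreal \<eta>"
    define G where "G = (grid_residual ep n H ^^ Suc k) F"
    have G: "torus_fun G" "Lp_norm p G \<le> ennreal (C * \<eta>)"
      unfolding G_def using IH[OF ok F \<eta> le] F by (blast intro: torus_fun_grid_residual_power)+
    have sG: "Lp_norm p (grid_conv ep n H s G) \<le> ennreal (Kp * (C * \<eta>))" for s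
      using C \<eta> by (intro Lp_norm_grid_conv_le ok G) auto
    have const: "Lp_const p 2 * (C * \<eta> + Kp * (C * \<eta>)) = C' * \<eta>" by (simp add: C'_def algebra_simps)
    have "(\<lambda>x. F x - grid_conv ep n H s (residual_sum ep n H (Suc (Suc k)) F) x)
      = (\<lambda>x. (F x - grid_conv ep n H s (residual_sum ep n H (Suc k) F) x) - grid_conv ep n H s G x)"
      by (rule ext) (simp only: residual_sum_Suc[of _ _ _ "Suc k"] grid_conv_add G_def diff_diff_add)
    moreover have "Lp_norm p (\<lambda>x. (F x - grid_conv ep n H s (residual_sum ep n H (Suc k) F) x) - grid_conv ep n H s G x) \<le> ennreal (Lp_const p 2 * (C * \<eta> + Kp * (C * \<eta>)))"
      using IH[OF ok F \<eta> le, of s] sG F G C Kp \<eta> 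
      by (intro Lp_norm_diff p_pos torus_fun_diff torus_fun_grid_conv torus_fun_residual_sum) auto
    ultimately show "Lp_norm p (\<lambda>x. F x - grid_conv ep n H s (residual_sum ep n H (Suc (Suc k)) F) x) \<le> ennreal (C' * \<eta>)"
      by (simp only: const)
    have "(grid_residual ep n H ^^ Suc (Suc k)) F = (\<lambda>x. G x - grid_conv ep n H 0 G x)"
      by (simp add: G_def grid_residual_eq_grid_conv fun_eq_iff)
    moreover have "Lp_norm p (\<lambda>x. G x - grid_conv ep n H 0 G x) \<le> ennreal (Lp_const p 2 * (C * \<eta> + Kp * (C * \<eta>)))"
      using sG G C Kp \<eta> by (intro Lp_norm_diff p_pos torus_fun_grid_conv) auto
    ultimately show "Lp_norm p ((grid_residual ep n H ^^ Suc (Suc k)) F) \<le> ennreal (C' * \<eta>)"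
      by (simp only: const)
  qed
qed

end

section \<open>A Jackson estimate at dyadic scales\<close>

text \<open>
Borel periodic functions of finite norm, continuous if \<open>p = \<infinity>\<close>, with \<open>\<parallel>\<Delta>\<^sub>\<delta>\<^sup>k F\<parallel> \<le> \<Theta> \<delta>\<^sup>\<alpha>\<close> for all steps \<open>\<delta> \<le> d\<close>; this is
how the functional \<open>\<theta>\<close> enters the estimates.
\<close>

definition smooth_upto :: "ennreal \<Rightarrow> nat \<Rightarrow> real \<Rightarrow> real \<Rightarrow> real \<Rightarrow> (real \<Rightarrow> complex) \<Rightarrow> bool" where
  "smooth_upto p k \<alpha> \<Theta> d F \<longleftrightarrow>
     torus_fun F \<and> Lp_norm p F < \<infinity> \<and> (p = \<infinity> \<longrightarrow> continuous_on UNIV F) \<and>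
     (\<forall>\<delta>. 0 < \<delta> \<longrightarrow> \<delta> \<le> d \<longrightarrow> Lp_norm p (difference k \<delta> F) \<le> ennreal (\<Theta> * \<delta> powr \<alpha>))"

lemma smooth_upto_mono: "smooth_upto p k \<alpha> \<Theta> d F \<Longrightarrow> d' \<le> d \<Longrightarrow> smooth_upto p k \<alpha> \<Theta> d' F"
  unfolding smooth_upto_def by (meson order_trans)

lemma sum_power_le:
  fixes \<rho> :: real
  assumes "0 \<le> \<rho>" "\<rho> < 1"
  shows "(\<Sum>i<I. \<rho> ^ i) \<le> 1 / (1 - \<rho>)"
proof -
  have "(1 - \<rho>) * (\<Sum>i<I. \<rho> ^ i) = 1 - \<rho> ^ I" by (rule one_diff_power_eq[symmetric])
  also have "\<dots> \<le> 1" using assms by simp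
  finally show ?thesis using assms by (simp add: pos_le_divide_eq mult.commute)
qed

lemma powr_dyadic:
  assumes "0 < (x::real)"
  shows "(2 ^ i * x) powr a = (2 powr a) ^ i * x powr a"
proof -
  have "(2 ^ i :: real) powr a = (2 powr a) ^ i"
    by (simp add: powr_realpow[symmetric] powr_powr mult.commute)
  then show ?thesis using assms by (simp add: powr_mult)
qed

text \<open>
Half the number of nodes per unit of degree. It is large enough that the grid of level \<open>N\<close> reproduces polynomials of
degree \<open>2 (2 e + 1) N\<close> as well, and that its mesh is below \<open>1 / (4 (2 e + 1) N)\<close>.
\<close>

definition grid_ratio :: "nat \<Rightarrow> nat" where
  "grid_ratio e = 13 * (2 * e + 1) * (2 * e + 2)"

lemma grid_ratio_ge: "26 \<le> grid_ratio e"
proof -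
  have "13 * 1 * 2 \<le> 13 * (2 * e + 1) * (2 * e + 2)" by (intro mult_mono) auto
  then show ?thesis by (simp add: grid_ratio_def)
qed

lemma admissible_grid_ratio:
  assumes "1 \<le> N"
  shows "admissible e (2 * real (grid_ratio e)) N (grid_ratio e * N)"
proof -
  have "8 * 1 \<le> grid_ratio e * N" using assms grid_ratio_ge[of e] by (intro mult_mono) auto
  moreover have "(2 * e + 2) * N < 2 * (grid_ratio e * N)"
  proof -
    have "1 * (2 * e + 2) < 26 * (2 * e + 1) * (2 * e + 2)" by (rule mult_strict_right_mono) auto
    then have "(2 * e + 2) < 2 * grid_ratio e" by (simp add: grid_ratio_def)
    then show ?thesis using assms by (metis less_le_trans mult.assoc mult_less_cancel2 zero_less_one)
  qed
  ultimately show ?thesis using assms grid_ratio_ge[of e] by (simp add: admissible_def)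
qed

lemma admissible_grid_ratio_refined:
  assumes "1 \<le> N"
  shows "admissible e (2 * real (grid_ratio e)) (2 * (2 * e + 1) * N) (grid_ratio e * N)"
proof -
  have "8 * 1 \<le> grid_ratio e * N" using assms grid_ratio_ge[of e] by (intro mult_mono) auto
  moreover have "(2 * e + 2) * (2 * (2 * e + 1) * N) < 2 * (grid_ratio e * N)"
  proof -
    have "2 * ((2 * e + 1) * (2 * e + 2) * N) < 26 * ((2 * e + 1) * (2 * e + 2) * N)"
      using assms by (intro mult_strict_right_mono) auto
    then show ?thesis by (simp add: grid_ratio_def algebra_simps)
  qed
  moreover have "real (grid_ratio e * N) \<le> real (grid_ratio e) * real (2 * (2 * e + 1) * N)"
    by (simp add: mult_left_mono del: of_nat_add)
  ultimately show ?thesis using assms grid_ratio_ge[of e] by (simp add: admissible_def algebra_simps)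
qed

lemma trig_polys_const: "(\<lambda>x. z) \<in> trig_polys n"
  using trig_polys_cmult[OF trig_polys_wave[of 0 n], of z] by simp

lemma trig_polys_translate_eq:
  assumes "admissible e c n H" "T \<in> trig_polys n"
  shows "T (x + t) = (\<Sum>j\<in>grid H. vp_kernel e n (t - node H j) / of_nat (2 * H) * T (x + node H j))"
  using vp_kernel_reproduce[of n e H T "x + t" x] assms by (simp add: admissible_def)

lemma trig_polys_fdiff_eq:
  assumes "admissible e c n H" "T \<in> trig_polys n"
  shows "fdiff h T x = (\<Sum>j\<in>grid H. (vp_kernel e n (0 - node H j) - vp_kernel e n (h - node H j)) / of_nat (2 * H) * T (x + node H j))"
  using trig_polys_translate_eq[OF assms, of x 0] trig_polys_translate_eq[OF assms, of x h]
  by (simp add: fdiff_def sum_subtractf[symmetric] diff_divide_distrib left_diff_distrib)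

lemma Holder_norm_le:
  assumes "Lp_norm p G \<le> ennreal A" "0 \<le> A" "0 \<le> B"
    and le: "\<And>h. 0 < h \<Longrightarrow> Lp_norm p (difference r h G) \<le> ennreal (B * h powr \<alpha>)"
  shows "Holder_norm p r \<alpha> G \<le> ennreal (A + B)"
proof -
  have "Holder_seminorm p r \<alpha> G \<le> ennreal B"
    unfolding Holder_seminorm_def
  proof (rule SUP_least)
    fix h :: real assume "h \<in> {0<..}"
    then have h: "0 < h" by simp
    have "ennreal (h powr - \<alpha>) * Lp_norm p (difference r h G) \<le> ennreal (h powr - \<alpha>) * ennreal (B * h powr \<alpha>)"
      by (intro mult_left_mono le h) auto
    also have "\<dots> = ennreal (h powr - \<alpha> * (B * h powr \<alpha>))" by (simp add: ennreal_mult')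
    also have "h powr - \<alpha> * (B * h powr \<alpha>) = B" using h by (simp add: powr_minus)
    finally show "ennreal (h powr - \<alpha>) * Lp_norm p (difference r h G) \<le> ennreal B" .
  qed
  then have "Holder_norm p r \<alpha> G \<le> ennreal A + ennreal B"
    unfolding Holder_norm_def using assms(1) by (intro add_mono)
  then show ?thesis using assms by simp
qed

lemma ex_dyadic:
  fixes y :: real
  assumes "1 \<le> y"
  obtains I :: nat where "2 ^ I \<le> y" "y < 2 ^ Suc I"
proof -
  obtain J :: nat where "y < 2 ^ J" using real_arch_pow[of 2 y] by auto
  then have ex: "\<exists>I. y < 2 ^ Suc I" by (intro exI[of _ J]) (simp add: less_le_trans)
  define I where "I = (LEAST I. y < 2 ^ Suc I)"
  have 1: "y < 2 ^ Suc I" unfolding I_def using ex by (rule LeastI_ex)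
  have "2 ^ I \<le> y"
  proof (cases I)
    case (Suc I')
    then have "\<not> y < 2 ^ Suc I'" unfolding I_def by (intro not_less_Least) simp
    then show ?thesis using Suc by simp
  qed (use assms in simp)
  with 1 show ?thesis by (intro that)
qed

context
  fixes p :: ennreal
  assumes p_pos: "0 < p"
begin

text \<open>
\<open>K\<close> bounds convolution with the kernel on \<open>L\<^sub>p\<close>, \<open>K2\<close> is the constant of the quasi-triangle inequality, and \<open>A0\<close> is the
constant of \<open>vp_kernel_diff_bound\<close>.
\<close>

private abbreviation "m \<equiv> Lp_power p"
private abbreviation "e \<equiv> 3 * Lp_power p"
private abbreviation "c \<equiv> 2 * real (grid_ratio (3 * Lp_power p))"
private abbreviation "K \<equiv> Lp_const p 3 * (7 * (2 * real (grid_ratio (3 * Lp_power p)))) ^ (3 * Lp_power p)"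
private abbreviation "K2 \<equiv> Lp_const p 2"
private abbreviation "A0 \<equiv> real (2 * (3 * Lp_power p) + 1) * (7 * (2 * real (grid_ratio (3 * Lp_power p)))) ^ (3 * Lp_power p - 1)"

lemma sampled_poly_refine_le:
  assumes F: "torus_fun F" and N: "1 \<le> N" and b: "0 \<le> b"
    and "Lp_norm p (difference k (pi / real (grid_ratio e * N)) F) \<le> ennreal b"
    and "Lp_norm p (difference k (pi / real (grid_ratio e * (2 * N))) F) \<le> ennreal b"
  shows "Lp_norm p (\<lambda>x. sampled_poly e (2 * N) (grid_ratio e * (2 * N)) k F (x + s) x - sampled_poly e N (grid_ratio e * N) k F (x + s) x)
    \<le> ennreal (2 * K * Lp_const p 2 * K ^ k * b)"
proof -
  let ?H = "grid_ratio e * N"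
  have c1: "1 \<le> c" using grid_ratio_ge[of e] by simp
  have K: "1 \<le> K" using K_ge_1[OF p_pos c1] .
  have H2: "grid_ratio e * (2 * N) = 2 * ?H" by simp
  have ok: "admissible e c N ?H" "admissible e c (2 * N) (2 * ?H)" "admissible e c (2 * (2 * e + 1) * N) ?H"
    using admissible_grid_ratio[OF N, of e] admissible_grid_ratio[of "2 * N" e] admissible_grid_ratio_refined[OF N, of e] N 
    unfolding H2 by auto
  define Z where "Z = (\<lambda>x. (grid_residual e N ?H ^^ k) F x - (grid_residual e (2 * N) (2 * ?H) ^^ k) F x)"
  have Z: "torus_fun Z" unfolding Z_def by (intro torus_fun_diff torus_fun_grid_residual_power F)
  have "Lp_norm p ((grid_residual e N ?H ^^ k) F) \<le> ennreal (K ^ k * b)"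
    using assms by (intro Lp_norm_grid_residual_power_le p_pos ok) auto
  moreover have "Lp_norm p ((grid_residual e (2 * N) (2 * ?H) ^^ k) F) \<le> ennreal (K ^ k * b)"
    using assms by (intro Lp_norm_grid_residual_power_le p_pos ok) (auto simp: H2[symmetric] simp del: mult.left_commute)
  ultimately have "Lp_norm p Z \<le> ennreal (Lp_const p 2 * (K ^ k * b + K ^ k * b))"
    unfolding Z_def using K b by (intro Lp_norm_diff p_pos torus_fun_grid_residual_power F) auto
  then have "Lp_norm p (grid_conv e (2 * (2 * e + 1) * N) ?H s Z) \<le> ennreal (K * (Lp_const p 2 * (K ^ k * b + K ^ k * b)))"
    using K b by (intro Lp_norm_grid_conv_le p_pos ok Z) (auto simp: Lp_const_nonneg)
  moreover have "(\<lambda>x. sampled_poly e (2 * N) (2 * ?H) k F (x + s) x - sampled_poly e N ?H k F (x + s) x) = grid_conv e (2 * (2 * e + 1) * N) ?H s Z"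
    unfolding Z_def using ok by (intro ext sampled_poly_refine F) (auto simp: admissible_def)
  ultimately show ?thesis by (simp add: H2 algebra_simps)
qed

lemma sampled_poly_tendsto:
  assumes F: "torus_fun F" "Lp_norm p F < \<infinity>" "p = \<infinity> \<Longrightarrow> continuous_on UNIV F" and k: "1 \<le> k" and \<epsilon>: "0 < \<epsilon>"
  shows "\<exists>N0. \<forall>N\<ge>N0. 1 \<le> N \<longrightarrow> (\<forall>s. Lp_norm p (\<lambda>x. F x - sampled_poly e N (grid_ratio e * N) k F (x + s) x) \<le> ennreal \<epsilon>)"
proof -
  have c1: "1 \<le> c" using grid_ratio_ge[of e] by simp
  have K: "1 \<le> K" using K_ge_1[OF p_pos c1] .
  obtain C where C: "0 \<le> C" and 
    lim: "\<And>n H F \<eta> s. admissible e c n H \<Longrightarrow> torus_fun F \<Longrightarrow> 0 \<le> \<eta> \<Longrightarrow>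
    (\<forall>s. Lp_norm p (\<lambda>x. F x - grid_conv e n H s F x) \<le> ennreal \<eta>) \<Longrightarrow>
    Lp_norm p (\<lambda>x. F x - grid_conv e n H s (residual_sum e n H (Suc (k - 1)) F) x) \<le> ennreal (C * \<eta>)"
    using Lp_norm_sampled_poly_limit[OF p_pos c1, of "k - 1"] by blast
  define \<eta> where "\<eta> = \<epsilon> / (C * K + 1)"
  have CK: "0 \<le> C * K" using C K by simp
  have \<eta>: "0 < \<eta>" using \<epsilon> CK by (simp add: \<eta>_def)
  obtain B where B: "0 \<le> B" "Lp_norm p F \<le> ennreal B" using F(2) by (cases "Lp_norm p F") auto
  obtain d where d: "0 < d" "\<And>u. \<bar>u\<bar> \<le> d \<Longrightarrow> Lp_norm p (fdiff u F) \<le> ennreal \<eta>"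
    using Lp_norm_shift_small[OF p_pos F \<eta>] by blast
  obtain N0 where N0: "2 * Lp_const p 2 * B * pi / (\<eta> * d) \<le> real N0" using real_arch_simple by blast
  have "Lp_norm p (\<lambda>x. F x - sampled_poly e N (grid_ratio e * N) k F (x + s) x) \<le> ennreal \<epsilon>" if N: "N0 \<le> N" "1 \<le> N" for N s
  proof -
    let ?H = "grid_ratio e * N"
    have ok: "admissible e c N ?H" by (rule admissible_grid_ratio[OF N(2)])
    have "1 * N \<le> ?H" using grid_ratio_ge[of e] by (intro mult_right_mono) auto
    then have "N0 \<le> ?H" "0 < ?H" using N by linarith+
    then have H: "real N0 \<le> real ?H" "0 < real ?H" by (simp_all only: of_nat_le_iff of_nat_0_less_iff)
    have "2 * Lp_const p 2 * B * pi \<le> real N0 * (\<eta> * d)"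
      using N0 \<eta> d(1) by (simp add: pos_divide_le_eq)
    also have "\<dots> \<le> real ?H * (\<eta> * d)" using H \<eta> d(1) by (intro mult_right_mono) auto
    finally have small: "2 * Lp_const p 2 * B * (pi / real ?H) \<le> \<eta> * d"
      using H(2) by (simp add: pos_divide_le_eq mult.commute)
    have "Lp_norm p (\<lambda>x. F x - grid_conv e N ?H s F x) \<le> ennreal (K * \<eta>)" for s
      using \<eta> d by (intro Lp_norm_grid_conv_diff_le[OF p_pos ok F(1) B(2,1) _ _ _ small]) auto
    then have "Lp_norm p (\<lambda>x. F x - grid_conv e N ?H s (residual_sum e N ?H (Suc (k - 1)) F) x) \<le> ennreal (C * (K * \<eta>))"
      using K \<eta> by (intro lim ok F) auto
    also have "C * (K * \<eta>) \<le> \<epsilon>"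
    proof -
      have "C * (K * \<eta>) \<le> (C * K + 1) * \<eta>" using \<eta> by (simp add: algebra_simps)
      also have "\<dots> = \<epsilon>" using CK by (simp add: \<eta>_def)
      finally show ?thesis .
    qed
    finally show ?thesis using k by (simp add: sampled_poly_eq_grid_conv ennreal_leI)
  qed
  then show ?thesis by blast
qed

text \<open>
The error on each diagonal \<open>l = x + s\<close>, by telescoping over the levels \<open>2\<^sup>i N\<close>. The increments decay like \<open>2\<^sup>-\<^sup>\<alpha>\<^sup>i\<close>,
so \<open>Lp_norm_sum\<close> applies with geometric weights.
\<close>

lemma sampled_poly_error_le:
  assumes k: "1 \<le> k" and \<alpha>: "0 < \<alpha>"
  shows "\<exists>C>0. \<forall>F \<Theta> N s. smooth_upto p k \<alpha> \<Theta> (pi / real (grid_ratio e * N)) F \<longrightarrow> 0 < \<Theta> \<longrightarrow> 1 \<le> N \<longrightarrow>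
    Lp_norm p (\<lambda>x. F x - sampled_poly e N (grid_ratio e * N) k F (x + s) x) \<le> ennreal (C * (\<Theta> * real N powr - \<alpha>))"
proof -
  have c1: "1 \<le> c" using grid_ratio_ge[of e] by simp
  have K: "1 \<le> K" using K_ge_1[OF p_pos c1] .
  define C1 where "C1 = 2 * K * Lp_const p 2 * K ^ k"
  have C1: "0 \<le> C1" using K by (simp add: C1_def Lp_const_nonneg)
  have m: "1 \<le> m" by (rule Lp_power_pos)
  define \<rho> where "\<rho> = 2 powr (- \<alpha> / real m)"
  have \<rho>: "0 < \<rho>" "\<rho> < 1" using \<alpha> m by (auto simp: \<rho>_def powr_less_one)
  have \<rho>m: "(\<rho> ^ i) ^ m = (2 powr - \<alpha>) ^ i" for i
  proof -
    have "\<rho> ^ m = 2 powr - \<alpha>" using m by (simp add: \<rho>_def powr_realpow[symmetric] powr_powr)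
    then show ?thesis by (metis mult.commute power_mult)
  qed
  define S where "S = 1 / (1 - \<rho>)"
  have S: "0 < S" using \<rho> by (simp add: S_def)
  define C where "C = Lp_const p 2 * (1 + Lp_const p S * C1)"
  have "0 < C"
  proof -
    have "0 \<le> Lp_const p S * C1" using S C1 by (simp add: Lp_const_nonneg)
    moreover have "1 \<le> Lp_const p 2" by (intro Lp_const_ge) simp
    ultimately show ?thesis by (simp add: C_def add_pos_nonneg)
  qed
  moreover have "Lp_norm p (\<lambda>x. F x - sampled_poly e N (grid_ratio e * N) k F (x + s) x) \<le> ennreal (C * (\<Theta> * real N powr - \<alpha>))"
    if smooth: "smooth_upto p k \<alpha> \<Theta> (pi / real (grid_ratio e * N)) F" and \<Theta>: "0 < \<Theta>" and N: "1 \<le> N" for F \<Theta> N s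
  proof -
    have F: "torus_fun F" "Lp_norm p F < \<infinity>" "p = \<infinity> \<longrightarrow> continuous_on UNIV F"
      and hyp: "\<And>\<delta>. 0 < \<delta> \<Longrightarrow> \<delta> \<le> pi / real (grid_ratio e * N) \<Longrightarrow> Lp_norm p (difference k \<delta> F) \<le> ennreal (\<Theta> * \<delta> powr \<alpha>)"
      using smooth by (auto simp: smooth_upto_def)
    \<comment> \<open>On the diagonal of offset \<open>s\<close>, the polynomial of level \<open>2\<^sup>i N\<close>.\<close>
    define a where "a i = (\<lambda>x. sampled_poly e (2 ^ i * N) (grid_ratio e * (2 ^ i * N)) k F (x + s) x)" for i
    define A where "A = \<Theta> * real N powr - \<alpha>"
    have A: "0 < A" using \<Theta> N by (simp add: A_def)
    have a: "torus_fun (a i)" for i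
      unfolding a_def sampled_poly_eq_grid_conv by (intro torus_fun_grid_conv[unfolded grid_conv_def[abs_def]] torus_fun_residual_sum F torus_fun_grid_conv)
    have diff: "Lp_norm p (difference k (pi / real (grid_ratio e * (2 ^ i * N))) F) \<le> ennreal (A * (2 powr - \<alpha>) ^ i)" for i
    proof -
      define \<delta> where "\<delta> = pi / real (grid_ratio e * (2 ^ i * N))"
      have pos: "0 < 2 ^ i * real N" "0 < real (grid_ratio e)" using N grid_ratio_ge[of e] by auto
      have \<delta>: "0 < \<delta>" using pos by (simp add: \<delta>_def)
      have "\<delta> \<le> pi / real (grid_ratio e * N)"
        unfolding \<delta>_def using pos N by (intro divide_left_mono) (auto intro!: mult_left_mono)
      from hyp[OF \<delta> this] have "Lp_norm p (difference k \<delta> F) \<le> ennreal (\<Theta> * \<delta> powr \<alpha>)" .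
      also have "\<Theta> * \<delta> powr \<alpha> \<le> A * (2 powr - \<alpha>) ^ i"
      proof -
        have "pi / real (grid_ratio e) \<le> 1" using pi_less_4 grid_ratio_ge[of e] by (simp add: divide_le_eq)
        then have "pi / real (grid_ratio e) / (2 ^ i * real N) \<le> 1 / (2 ^ i * real N)" using pos by (intro divide_right_mono) auto
        then have "\<delta> \<le> 1 / (2 ^ i * real N)" by (simp add: \<delta>_def)
        then have "\<delta> powr \<alpha> \<le> (1 / (2 ^ i * real N)) powr \<alpha>" using \<delta> \<alpha> by (intro powr_mono2) auto
        also have "\<dots> = (2 ^ i * real N) powr - \<alpha>" 
          using pos powr_divide[of 1 "2 ^ i * real N" \<alpha>] by (simp only: powr_minus powr_one_eq_one inverse_eq_divide) 
        also have "\<dots> = (2 powr - \<alpha>) ^ i * real N powr - \<alpha>" using N by (intro powr_dyadic) auto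
        finally show ?thesis using \<Theta> by (simp add: A_def mult_ac)
      qed
      finally show ?thesis unfolding \<delta>_def by (simp add: ennreal_leI)
    qed
    have step: "Lp_norm p (\<lambda>x. a (Suc i) x - a i x) \<le> ennreal (C1 * A * (\<rho> ^ i) ^ m)" for i
    proof -
      have eq: "2 ^ Suc i * N = 2 * (2 ^ i * N)" by simp
      have "Lp_norm p (\<lambda>x. a (Suc i) x - a i x) \<le> ennreal (2 * K * Lp_const p 2 * K ^ k * (A * (2 powr - \<alpha>) ^ i))"
        unfolding a_def eq
      proof (rule sampled_poly_refine_le)
        show "Lp_norm p (difference k (pi / real (grid_ratio e * (2 * (2 ^ i * N)))) F) \<le> ennreal (A * (2 powr - \<alpha>) ^ i)"
        proof -
          have "2 powr - \<alpha> < 1" using \<alpha> by (auto simp: powr_less_one)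
          then have "(2 powr - \<alpha>) ^ Suc i \<le> (2 powr - \<alpha>) ^ i" by (intro power_decreasing) auto
          then have "A * (2 powr - \<alpha>) ^ Suc i \<le> A * (2 powr - \<alpha>) ^ i" using A by (intro mult_left_mono) auto
          then show ?thesis using diff[of "Suc i"] unfolding eq by (meson ennreal_leI order_trans)
        qed
      qed (use F N A diff in auto)
      then show ?thesis by (simp add: C1_def \<rho>m mult_ac)
    qed
    \<comment> \<open>The remainder at a late level is at most \<open>A\<close>; the number of levels does not enter the constant.\<close>
    have "0 < A" by fact
    then obtain I where N0: "\<And>N s. I \<le> N \<Longrightarrow> 1 \<le> N \<Longrightarrow> Lp_norm p (\<lambda>x. F x - sampled_poly e N (grid_ratio e * N) k F (x + s) x) \<le> ennreal A"
      using sampled_poly_tendsto[OF F(1,2) _ k, of A] F(3) by blast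
    have "I * 1 \<le> 2 ^ I * N" using N by (intro mult_mono less_imp_le[OF less_exp]) auto
    then have last: "Lp_norm p (\<lambda>x. F x - a I x) \<le> ennreal A"
      unfolding a_def using N by (intro N0) (auto simp: mult.commute)
    have "Lp_norm p (\<lambda>x. \<Sum>i<I. a (Suc i) x - a i x) \<le> ennreal (Lp_const p S * (C1 * A))"
    proof (rule Lp_norm_sum[OF p_pos, where w = "\<lambda>i. \<rho> ^ i"])
      show "(\<Sum>i<I. \<rho> ^ i) \<le> S" unfolding S_def using \<rho> by (intro sum_power_le) auto
      show "0 < \<rho> ^ i \<and> \<rho> ^ i \<le> 1" for i using \<rho> by (auto intro: power_le_one)
    qed (use S C1 A a step in \<open>auto intro!: torus_fun_diff\<close>)
    moreover have "(\<lambda>x. \<Sum>i<I. a (Suc i) x - a i x) = (\<lambda>x. a I x - a 0 x)"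
      using sum_lessThan_telescope[of "\<lambda>i. a i x" I for x] by (intro ext)
    ultimately have "Lp_norm p (\<lambda>x. (F x - a I x) + (a I x - a 0 x)) \<le> ennreal (Lp_const p 2 * (A + Lp_const p S * (C1 * A)))"
      using last F a A C1 S by (intro Lp_norm_add p_pos torus_fun_diff) (auto simp: Lp_const_nonneg)
    also have "Lp_const p 2 * (A + Lp_const p S * (C1 * A)) = C * A" by (simp add: C_def algebra_simps)
    finally show ?thesis by (simp add: a_def A_def)
  qed
  ultimately show ?thesis by blast
qed

lemma jackson_trig_poly:
  assumes k: "1 \<le> k" and \<alpha>: "0 < \<alpha>"
  shows "\<exists>C>0. \<forall>F \<Theta> N. smooth_upto p k \<alpha> \<Theta> (pi / real (grid_ratio e * N)) F \<longrightarrow> 0 < \<Theta> \<longrightarrow> 1 \<le> N \<longrightarrow>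
    (\<exists>T\<in>trig_polys ((2 * e + 1) * N). Lp_norm p (\<lambda>x. F x - T x) \<le> ennreal (C * (\<Theta> * real N powr - \<alpha>)))"
proof -
  obtain C where C: "0 < C" and err: "\<And>F \<Theta> N s. smooth_upto p k \<alpha> \<Theta> (pi / real (grid_ratio e * N)) F \<Longrightarrow> 0 < \<Theta> \<Longrightarrow> 1 \<le> N \<Longrightarrow>
    Lp_norm p (\<lambda>x. F x - sampled_poly e N (grid_ratio e * N) k F (x + s) x) \<le> ennreal (C * (\<Theta> * real N powr - \<alpha>))"
    using sampled_poly_error_le[OF assms] by blast
  show ?thesis
  proof (intro exI[of _ C] conjI C allI impI)
    fix F :: "real \<Rightarrow> complex" and \<Theta> :: real and N :: nat
    assume smooth: "smooth_upto p k \<alpha> \<Theta> (pi / real (grid_ratio e * N)) F" and \<Theta>: "0 < \<Theta>" and N: "1 \<le> N"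
    have F: "torus_fun F" using smooth by (simp add: smooth_upto_def)
    obtain l where "Lp_norm p (\<lambda>x. F x - sampled_poly e N (grid_ratio e * N) k F l x) \<le> ennreal (C * (\<Theta> * real N powr - \<alpha>))"
    proof (rule Lp_norm_choose_parameter[OF p_pos, where G = "\<lambda>x l. F x - sampled_poly e N (grid_ratio e * N) k F l x"])
      show "case_prod (\<lambda>x l. F x - sampled_poly e N (grid_ratio e * N) k F l x) \<in> borel_measurable (borel \<Otimes>\<^sub>M borel)"
        using F N by (intro sampled_poly_measurable)
      show "F x - sampled_poly e N (grid_ratio e * N) k F (l + 2 * pi) x = F x - sampled_poly e N (grid_ratio e * N) k F l x" for x l
        using F N by (simp add: sampled_poly_periodic)
      show "0 \<le> C * (\<Theta> * real N powr - \<alpha>)" using C \<Theta> by simp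
      show "Lp_norm p (\<lambda>x. F x - sampled_poly e N (grid_ratio e * N) k F (x + s) x) \<le> ennreal (C * (\<Theta> * real N powr - \<alpha>))" for s
        by (rule err[OF smooth \<Theta> N])
    qed
    then show "\<exists>T\<in>trig_polys ((2 * e + 1) * N). Lp_norm p (\<lambda>x. F x - T x) \<le> ennreal (C * (\<Theta> * real N powr - \<alpha>))"
      using sampled_poly_trig_poly[OF N] by blast
  qed
qed

section \<open>Bernstein and Nikolskii--Stechkin inequalities\<close>

lemma K2_ge_1: "1 \<le> K2"
  by (rule Lp_const_ge) simp

lemma Lp_norm_trig_poly_finite:
  assumes "T \<in> trig_polys n"
  obtains b where "0 \<le> b" "Lp_norm p T = ennreal b"
proof -
  obtain a where a: "T = (\<lambda>x. \<Sum>\<nu>\<in>{- int n..int n}. a \<nu> * wave \<nu> x)" using assms by (auto simp: trig_polys_iff)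
  have "cmod (T x) \<le> (\<Sum>\<nu>\<in>{- int n..int n}. cmod (a \<nu>))" for x
    unfolding a by (rule order_trans[OF norm_sum]) (simp add: norm_mult)
  then have "Lp_norm p T \<le> ennreal (\<Sum>\<nu>\<in>{- int n..int n}. cmod (a \<nu>))" by (intro Lp_norm_bounded p_pos)
  then show ?thesis using that by (cases "Lp_norm p T") (auto simp: top_unique)
qed

lemma vp_kernel_increment_le:
  assumes n: "1 \<le> n" and h: "0 \<le> h" "h \<le> pi / real (grid_ratio e * n)" and j: "j \<in> grid (grid_ratio e * n)"
  shows "cmod ((vp_kernel e n (0 - node (grid_ratio e * n) j) - vp_kernel e n (h - node (grid_ratio e * n) j)) / of_nat (2 * (grid_ratio e * n)))
    \<le> A0 * real n * h / (1 + real_of_int \<bar>j\<bar>) ^ (2 * m)"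
proof -
  let ?H = "grid_ratio e * n"
  have m: "1 \<le> m" by (rule Lp_power_pos)
  have ok: "admissible e c n ?H" by (rule admissible_grid_ratio[OF n])
  have "cmod ((vp_kernel e n (0 - node ?H j) - vp_kernel e n (h - node ?H j)) / of_nat (2 * ?H))
      \<le> A0 * real n * \<bar>0 - h\<bar> / (1 + real_of_int \<bar>j\<bar>) ^ (e - 1)"
    using ok m h j by (intro vp_kernel_diff_bound) (auto simp: admissible_def)
  also have "\<dots> \<le> A0 * real n * \<bar>0 - h\<bar> / (1 + real_of_int \<bar>j\<bar>) ^ (2 * m)"
    using m h by (intro weaken_decay) auto
  finally show ?thesis using h by simp
qed

text \<open>
For steps up to one mesh width this is the representation of \<open>fdiff h T\<close> as a sum of translates. For larger steps
\<open>n h\<close> is bounded below, and the trivial bound suffices.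
\<close>

lemma bernstein_step:
  "\<exists>C\<ge>0. \<forall>n T h B. 1 \<le> n \<longrightarrow> T \<in> trig_polys n \<longrightarrow> 0 \<le> h \<longrightarrow> 0 \<le> B \<longrightarrow> Lp_norm p T \<le> ennreal B \<longrightarrow>
    Lp_norm p (fdiff h T) \<le> ennreal (C * (real n * h) * B)"
proof -
  define Ca where "Ca = Lp_const p 3 * A0"
  define Cb where "Cb = 2 * K2 * real (grid_ratio e)"
  have nonneg: "0 \<le> Ca" "0 \<le> Cb" using K2_ge_1 by (auto simp: Ca_def Cb_def Lp_const_nonneg)
  show ?thesis
  proof (intro exI[of _ "Ca + Cb"] conjI allI impI)
    fix n T h B
    assume n: "1 \<le> n" and T: "T \<in> trig_polys n" and h: "0 \<le> (h::real)" and B: "0 \<le> B" "Lp_norm p T \<le> ennreal B"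
    let ?H = "grid_ratio e * n"
    have ok: "admissible e c n ?H" by (rule admissible_grid_ratio[OF n])
    have T': "torus_fun T" by (rule trig_polys_torus_fun[OF T])
    show "Lp_norm p (fdiff h T) \<le> ennreal ((Ca + Cb) * (real n * h) * B)"
    proof (cases "h \<le> pi / real ?H")
      case True
      have "Lp_norm p (\<lambda>x. \<Sum>j\<in>grid ?H. (vp_kernel e n (0 - node ?H j) - vp_kernel e n (h - node ?H j)) / of_nat (2 * ?H) * T (x + node ?H j))
         \<le> ennreal (Lp_const p 3 * (A0 * real n * h * B))"
        using n h True by (intro Lp_norm_conv p_pos T' B vp_kernel_increment_le) auto
      then have "Lp_norm p (fdiff h T) \<le> ennreal (Ca * (real n * h) * B)"
        unfolding trig_polys_fdiff_eq[OF ok T, abs_def] by (simp add: Ca_def mult_ac)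
      also have "Ca * (real n * h) * B \<le> (Ca + Cb) * (real n * h) * B"
        using nonneg h B by (intro mult_right_mono) auto
      finally show ?thesis by (simp add: ennreal_leI)
    next
      case False
      have "Lp_norm p (difference 1 h T) \<le> ennreal ((2 * K2) ^ 1 * B)"
        by (intro Lp_norm_difference_le p_pos T' B)
      then have "Lp_norm p (fdiff h T) \<le> ennreal (2 * K2 * B)" by (simp add: difference_eq_funpow)
      also have "2 * K2 * B \<le> (Ca + Cb) * (real n * h) * B"
      proof -
        have "0 < real ?H" using ok by (auto simp: admissible_def)
        then have "pi < h * real ?H" using False by (simp add: pos_divide_less_eq not_le)
        then have "1 \<le> h * real ?H" using pi_gt3 by linarith
        then have "2 * K2 * B * 1 \<le> 2 * K2 * B * (h * real ?H)" using K2_ge_1 B by (intro mult_left_mono) auto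
        also have "\<dots> = Cb * (real n * h) * B" by (simp add: Cb_def mult_ac)
        also have "\<dots> \<le> (Ca + Cb) * (real n * h) * B"
          using nonneg h B by (intro mult_right_mono) auto
        finally show ?thesis by simp
      qed
      finally show ?thesis by (simp add: ennreal_leI)
    qed
  qed (use nonneg in auto)
qed

lemma bernstein:
  "\<exists>C\<ge>0. \<forall>n T h B r. 1 \<le> n \<longrightarrow> T \<in> trig_polys n \<longrightarrow> 0 \<le> h \<longrightarrow> 0 \<le> B \<longrightarrow> Lp_norm p T \<le> ennreal B \<longrightarrow>
    Lp_norm p (difference r h T) \<le> ennreal ((C * (real n * h)) ^ r * B)"
proof -
  obtain C where C: "0 \<le> C" and step: "\<And>n T h B. 1 \<le> n \<Longrightarrow> T \<in> trig_polys n \<Longrightarrow> 0 \<le> h \<Longrightarrow> 0 \<le> B \<Longrightarrow> Lp_norm p T \<le> ennreal B \<Longrightarrow>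
    Lp_norm p (fdiff h T) \<le> ennreal (C * (real n * h) * B)"
    using bernstein_step by blast
  show ?thesis
  proof (intro exI[of _ C] conjI C allI impI)
    fix n T h B r
    assume *: "1 \<le> n" "T \<in> trig_polys n" "0 \<le> (h::real)" "0 \<le> B" "Lp_norm p T \<le> ennreal B"
    show "Lp_norm p (difference r h T) \<le> ennreal ((C * (real n * h)) ^ r * B)"
    proof (induction r)
      case 0
      then show ?case using * by (simp add: difference_def)
    next
      case (Suc r)
      have "difference (Suc r) h T = fdiff h (difference r h T)" by (simp add: difference_eq_funpow)
      moreover have "Lp_norm p (fdiff h (difference r h T)) \<le> ennreal (C * (real n * h) * ((C * (real n * h)) ^ r * B))"
        using * C Suc by (intro step trig_polys_difference) auto
      ultimately show ?case by (simp add: mult_ac)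
    qed
  qed
qed

text \<open>
With \<open>V = \<Delta>\<^sub>h U\<close>, the difference of \<open>U\<close> with step \<open>l h\<close> is \<open>\<Sum>\<^sub>i\<^sub><\<^sub>l V(x + i h)\<close>, which differs from \<open>l V\<close> by \<open>W\<close>. By the
reproducing property \<open>W\<close> is at most half of \<open>l V\<close> in norm, up to the quasi-norm constant, if \<open>n l h\<close> is small.
\<close>

lemma nikolskii_step:
  "\<exists>c0>0. \<forall>n U h l \<beta>. 1 \<le> n \<longrightarrow> U \<in> trig_polys n \<longrightarrow> 0 < h \<longrightarrow> 1 \<le> l \<longrightarrow> real l * h \<le> c0 / real n \<longrightarrow> 0 \<le> \<beta> \<longrightarrow>
    Lp_norm p (fdiff (real l * h) U) \<le> ennreal \<beta> \<longrightarrow> Lp_norm p (fdiff h U) \<le> ennreal (2 * K2 / real l * \<beta>)"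
proof -
  define Ca where "Ca = K2 * (Lp_const p 3 * A0)"
  have A0: "0 \<le> A0" by simp
  have Ca: "0 \<le> Ca" using K2_ge_1 A0 by (simp add: Ca_def Lp_const_nonneg)
  define c0 where "c0 = min (pi / real (grid_ratio e)) (1 / (2 * (Ca + 1)))"
  have c0: "0 < c0" using Ca grid_ratio_ge[of e] by (simp add: c0_def)
  show ?thesis
  proof (intro exI[of _ c0] conjI c0 allI impI)
    fix n U h l \<beta>
    assume n: "1 \<le> n" and U: "U \<in> trig_polys n" and h: "0 < (h::real)" and l: "1 \<le> l" and lh: "real l * h \<le> c0 / real n"
      and \<beta>: "0 \<le> \<beta>" "Lp_norm p (fdiff (real l * h) U) \<le> ennreal \<beta>"
    let ?H = "grid_ratio e * n"
    have ok: "admissible e c n ?H" by (rule admissible_grid_ratio[OF n])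
    define V where "V = fdiff h U"
    have V: "V \<in> trig_polys n" unfolding V_def by (rule trig_polys_fdiff[OF U])
    obtain b where b: "0 \<le> b" "Lp_norm p V = ennreal b" using Lp_norm_trig_poly_finite[OF V] by blast
    define t where "t = real l * h"
    have t: "0 < t" using h l by (simp add: t_def)
    have nt: "real n * t \<le> c0" using lh n by (simp add: t_def pos_le_divide_eq mult.commute)
    have tH: "t \<le> pi / real ?H"
    proof -
      have "t * real n \<le> pi / real (grid_ratio e)" using nt by (simp add: c0_def mult.commute)
      moreover have "0 < real n" using n by simp
      ultimately have "t \<le> pi / real (grid_ratio e) / real n" by (simp only: pos_le_divide_eq)
      then show ?thesis by (simp only: of_nat_mult divide_divide_eq_left)
    qed
    define v where "v j = (\<Sum>i<l. (vp_kernel e n (0 - node ?H j) - vp_kernel e n (real i * h - node ?H j)) / of_nat (2 * ?H))" for j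
    define W where "W x = (\<Sum>j\<in>grid ?H. v j * V (x + node ?H j))" for x
    have W_eq: "W x = of_nat l * V x - fdiff t U x" for x
    proof -
      have "W x = (\<Sum>i<l. fdiff (real i * h) V x)"
        unfolding W_def v_def sum_distrib_right trig_polys_fdiff_eq[OF ok V] by (rule sum.swap)
      also have "\<dots> = of_nat l * V x - (\<Sum>i<l. V (x + real i * h))"
        by (simp add: fdiff_def sum_subtractf)
      also have "(\<Sum>i<l. V (x + real i * h)) = (\<Sum>i<l. U (x + real i * h) - U (x + real (Suc i) * h))"
        by (simp add: V_def fdiff_def algebra_simps)
      also have "\<dots> = fdiff t U x" by (subst sum_lessThan_telescope') (simp add: fdiff_def t_def)
      finally show ?thesis .
    qed
    have W: "Lp_norm p W \<le> ennreal (Lp_const p 3 * ((real l * (A0 * real n * t)) * b))"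
      unfolding W_def[abs_def]
    proof (intro Lp_norm_conv p_pos)
      fix j assume j: "j \<in> grid ?H"
      have "cmod (v j) \<le> (\<Sum>i<l. A0 * real n * t / (1 + real_of_int \<bar>j\<bar>) ^ (2 * m))"
        unfolding v_def
      proof (intro sum_norm_le)
        fix i assume i: "i \<in> {..<l}"
        have it: "0 \<le> real i * h" "real i * h \<le> t" using i h by (auto simp: t_def intro!: mult_right_mono)
        have "cmod ((vp_kernel e n (0 - node ?H j) - vp_kernel e n (real i * h - node ?H j)) / of_nat (2 * ?H)) \<le> A0 * real n * (real i * h) / (1 + real_of_int \<bar>j\<bar>) ^ (2 * m)"
          using it tH by (intro vp_kernel_increment_le n j) auto
        also have "\<dots> \<le> A0 * real n * t / (1 + real_of_int \<bar>j\<bar>) ^ (2 * m)"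
          using it A0 by (intro divide_right_mono mult_left_mono) auto
        finally show "cmod ((vp_kernel e n (0 - node ?H j) - vp_kernel e n (real i * h - node ?H j)) / of_nat (2 * ?H)) \<le> A0 * real n * t / (1 + real_of_int \<bar>j\<bar>) ^ (2 * m)" .
      qed
      then show "cmod (v j) \<le> real l * (A0 * real n * t) / (1 + real_of_int \<bar>j\<bar>) ^ (2 * m)" by simp
    qed (use b t A0 V trig_polys_torus_fun in auto)
    have tf: "torus_fun W" "torus_fun (fdiff t U)"
      unfolding W_def[abs_def] using trig_polys_torus_fun U V
      by (auto intro!: torus_fun_sum torus_fun_cmult torus_fun_shift torus_fun_fdiff)
    define R where "R = Lp_const p 3 * ((real l * (A0 * real n * t)) * b)"
    have R: "0 \<le> R" using b t A0 by (simp add: R_def Lp_const_nonneg)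
    have "Lp_norm p (\<lambda>x. W x + fdiff t U x) \<le> ennreal (K2 * (R + \<beta>))"
      using W \<beta> R by (intro Lp_norm_add p_pos tf) (auto simp: R_def t_def)
    then have "Lp_norm p (\<lambda>x. (1 / of_nat l) * (W x + fdiff t U x)) \<le> ennreal (1 / real l * (K2 * (R + \<beta>)))"
      using R \<beta> K2_ge_1 by (intro Lp_norm_cmult p_pos torus_fun_add tf) (auto simp: norm_divide)
    moreover have "V = (\<lambda>x. (1 / of_nat l) * (W x + fdiff t U x))" using l by (simp add: W_eq)
    ultimately have "ennreal b \<le> ennreal (1 / real l * (K2 * (R + \<beta>)))" using b by simp
    then have "b \<le> 1 / real l * (K2 * (R + \<beta>))"
      using R \<beta> K2_ge_1 l by (subst (asm) ennreal_le_iff) auto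
    also have "\<dots> = Ca * (real n * t) * b + K2 * \<beta> / real l"
      using l by (simp add: R_def Ca_def field_simps)
    also have "\<dots> \<le> b / 2 + K2 * \<beta> / real l"
    proof -
      have "Ca * (real n * t) \<le> (Ca + 1) * (1 / (2 * (Ca + 1)))"
        using Ca nt t by (intro mult_mono) (auto simp: c0_def)
      also have "\<dots> = 1 / 2" using Ca by simp
      finally have "Ca * (real n * t) * b \<le> 1 / 2 * b" using b by (intro mult_right_mono) auto
      then show ?thesis by simp
    qed
    finally have "b \<le> 2 * K2 / real l * \<beta>" by simp
    then show "Lp_norm p (fdiff h U) \<le> ennreal (2 * K2 / real l * \<beta>)"
      using b by (simp add: V_def ennreal_leI)
  qed
qed

lemma nikolskii_stechkin:
  "\<exists>c0>0. \<forall>n T h l B r. 1 \<le> n \<longrightarrow> T \<in> trig_polys n \<longrightarrow> 0 < h \<longrightarrow> 1 \<le> l \<longrightarrow> real l * h \<le> c0 / real n \<longrightarrow> 0 \<le> B \<longrightarrow>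
    Lp_norm p (difference r (real l * h) T) \<le> ennreal B \<longrightarrow> Lp_norm p (difference r h T) \<le> ennreal ((2 * K2 / real l) ^ r * B)"
proof -
  obtain c0 where c0: "0 < c0" and step: "\<And>n U h l \<beta>. 1 \<le> n \<Longrightarrow> U \<in> trig_polys n \<Longrightarrow> 0 < h \<Longrightarrow> 1 \<le> l \<Longrightarrow> real l * h \<le> c0 / real n \<Longrightarrow> 0 \<le> \<beta> \<Longrightarrow>
    Lp_norm p (fdiff (real l * h) U) \<le> ennreal \<beta> \<Longrightarrow> Lp_norm p (fdiff h U) \<le> ennreal (2 * K2 / real l * \<beta>)"
    using nikolskii_step by blast
  show ?thesis
  proof (intro exI[of _ c0] conjI c0 allI impI)
    fix n T h l B r
    assume *: "1 \<le> n" "0 < (h::real)" "1 \<le> l" "real l * h \<le> c0 / real n"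
      and T: "T \<in> trig_polys n" "0 \<le> B" "Lp_norm p (difference r (real l * h) T) \<le> ennreal B"
    from T show "Lp_norm p (difference r h T) \<le> ennreal ((2 * K2 / real l) ^ r * B)"
    proof (induction r arbitrary: T B)
      case 0
      then show ?case by (simp add: difference_def)
    next
      case (Suc r)
      have "difference (Suc r) (real l * h) T = fdiff (real l * h) (difference r (real l * h) T)" by (simp add: difference_eq_funpow)
      then have "Lp_norm p (fdiff h (difference r (real l * h) T)) \<le> ennreal (2 * K2 / real l * B)"
        using Suc.prems * by (intro step trig_polys_difference) auto
      moreover have "fdiff h (difference r (real l * h) T) = difference r (real l * h) (fdiff h T)"
        by (simp add: fdiff_def difference_diff difference_shift)
      ultimately have "Lp_norm p (difference r h (fdiff h T)) \<le> ennreal ((2 * K2 / real l) ^ r * (2 * K2 / real l * B))"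
        using Suc.prems K2_ge_1 by (intro Suc.IH trig_polys_fdiff) auto
      moreover have "difference r h (fdiff h T) = difference (Suc r) h T"
        by (simp add: difference_eq_funpow funpow_swap1)
      ultimately show ?case by (simp add: mult_ac)
    qed
  qed
qed

text \<open>
Subtracting the grid mean, as \<open>I - V\<close> with constant coefficients, is idempotent on polynomials
of degree at most \<open>q\<close>. Hence \<open>T\<close> minus its mean equals \<open>(I - V)\<^sup>k T\<close>.
\<close>

lemma trig_poly_near_constant:
  assumes k: "1 \<le> k" and q: "1 \<le> q"
  shows "\<exists>C\<ge>0. \<forall>T B. T \<in> trig_polys q \<longrightarrow> 0 \<le> B \<longrightarrow> Lp_norm p (difference k (pi / real (8 * q)) T) \<le> ennreal B \<longrightarrow>
    (\<exists>z. Lp_norm p (\<lambda>x. T x - z) \<le> ennreal (C * B))"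
proof -
  define H where "H = 8 * q"
  have H: "0 < H" "q < 2 * H" using q by (auto simp: H_def)
  define A where "A = (1 + real H) ^ e"
  define v :: "int \<Rightarrow> complex" where "v j = 1 / of_nat (2 * H)" for j
  define C where "C = (Lp_const p 3 * A) ^ k"
  have A: "0 \<le> A" by (simp add: A_def)
  show ?thesis
  proof (intro exI[of _ C] conjI allI impI)
    show "0 \<le> C" using A by (simp add: C_def Lp_const_nonneg)
    fix T B assume T: "T \<in> trig_polys q" and B: "0 \<le> B" "Lp_norm p (difference k (pi / real (8 * q)) T) \<le> ennreal B"
    obtain a where a: "T = (\<lambda>x. \<Sum>\<nu>\<in>{- int q..int q}. a \<nu> * wave \<nu> x)" using T by (auto simp: trig_polys_iff)
    have mean: "(\<Sum>j\<in>grid H. v j * T (x + of_int j * (pi / real H))) = a 0" for x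
    proof -
      have "(\<Sum>j\<in>grid H. v j * T (x + of_int j * (pi / real H))) = (\<Sum>\<nu>\<in>{- int q..int q}. a \<nu> * wave \<nu> x / of_nat (2 * H) * (\<Sum>j\<in>grid H. wave \<nu> (node H j)))"
        unfolding a v_def sum_distrib_left by (subst sum.swap) (simp add: wave_plus node_def mult_ac)
      also have "\<dots> = (\<Sum>\<nu>\<in>{- int q..int q}. if \<nu> = 0 then a 0 else 0)"
        using H by (intro sum.cong refl) (subst sum_wave_grid, auto)
      also have "\<dots> = a 0" by simp
      finally show ?thesis .
    qed
    have v1: "(\<Sum>j\<in>grid H. v j) = 1" using H by (simp add: v_def grid_def)
    have res1: "residual (grid H) v (pi / real H) T = (\<lambda>x. T x - a 0)"
      unfolding residual_def mean ..
    have "residual (grid H) v (pi / real H) (\<lambda>x. T x - a 0) = (\<lambda>x. T x - a 0)"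
      unfolding residual_def right_diff_distrib sum_subtractf mean sum_distrib_right[symmetric] v1 by simp
    then have "(residual (grid H) v (pi / real H) ^^ Suc i) T = (\<lambda>x. T x - a 0)" for i
      by (induction i) (simp_all add: res1)
    from this[of "k - 1"] have "(residual (grid H) v (pi / real H) ^^ k) T = (\<lambda>x. T x - a 0)" using k by simp
    moreover have "Lp_norm p ((residual (grid H) v (pi / real H) ^^ k) T) \<le> ennreal (C * B)"
      unfolding C_def
    proof (rule Lp_norm_residual_power_le[OF p_pos finite_grid trig_polys_torus_fun[OF T] v1 _ A B(1)])
      fix j assume "j \<in> grid H"
      then have "1 + real_of_int \<bar>j\<bar> \<le> 1 + real H" by (auto simp: grid_def)
      then have "(1 + real_of_int \<bar>j\<bar>) ^ e \<le> A" unfolding A_def by (intro power_mono) auto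
      moreover have "0 < (1 + real_of_int \<bar>j\<bar>) ^ e" by (intro zero_less_power) linarith
      ultimately have "1 \<le> A / (1 + real_of_int \<bar>j\<bar>) ^ e" by (simp only: pos_le_divide_eq mult_1)
      moreover have "cmod (v j) \<le> 1" using H by (simp add: v_def norm_divide)
      ultimately show "cmod (v j) \<le> A / (1 + real_of_int \<bar>j\<bar>) ^ e" by linarith
    qed (use B in \<open>simp add: H_def\<close>)
    ultimately show "\<exists>z. Lp_norm p (\<lambda>x. T x - z) \<le> ennreal (C * B)" by auto
  qed
qed

section \<open>Approximation in Holder norms\<close>

lemma jackson:
  assumes k: "1 \<le> k" and \<alpha>: "0 < \<alpha>"
  shows "\<exists>C>0. \<forall>F \<Theta> n. smooth_upto p k \<alpha> \<Theta> (1 / (2 * real n)) F \<longrightarrow> 0 < \<Theta> \<longrightarrow> 1 \<le> n \<longrightarrow>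
    (\<exists>T\<in>trig_polys n. Lp_norm p (\<lambda>x. F x - T x) \<le> ennreal (C * \<Theta> * real n powr - \<alpha>))"
proof -
  obtain C1 where C1: "0 < C1" and J: "\<And>F \<Theta> N. smooth_upto p k \<alpha> \<Theta> (pi / real (grid_ratio e * N)) F \<Longrightarrow> 0 < \<Theta> \<Longrightarrow> 1 \<le> N \<Longrightarrow>
    (\<exists>T\<in>trig_polys ((2 * e + 1) * N). Lp_norm p (\<lambda>x. F x - T x) \<le> ennreal (C1 * (\<Theta> * real N powr - \<alpha>)))"
    using jackson_trig_poly[OF assms] by blast
  define q where "q = 2 * e + 1"
  have q: "1 \<le> q" by (simp add: q_def)
  obtain C2 where C2: "0 \<le> C2" and const: "\<And>T B. T \<in> trig_polys q \<Longrightarrow> 0 \<le> B \<Longrightarrow> Lp_norm p (difference k (pi / real (8 * q)) T) \<le> ennreal B \<Longrightarrow>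
    (\<exists>z. Lp_norm p (\<lambda>x. T x - z) \<le> ennreal (C2 * B))"
    using trig_poly_near_constant[OF k q] by blast
  define C3 where "C3 = K2 * (C1 + C2 * (K2 * (1 + (2 * K2) ^ k * C1)))"
  have K2: "1 \<le> K2" by (rule K2_ge_1)
  have C3: "0 \<le> C3" using C1 C2 K2 by (simp add: C3_def)
  define C where "C = C1 * (2 * real q) powr \<alpha> + C3 * real q powr \<alpha>"
  have "0 < C" using C1 C3 q by (auto simp: C_def intro!: add_pos_nonneg)
  moreover have "\<exists>T\<in>trig_polys n. Lp_norm p (\<lambda>x. F x - T x) \<le> ennreal (C * \<Theta> * real n powr - \<alpha>)"
    if F: "smooth_upto p k \<alpha> \<Theta> (1 / (2 * real n)) F" and \<Theta>: "0 < \<Theta>" and n: "1 \<le> n" for F \<Theta> n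
  proof -
    have ratio: "grid_ratio e \<ge> 26 * q"
    proof -
      have "13 * q * 2 \<le> 13 * q * (2 * e + 2)" by (intro mult_left_mono) auto
      then show ?thesis by (simp add: grid_ratio_def q_def)
    qed
    have J': "\<exists>T\<in>trig_polys (q * N). Lp_norm p (\<lambda>x. F x - T x) \<le> ennreal (C1 * (\<Theta> * real N powr - \<alpha>))"
      if N: "1 \<le> N" "n \<le> 2 * q * N" for N
      unfolding q_def
    proof (rule J)
      have "pi / real (grid_ratio e * N) \<le> 1 / (2 * real n)"
      proof -
        have "n \<le> 2 * (q * N)" using N(2) by (simp only: mult.assoc)
        then have "2 * n * 4 \<le> 26 * (q * N)" by linarith
        then have "2 * n * 4 \<le> 26 * q * N" by (simp only: mult.assoc)
        also have "\<dots> \<le> grid_ratio e * N" using ratio by (intro mult_right_mono) auto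
        finally have "real (2 * n * 4) \<le> real (grid_ratio e * N)" by (simp only: of_nat_le_iff)
        moreover have "2 * real n * pi \<le> real (2 * n * 4)" using pi_less_4 n by simp
        ultimately have "2 * real n * pi \<le> real (grid_ratio e * N)" by linarith
        moreover have "0 < grid_ratio e * N" using N ratio q by auto
        ultimately show ?thesis using n by (simp add: field_simps)
      qed
      then show "smooth_upto p k \<alpha> \<Theta> (pi / real (grid_ratio e * N)) F" by (rule smooth_upto_mono[OF F])
    qed (use \<Theta> N in auto)
    show ?thesis
    proof (cases "q \<le> n")
      case True
      \<comment> \<open>The polynomial of level \<open>N\<close> has degree \<open>q N\<close>, whence the integer division.\<close>
      define N where "N = n div q"
      have "n < q * N + q" using dividend_less_times_div[of q n] q by (simp add: N_def)
      moreover have "1 \<le> N" "q * N \<le> n"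
        using True q by (auto simp: N_def div_greater_zero_iff Suc_le_eq)
      ultimately have N: "1 \<le> N" "q * N \<le> n" "n < q * N + q" by blast+
      have "q * 1 \<le> q * N" using N by (intro mult_left_mono) auto
      then have n2: "n \<le> 2 * q * N" using N by linarith
      obtain T where T: "T \<in> trig_polys (q * N)" "Lp_norm p (\<lambda>x. F x - T x) \<le> ennreal (C1 * (\<Theta> * real N powr - \<alpha>))"
        using J'[OF N(1) n2] by blast
      have "real N powr - \<alpha> \<le> (real n / (2 * real q)) powr - \<alpha>"
      proof (rule powr_mono2')
        have "real n \<le> real (2 * q * N)" using n2 by (simp only: of_nat_le_iff)
        then show "real n / (2 * real q) \<le> real N" using q by (simp add: divide_le_eq mult_ac)
      qed (use \<alpha> n q in auto)
      also have "\<dots> = (2 * real q) powr \<alpha> * real n powr - \<alpha>"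
        using q n by (simp add: powr_divide powr_minus field_simps)
      finally have "C1 * (\<Theta> * real N powr - \<alpha>) \<le> C1 * (\<Theta> * ((2 * real q) powr \<alpha> * real n powr - \<alpha>))"
        using C1 \<Theta> by (intro mult_left_mono) auto
      also have "\<dots> \<le> C * \<Theta> * real n powr - \<alpha>"
        using C3 \<Theta> by (simp add: C_def algebra_simps)
      finally show ?thesis using T trig_polys_mono[OF T(1) N(2)] by (meson ennreal_leI order_trans)
    next
      case False
      \<comment> \<open>Finitely many small degrees: a polynomial of degree \<open>q\<close> is replaced by a constant.\<close>
      obtain T where T: "T \<in> trig_polys q" "Lp_norm p (\<lambda>x. F x - T x) \<le> ennreal (C1 * \<Theta>)"
        using J'[of 1] False by auto
      have F': "torus_fun F" using F by (simp add: smooth_upto_def)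
      have T': "torus_fun T" by (rule trig_polys_torus_fun[OF T(1)])
      define t where "t = pi / real (8 * q)"
      have t: "0 < t" "t \<le> 1 / (2 * real n)" "t \<le> 1"
      proof -
        show "0 < t" using q by (simp add: t_def)
        have "real n * pi \<le> real q * 4" using False pi_less_4 by (intro mult_mono) auto
        then show "t \<le> 1 / (2 * real n)" using q n by (simp add: t_def field_simps)
        also have "1 / (2 * real n) \<le> 1" using n by simp
        finally show "t \<le> 1" .
      qed
      have "Lp_norm p (difference k t F) \<le> ennreal (\<Theta> * t powr \<alpha>)" using F t by (simp add: smooth_upto_def)
      also have "\<Theta> * t powr \<alpha> \<le> \<Theta>" using \<Theta> t \<alpha> powr_le1[of \<alpha> t] by (simp add: mult_left_le)
      finally have dF: "Lp_norm p (difference k t F) \<le> ennreal \<Theta>" by (simp add: ennreal_leI)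
      have dFT: "Lp_norm p (difference k t (\<lambda>x. F x - T x)) \<le> ennreal ((2 * K2) ^ k * (C1 * \<Theta>))"
        using T C1 \<Theta> F' T' by (intro Lp_norm_difference_le p_pos torus_fun_diff) auto
      have eq: "difference k t T = (\<lambda>x. difference k t F x - difference k t (\<lambda>x. F x - T x) x)"
        by (simp add: difference_diff)
      define B where "B = K2 * (\<Theta> + (2 * K2) ^ k * (C1 * \<Theta>))"
      have B: "0 \<le> B" using K2 \<Theta> C1 by (simp add: B_def)
      have "Lp_norm p (difference k t T) \<le> ennreal B"
        unfolding eq B_def using dF dFT \<Theta> C1 K2 F' T' 
        by (intro Lp_norm_diff p_pos torus_fun_difference torus_fun_diff) auto
      then obtain z where z: "Lp_norm p (\<lambda>x. T x - z) \<le> ennreal (C2 * B)"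
        using const[OF T(1) B] by (auto simp: t_def)
      have "Lp_norm p (\<lambda>x. (F x - T x) + (T x - z)) \<le> ennreal (K2 * (C1 * \<Theta> + C2 * B))"
        using T(2) z F' T' C1 C2 \<Theta> B trig_polys_torus_fun[OF trig_polys_const]
        by (intro Lp_norm_add p_pos torus_fun_diff) auto
      then have "Lp_norm p (\<lambda>x. F x - z) \<le> ennreal (K2 * (C1 * \<Theta> + C2 * B))" by simp
      also have "K2 * (C1 * \<Theta> + C2 * B) = C3 * \<Theta>" by (simp add: C3_def B_def algebra_simps)
      also have "C3 * \<Theta> \<le> C * \<Theta> * real n powr - \<alpha>"
      proof -
        have "real n powr \<alpha> \<le> real q powr \<alpha>" using False \<alpha> by (intro powr_mono2) auto
        then have "1 \<le> real q powr \<alpha> * real n powr - \<alpha>" using n by (simp add: powr_minus field_simps)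
        then have "C3 * \<Theta> * 1 \<le> C3 * \<Theta> * (real q powr \<alpha> * real n powr - \<alpha>)" using C3 \<Theta> by (intro mult_left_mono) auto
        also have "\<dots> \<le> C * \<Theta> * real n powr - \<alpha>" using C1 \<Theta> by (simp add: C_def algebra_simps)
        finally show ?thesis by simp
      qed
      finally show ?thesis using trig_polys_const[of z n] by (intro bexI[of _ "\<lambda>x. z"]) (auto simp: ennreal_leI)
    qed
  qed
  ultimately show ?thesis by blast
qed

text \<open>
For a step \<open>h < 1 / n\<close>, choose a level \<open>I\<close> with \<open>2\<^sup>I n\<close> comparable to \<open>1 / h\<close> and split \<open>F - T\<^sub>0\<close> into \<open>F - T\<^sub>I\<close> and the increments
\<open>T\<^sub>i\<^sub>+\<^sub>1 - T\<^sub>i\<close>. By Bernstein the \<open>i\<close>-th increment contributes \<open>h\<^sup>\<alpha> (2\<^sup>i n h)\<^sup>r\<^sup>-\<^sup>\<alpha>\<close>, up to constants.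
\<close>

lemma Holder_approx_below_order:
  assumes k: "1 \<le> k" and \<alpha>: "0 < \<alpha>" "\<alpha> < real r"
  shows "\<exists>C>0. \<forall>F \<Theta> n. smooth_upto p k \<alpha> \<Theta> (1 / (2 * real n)) F \<longrightarrow> 0 < \<Theta> \<longrightarrow> 1 \<le> n \<longrightarrow>
    (\<exists>T\<in>trig_polys n. Holder_norm p r \<alpha> (\<lambda>x. F x - T x) \<le> ennreal (C * \<Theta>))"
proof -
  obtain CJ where CJ: "0 < CJ" and J: "\<And>F \<Theta> n. smooth_upto p k \<alpha> \<Theta> (1 / (2 * real n)) F \<Longrightarrow> 0 < \<Theta> \<Longrightarrow> 1 \<le> n \<Longrightarrow>
    (\<exists>T\<in>trig_polys n. Lp_norm p (\<lambda>x. F x - T x) \<le> ennreal (CJ * \<Theta> * real n powr - \<alpha>))"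
    using jackson[OF k \<alpha>(1)] by blast
  obtain CB where CB: "0 \<le> CB" and bern: "\<And>n T h B. 1 \<le> n \<Longrightarrow> T \<in> trig_polys n \<Longrightarrow> 0 \<le> h \<Longrightarrow> 0 \<le> B \<Longrightarrow> Lp_norm p T \<le> ennreal B \<Longrightarrow>
    Lp_norm p (difference r h T) \<le> ennreal ((CB * (real n * h)) ^ r * B)"
    using bernstein by blast
  have K2: "1 \<le> K2" by (rule K2_ge_1)
  have m: "1 \<le> m" by (rule Lp_power_pos)
  define \<sigma> where "\<sigma> = 2 powr (- (real r - \<alpha>) / real m)"
  have "- (real r - \<alpha>) / real m < 0" using \<alpha> m by (intro divide_neg_pos) auto
  then have \<sigma>: "0 < \<sigma>" "\<sigma> < 1" unfolding \<sigma>_def by (auto intro!: powr_less_one)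
  have \<sigma>m: "\<sigma> ^ m = 2 powr - (real r - \<alpha>)" using m by (simp add: \<sigma>_def powr_realpow[symmetric] powr_powr)
  define S where "S = 1 / (1 - \<sigma>)"
  have S: "0 < S" using \<sigma> by (simp add: S_def)
  define D where "D = (2 * K2) ^ r * CJ"
  define E where "E = (2 * CB) ^ r * (2 * K2 * CJ)"
  define B0 where "B0 = K2 * (D * 2 powr \<alpha> + Lp_const p S * E)"
  have nonneg: "0 \<le> D" "0 \<le> E" "0 \<le> Lp_const p S" using K2 CJ CB S by (auto simp: D_def E_def Lp_const_nonneg)
  have B0: "0 \<le> B0" using nonneg K2 by (simp add: B0_def)
  show ?thesis
  proof (intro exI[of _ "CJ + (D + B0)"] conjI allI impI)
    show "0 < CJ + (D + B0)" using CJ nonneg B0 by simp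
    fix F \<Theta> n
    assume F: "smooth_upto p k \<alpha> \<Theta> (1 / (2 * real n)) F" and \<Theta>: "0 < (\<Theta>::real)" and n: "1 \<le> n"
    have F': "torus_fun F" using F by (simp add: smooth_upto_def)
    define N where "N i = 2 ^ i * n" for i
    have N: "1 \<le> N i" "n \<le> N i" for i
    proof -
      have "1 * n \<le> N i" unfolding N_def by (intro mult_right_mono) auto
      then show "1 \<le> N i" "n \<le> N i" using n by linarith+
    qed
    have "\<exists>T\<in>trig_polys (N i). Lp_norm p (\<lambda>x. F x - T x) \<le> ennreal (CJ * \<Theta> * real (N i) powr - \<alpha>)" for i
    proof (rule J[OF smooth_upto_mono[OF F] \<Theta> N(1)])
      show "1 / (2 * real (N i)) \<le> 1 / (2 * real n)" using N(2)[of i] n by (intro frac_le) auto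
    qed
    then obtain T where T: "\<And>i. T i \<in> trig_polys (N i)" 
      and err: "\<And>i. Lp_norm p (\<lambda>x. F x - T i x) \<le> ennreal (CJ * \<Theta> * real (N i) powr - \<alpha>)"
      by metis
    have T': "torus_fun (T i)" for i by (rule trig_polys_torus_fun[OF T])
    have dT: "Lp_norm p (difference r h (\<lambda>x. F x - T i x)) \<le> ennreal (D * \<Theta> * real (N i) powr - \<alpha>)" for i h
    proof -
      have "Lp_norm p (difference r h (\<lambda>x. F x - T i x)) \<le> ennreal ((2 * K2) ^ r * (CJ * \<Theta> * real (N i) powr - \<alpha>))"
        using CJ \<Theta> by (intro Lp_norm_difference_le p_pos torus_fun_diff F' T' err) auto
      then show ?thesis by (simp add: D_def mult_ac)
    qed
    have "Holder_norm p r \<alpha> (\<lambda>x. F x - T 0 x) \<le> ennreal (CJ * \<Theta> + (D + B0) * \<Theta>)"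
    proof (rule Holder_norm_le)
      have "real (N 0) powr - \<alpha> \<le> 1" using n \<alpha> by (simp add: N_def powr_minus inverse_le_1_iff ge_one_powr_ge_zero)
      then have "CJ * \<Theta> * real (N 0) powr - \<alpha> \<le> CJ * \<Theta>" using CJ \<Theta> by (simp add: mult_left_le)
      then show "Lp_norm p (\<lambda>x. F x - T 0 x) \<le> ennreal (CJ * \<Theta>)" using err[of 0] by (meson ennreal_leI order_trans)
      show "0 \<le> CJ * \<Theta>" "0 \<le> (D + B0) * \<Theta>" using CJ \<Theta> nonneg B0 by auto
      fix h :: real assume h: "0 < h"
      have nh: "0 < real n * h" using n h by simp
      show "Lp_norm p (difference r h (\<lambda>x. F x - T 0 x)) \<le> ennreal ((D + B0) * \<Theta> * h powr \<alpha>)"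
      proof (cases "1 \<le> real n * h")
        case True
        have "real n powr - \<alpha> = (1 / real n) powr \<alpha>" using n by (simp add: powr_divide powr_minus inverse_eq_divide)
        also have "\<dots> \<le> h powr \<alpha>" using True n \<alpha> by (intro powr_mono2) (auto simp: divide_le_eq mult.commute)
        finally have "D * \<Theta> * real (N 0) powr - \<alpha> \<le> D * \<Theta> * h powr \<alpha>"
          using nonneg \<Theta> by (intro mult_left_mono) (auto simp: N_def)
        also have "\<dots> \<le> (D + B0) * \<Theta> * h powr \<alpha>" using B0 \<Theta> by (intro mult_right_mono) auto
        finally show ?thesis using dT[of h 0] by (meson ennreal_leI order_trans)
      next
        case False
        then have "1 \<le> 1 / (real n * h)" using nh by simp
        then obtain I where I: "2 ^ I \<le> 1 / (real n * h)" "1 / (real n * h) < 2 ^ Suc I"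
          using ex_dyadic by blast
        have NI: "real (N I) * h \<le> 1" "1 < 2 * (real (N I) * h)"
          using I nh by (simp_all add: N_def field_simps)
        have "real (N I) powr - \<alpha> = (1 / real (N I)) powr \<alpha>" using N[of I] by (simp add: powr_divide powr_minus inverse_eq_divide)
        also have "\<dots> \<le> (2 * h) powr \<alpha>" using NI N[of I] h \<alpha> by (intro powr_mono2) (auto simp: divide_le_eq mult_ac)
        also have "\<dots> = 2 powr \<alpha> * h powr \<alpha>" using h by (simp add: powr_mult)
        finally have "D * \<Theta> * real (N I) powr - \<alpha> \<le> D * \<Theta> * (2 powr \<alpha> * h powr \<alpha>)"
          using nonneg \<Theta> by (intro mult_left_mono) auto
        then have first: "Lp_norm p (difference r h (\<lambda>x. F x - T I x)) \<le> ennreal (D * \<Theta> * (2 powr \<alpha> * h powr \<alpha>))"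
          using dT[of h I] by (meson ennreal_leI order_trans)
        have step: "Lp_norm p (difference r h (\<lambda>x. T (Suc i) x - T i x)) \<le> ennreal (E * \<Theta> * h powr \<alpha> * (\<sigma> ^ (I - Suc i)) ^ m)"
          if i: "i < I" for i
        proof -
          define u where "u = real (N i) * h"
          have u: "0 < u" using N[of i] h by (simp add: u_def)
          have "Lp_norm p (\<lambda>x. (F x - T i x) - (F x - T (Suc i) x)) \<le> ennreal (K2 * (CJ * \<Theta> * real (N i) powr - \<alpha> + CJ * \<Theta> * real (N i) powr - \<alpha>))"
          proof (intro Lp_norm_diff p_pos torus_fun_diff F' T' err)
            have "real (N (Suc i)) powr - \<alpha> \<le> real (N i) powr - \<alpha>"
              using N[of i] \<alpha> by (intro powr_mono2') (auto simp: N_def)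
            then have "CJ * \<Theta> * real (N (Suc i)) powr - \<alpha> \<le> CJ * \<Theta> * real (N i) powr - \<alpha>"
              using CJ \<Theta> by (intro mult_left_mono) auto
            then show "Lp_norm p (\<lambda>x. F x - T (Suc i) x) \<le> ennreal (CJ * \<Theta> * real (N i) powr - \<alpha>)"
              using err[of "Suc i"] by (meson ennreal_leI order_trans)
          qed (use CJ \<Theta> in auto)
          then have small: "Lp_norm p (\<lambda>x. T (Suc i) x - T i x) \<le> ennreal (2 * K2 * CJ * \<Theta> * real (N i) powr - \<alpha>)"
            by (simp add: mult_ac)
          have "T i \<in> trig_polys (N (Suc i))" by (rule trig_polys_mono[OF T]) (simp add: N_def)
          then have "Lp_norm p (difference r h (\<lambda>x. T (Suc i) x - T i x)) \<le> ennreal ((CB * (real (N (Suc i)) * h)) ^ r * (2 * K2 * CJ * \<Theta> * real (N i) powr - \<alpha>))"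
            using h K2 CJ \<Theta> N by (intro bern trig_polys_diff T small) auto
          also have "(CB * (real (N (Suc i)) * h)) ^ r * (2 * K2 * CJ * \<Theta> * real (N i) powr - \<alpha>) = E * \<Theta> * h powr \<alpha> * u powr (real r - \<alpha>)"
          proof -
            have "real (N i) powr - \<alpha> = u powr - \<alpha> * h powr \<alpha>"
              using h N[of i] by (simp add: u_def powr_mult powr_minus)
            moreover have "(CB * (real (N (Suc i)) * h)) ^ r = (2 * CB) ^ r * u powr real r"
              using u by (simp add: u_def N_def powr_realpow power_mult_distrib mult_ac)
            moreover have "u powr (real r - \<alpha>) = u powr real r * u powr - \<alpha>" by (simp flip: powr_add)
            ultimately show ?thesis by (simp add: E_def mult_ac)
          qed
          also have "E * \<Theta> * h powr \<alpha> * u powr (real r - \<alpha>) \<le> E * \<Theta> * h powr \<alpha> * (\<sigma> ^ (I - Suc i)) ^ m"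
          proof (intro mult_left_mono)
            have "2 ^ (I - i) * 2 ^ i = (2 ^ I :: real)" using i by (simp flip: power_add)
            then have "2 ^ (I - i) * u = real (N I) * h" by (simp add: u_def N_def mult_ac)
            then have "2 ^ (I - i) * u \<le> 1" using NI by simp
            moreover have "(2::real) ^ (I - Suc i) * u \<le> 2 ^ (I - i) * u"
              using u by (intro mult_right_mono power_increasing) auto
            ultimately have "2 ^ (I - Suc i) * u \<le> 1" by linarith
            then have "(2 ^ (I - Suc i) * u) powr (real r - \<alpha>) \<le> 1" using u \<alpha> by (intro powr_le1) auto
            then have le1: "(2 powr (real r - \<alpha>)) ^ (I - Suc i) * u powr (real r - \<alpha>) \<le> 1"
              using powr_dyadic[OF u, of "I - Suc i" "real r - \<alpha>"] by simp
            have "(\<sigma> ^ (I - Suc i)) ^ m = (\<sigma> ^ m) ^ (I - Suc i)" by (metis mult.commute power_mult)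
            also have "\<dots> = inverse ((2 powr (real r - \<alpha>)) ^ (I - Suc i))"
              unfolding \<sigma>m powr_minus power_inverse ..
            finally show "u powr (real r - \<alpha>) \<le> (\<sigma> ^ (I - Suc i)) ^ m"
              using le1 by (simp add: inverse_eq_divide pos_le_divide_eq mult.commute)
          qed (use nonneg \<Theta> in auto)
          finally show ?thesis by (simp add: ennreal_leI)
        qed
        have "Lp_norm p (\<lambda>x. \<Sum>i<I. difference r h (\<lambda>x. T (Suc i) x - T i x) x) \<le> ennreal (Lp_const p S * (E * \<Theta> * h powr \<alpha>))"
        proof (rule Lp_norm_sum[OF p_pos, where w = "\<lambda>i. \<sigma> ^ (I - Suc i)"])
          have "(\<Sum>i<I. \<sigma> ^ (I - Suc i)) = (\<Sum>i<I. \<sigma> ^ i)" by (rule sum.nat_diff_reindex)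
          also have "\<dots> \<le> S" unfolding S_def using \<sigma> by (intro sum_power_le) auto
          finally show "(\<Sum>i<I. \<sigma> ^ (I - Suc i)) \<le> S" .
          show "0 < \<sigma> ^ (I - Suc i) \<and> \<sigma> ^ (I - Suc i) \<le> 1" for i using \<sigma> by (auto intro: power_le_one)
        qed (use S nonneg \<Theta> step T' in \<open>auto intro!: torus_fun_difference torus_fun_diff\<close>)
        moreover have "(\<lambda>x. \<Sum>i<I. difference r h (\<lambda>x. T (Suc i) x - T i x) x) = (\<lambda>x. difference r h (T I) x - difference r h (T 0) x)"
          unfolding difference_diff using sum_lessThan_telescope[of "\<lambda>i. difference r h (T i) x" I for x] by (intro ext)
        ultimately have "Lp_norm p (\<lambda>x. difference r h (\<lambda>x. F x - T I x) x + (difference r h (T I) x - difference r h (T 0) x))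
            \<le> ennreal (K2 * (D * \<Theta> * (2 powr \<alpha> * h powr \<alpha>) + Lp_const p S * (E * \<Theta> * h powr \<alpha>)))"
          using first nonneg \<Theta> by (intro Lp_norm_add p_pos torus_fun_difference torus_fun_diff F' T') auto
        also have "(\<lambda>x. difference r h (\<lambda>x. F x - T I x) x + (difference r h (T I) x - difference r h (T 0) x)) = difference r h (\<lambda>x. F x - T 0 x)"
          by (simp add: difference_diff)
        also have "K2 * (D * \<Theta> * (2 powr \<alpha> * h powr \<alpha>) + Lp_const p S * (E * \<Theta> * h powr \<alpha>)) = B0 * \<Theta> * h powr \<alpha>"
          by (simp add: B0_def algebra_simps)
        also have "\<dots> \<le> (D + B0) * \<Theta> * h powr \<alpha>" using nonneg \<Theta> by (intro mult_right_mono) auto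
        finally show ?thesis by (simp add: ennreal_leI)
      qed
    qed
    then have "Holder_norm p r \<alpha> (\<lambda>x. F x - T 0 x) \<le> ennreal ((CJ + (D + B0)) * \<Theta>)" by (simp add: distrib_right)
    moreover have "T 0 \<in> trig_polys n" using T[of 0] by (simp add: N_def)
    ultimately show "\<exists>T\<in>trig_polys n. Holder_norm p r \<alpha> (\<lambda>x. F x - T x) \<le> ennreal ((CJ + (D + B0)) * \<Theta>)" by blast
  qed
qed

text \<open>
For \<open>\<alpha> = r\<close> the increments in the dyadic sum would only be bounded by a logarithmic number of equal terms. Instead, the differences of \<open>T\<close> with step \<open>h\<close> are compared with
those of step \<open>l h\<close> comparable to \<open>1 / n\<close>.
\<close>

lemma Holder_approx_at_order:
  assumes r: "1 \<le> r"
  shows "\<exists>C>0. \<forall>F \<Theta> n. smooth_upto p r (real r) \<Theta> (1 / (2 * real n)) F \<longrightarrow> 0 < \<Theta> \<longrightarrow> 1 \<le> n \<longrightarrow>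
    (\<exists>T\<in>trig_polys n. Holder_norm p r (real r) (\<lambda>x. F x - T x) \<le> ennreal (C * \<Theta>))"
proof -
  obtain CJ where CJ: "0 < CJ" and J: "\<And>F \<Theta> n. smooth_upto p r (real r) \<Theta> (1 / (2 * real n)) F \<Longrightarrow> 0 < \<Theta> \<Longrightarrow> 1 \<le> n \<Longrightarrow>
    (\<exists>T\<in>trig_polys n. Lp_norm p (\<lambda>x. F x - T x) \<le> ennreal (CJ * \<Theta> * real n powr - real r))"
    using jackson[OF r, of "real r"] r by auto
  obtain c1 where c1: "0 < c1" and nik: "\<And>n T h l B. 1 \<le> n \<Longrightarrow> T \<in> trig_polys n \<Longrightarrow> 0 < h \<Longrightarrow> 1 \<le> l \<Longrightarrow> real l * h \<le> c1 / real n \<Longrightarrow> 0 \<le> B \<Longrightarrow>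
    Lp_norm p (difference r (real l * h) T) \<le> ennreal B \<Longrightarrow> Lp_norm p (difference r h T) \<le> ennreal ((2 * K2 / real l) ^ r * B)"
    using nikolskii_stechkin by blast
  \<comment> \<open>The bound \<open>1 / 2\<close> keeps the steps \<open>l h\<close> within the range \<open>1 / (2 n)\<close> of the hypothesis on \<open>F\<close>.\<close>
  define c0 where "c0 = min c1 (1 / 2)"
  have c0: "0 < c0" "c0 \<le> c1" "c0 \<le> 1 / 2" using c1 by (auto simp: c0_def)
  have K2: "1 \<le> K2" by (rule K2_ge_1)
  define D where "D = (2 * K2) ^ r * CJ"
  define E where "E = (4 * K2 / c0) ^ r * (K2 * (1 + D))"
  define B1 where "B1 = D * (2 / c0) ^ r"
  define B2 where "B2 = K2 * (1 + E)"
  have nonneg: "0 \<le> D" "0 \<le> E" "0 \<le> B1" "0 \<le> B2" using K2 CJ c0 by (auto simp: D_def E_def B1_def B2_def)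
  show ?thesis
  proof (intro exI[of _ "CJ + (B1 + B2)"] conjI allI impI)
    show "0 < CJ + (B1 + B2)" using CJ nonneg by simp
    fix F \<Theta> n
    assume F: "smooth_upto p r (real r) \<Theta> (1 / (2 * real n)) F" and \<Theta>: "0 < (\<Theta>::real)" and n: "1 \<le> n"
    have F': "torus_fun F" using F by (simp add: smooth_upto_def)
    have n0: "0 < real n" using n by simp
    obtain T where T: "T \<in> trig_polys n" and err': "Lp_norm p (\<lambda>x. F x - T x) \<le> ennreal (CJ * \<Theta> * real n powr - real r)"
      using J[OF F \<Theta> n] by blast
    have npow: "real n powr - real r = (1 / real n) ^ r"
      using n0 by (simp add: powr_minus powr_realpow power_divide inverse_eq_divide)
    have err: "Lp_norm p (\<lambda>x. F x - T x) \<le> ennreal (CJ * \<Theta> * (1 / real n) ^ r)" using err' by (simp only: npow)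
    have T': "torus_fun T" by (rule trig_polys_torus_fun[OF T])
    have dFT: "Lp_norm p (difference r h (\<lambda>x. F x - T x)) \<le> ennreal (D * \<Theta> * (1 / real n) ^ r)" for h
    proof -
      have "Lp_norm p (difference r h (\<lambda>x. F x - T x)) \<le> ennreal ((2 * K2) ^ r * (CJ * \<Theta> * (1 / real n) ^ r))"
        using CJ \<Theta> by (intro Lp_norm_difference_le p_pos torus_fun_diff F' T' err) auto
      then show ?thesis by (simp add: D_def mult_ac)
    qed
    have "Holder_norm p r (real r) (\<lambda>x. F x - T x) \<le> ennreal (CJ * \<Theta> + (B1 + B2) * \<Theta>)"
    proof (rule Holder_norm_le)
      have "(1 / real n) ^ r \<le> 1" using n by (intro power_le_one) auto
      then have "CJ * \<Theta> * (1 / real n) ^ r \<le> CJ * \<Theta>" using CJ \<Theta> by (simp add: mult_left_le del: power_one_over)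
      then show "Lp_norm p (\<lambda>x. F x - T x) \<le> ennreal (CJ * \<Theta>)" using err by (meson ennreal_leI order_trans)
      show "0 \<le> CJ * \<Theta>" "0 \<le> (B1 + B2) * \<Theta>" using CJ \<Theta> nonneg by auto
      fix h :: real assume h: "0 < h"
      have hpow: "h powr real r = h ^ r" using h by (rule powr_realpow)
      show "Lp_norm p (difference r h (\<lambda>x. F x - T x)) \<le> ennreal ((B1 + B2) * \<Theta> * h powr real r)"
      proof (cases "h \<le> c0 / (2 * real n)")
        case False
        have "1 / real n \<le> 2 / c0 * h" using False n0 c0 by (simp add: field_simps)
        then have "(1 / real n) ^ r \<le> (2 / c0 * h) ^ r" by (intro power_mono) auto
        then have "D * \<Theta> * (1 / real n) ^ r \<le> D * \<Theta> * (2 / c0 * h) ^ r" using nonneg \<Theta> by (intro mult_left_mono) auto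
        also have "\<dots> = B1 * \<Theta> * h ^ r" by (simp only: B1_def power_mult_distrib mult_ac)
        also have "\<dots> \<le> (B1 + B2) * \<Theta> * h ^ r" using nonneg \<Theta> h by (intro mult_right_mono) auto
        finally show ?thesis unfolding hpow using dFT[of h] by (meson ennreal_leI order_trans)
      next
        case True
        \<comment> \<open>The largest multiple \<open>l h\<close> not exceeding \<open>c0 / n\<close>; it is at least half of this.\<close>
        define y where "y = c0 / (real n * h)"
        define l where "l = nat \<lfloor>y\<rfloor>"
        have y: "2 \<le> y" using True n0 h by (simp add: y_def field_simps)
        then have l: "1 \<le> l" "real l \<le> y" "y / 2 \<le> real l" unfolding l_def by linarith+
        have yh: "y * h = c0 / real n" using h by (simp add: y_def)
        define t where "t = real l * h"
        have "t \<le> y * h" "y / 2 * h \<le> t" unfolding t_def using l h by (auto intro!: mult_right_mono)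
        then have t: "t \<le> c0 / real n" "c0 / real n / 2 \<le> t" using yh by auto
        have t0: "0 < t" using l h by (simp add: t_def)
        have tn: "t \<le> 1 / (2 * real n)"
        proof -
          have "c0 / real n \<le> 1 / 2 / real n" using c0 n0 by (intro divide_right_mono) auto
          then show ?thesis using t by simp
        qed
        have tc1: "t \<le> c1 / real n"
        proof -
          have "c0 / real n \<le> c1 / real n" using c0 n0 by (intro divide_right_mono) auto
          then show ?thesis using t by simp
        qed
        have "Lp_norm p (difference r t F) \<le> ennreal (\<Theta> * t powr real r)" using F t0 tn by (simp add: smooth_upto_def)
        also have "\<Theta> * t powr real r \<le> \<Theta> * (1 / real n) ^ r"
        proof -
          have "t \<le> 1 / real n" using tn n0 by (simp add: field_simps)
          then have "t ^ r \<le> (1 / real n) ^ r" using t0 by (intro power_mono) auto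
          then show ?thesis using \<Theta> t0 by (simp only: powr_realpow mult_left_mono less_imp_le)
        qed
        finally have dF: "Lp_norm p (difference r t F) \<le> ennreal (\<Theta> * (1 / real n) ^ r)" by (simp add: ennreal_leI)
        define Q where "Q = K2 * (\<Theta> * (1 / real n) ^ r + D * \<Theta> * (1 / real n) ^ r)"
        have Q: "0 \<le> Q" using K2 \<Theta> nonneg by (simp add: Q_def)
        have eq: "difference r t T = (\<lambda>x. difference r t F x - difference r t (\<lambda>x. F x - T x) x)"
          by (simp add: difference_diff)
        have "Lp_norm p (difference r t T) \<le> ennreal Q"
          unfolding eq Q_def using dF dFT[of t] \<Theta> nonneg
          by (intro Lp_norm_diff p_pos torus_fun_difference torus_fun_diff F' T') auto
        then have "Lp_norm p (difference r h T) \<le> ennreal ((2 * K2 / real l) ^ r * Q)"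
          using l tc1 unfolding t_def by (intro nik[OF n T h] Q) auto
        also have "(2 * K2 / real l) ^ r * Q \<le> E * \<Theta> * h ^ r"
        proof -
          have "1 / real l \<le> 2 * real n * h / c0"
          proof -
            have "c0 / real n / 2 \<le> real l * h" using t(2) by (simp add: t_def)
            then show ?thesis using l c0 n0 by (simp add: field_simps)
          qed
          then have "2 * K2 * (1 / real l) \<le> 2 * K2 * (2 * real n * h / c0)" using K2 by (intro mult_left_mono) auto
          then have "(2 * K2 / real l) ^ r \<le> (4 * K2 / c0 * h * real n) ^ r" using K2 by (intro power_mono) (auto simp: mult_ac)
          then have "(2 * K2 / real l) ^ r * Q \<le> (4 * K2 / c0 * h * real n) ^ r * Q" using Q by (intro mult_right_mono)
          also have "\<dots> = (4 * K2 / c0) ^ r * h ^ r * (K2 * (1 + D) * \<Theta>) * (real n ^ r * (1 / real n) ^ r)"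
            unfolding power_mult_distrib Q_def by (simp add: algebra_simps)
          also have "real n ^ r * (1 / real n) ^ r = 1" using n0 by (simp add: power_mult_distrib[symmetric])
          finally show ?thesis by (simp add: E_def mult_ac)
        qed
        finally have dT: "Lp_norm p (difference r h T) \<le> ennreal (E * \<Theta> * h ^ r)" by (simp add: ennreal_leI)
        have "h \<le> 1 / (2 * real n)"
        proof -
          have "c0 / (2 * real n) \<le> 1 / (2 * real n)" using c0 n0 by (intro divide_right_mono) auto
          then show ?thesis using True by simp
        qed
        then have "Lp_norm p (difference r h F) \<le> ennreal (\<Theta> * h ^ r)"
          using F h by (simp add: smooth_upto_def hpow[symmetric])
        then have "Lp_norm p (\<lambda>x. difference r h F x - difference r h T x) \<le> ennreal (K2 * (\<Theta> * h ^ r + E * \<Theta> * h ^ r))"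
          using dT \<Theta> nonneg h by (intro Lp_norm_diff p_pos torus_fun_difference F' T') auto
        also have "K2 * (\<Theta> * h ^ r + E * \<Theta> * h ^ r) = B2 * \<Theta> * h ^ r" by (simp add: B2_def algebra_simps)
        also have "\<dots> \<le> (B1 + B2) * \<Theta> * h ^ r" using nonneg \<Theta> h by (intro mult_right_mono) auto
        finally show ?thesis by (simp add: difference_diff hpow ennreal_leI)
      qed
    qed
    then have "Holder_norm p r (real r) (\<lambda>x. F x - T x) \<le> ennreal ((CJ + (B1 + B2)) * \<Theta>)" by (simp add: distrib_right)
    then show "\<exists>T\<in>trig_polys n. Holder_norm p r (real r) (\<lambda>x. F x - T x) \<le> ennreal ((CJ + (B1 + B2)) * \<Theta>)"
      using T by blast
  qed
qed

end

lemma Holder_space_representative: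
  assumes "f \<in> Holder_space p r \<alpha>"
  obtains F where "torus_fun F" "Lp_norm p F < \<infinity>" "p = \<infinity> \<longrightarrow> continuous_on UNIV F"
    "\<And>k \<delta> T. Lp_norm p (difference k \<delta> (\<lambda>x. f x - T x)) = Lp_norm p (difference k \<delta> (\<lambda>x. F x - T x))"
proof -
  have f: "\<And>x. f (x + 2 * pi) = f x" "p = \<infinity> \<Longrightarrow> continuous_on UNIV f" "p \<noteq> \<infinity> \<Longrightarrow> f \<in> borel_measurable lebesgue" "Lp_norm p f < \<infinity>"
    using assms by (auto simp: Holder_space_def Lp_space_def Holder_norm_def split: if_splits)
  show ?thesis
  proof (cases "p = \<infinity>")
    case True
    then have "torus_fun f" using f by (simp add: torus_fun_def borel_measurable_continuous_onI)
    then show ?thesis using f True by (intro that[of f]) auto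
  next
    case False
    obtain F where F: "torus_fun F" "AE x in lborel. f x = F x"
      using torus_fun_representative[OF f(3)[OF False] f(1)] by blast
    have eq: "Lp_norm p (difference k \<delta> (\<lambda>x. f x - T x)) = Lp_norm p (difference k \<delta> (\<lambda>x. F x - T x))" for k \<delta> T
      using F(2) by (intro Lp_norm_difference_cong_AE False) (auto elim!: eventually_mono)
    have "Lp_norm p F = Lp_norm p f" using eq[of 0 0 "\<lambda>x. 0"] by simp
    then show ?thesis using F f(4) False eq by (intro that[of F]) auto
  qed
qed

theorem theorem3p1:
  fixes p :: ennreal and r k :: nat and \<alpha> :: real
  assumes "0 < p" and "1 \<le> r" and "1 \<le> k"
    and "(0 < \<alpha> \<and> \<alpha> < real (min r k)) \<or> (0 < \<alpha> \<and> \<alpha> = real k \<and> k = r)"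
  shows "\<exists>C::real. 0 < C \<and>
           (\<forall>f\<in>Holder_space p r \<alpha>. \<forall>n::nat. 1 \<le> n \<longrightarrow>
              best_approx n f p r \<alpha> \<le> ennreal C * theta k \<alpha> f (1 / real n) p)"
proof -
  have \<alpha>: "0 < \<alpha>" using assms(4) by auto
  have "\<exists>C>0. \<forall>F \<Theta> n. smooth_upto p k \<alpha> \<Theta> (1 / (2 * real n)) F \<longrightarrow> 0 < \<Theta> \<longrightarrow> 1 \<le> n \<longrightarrow>
    (\<exists>T\<in>trig_polys n. Holder_norm p r \<alpha> (\<lambda>x. F x - T x) \<le> ennreal (C * \<Theta>))"
  proof (cases "\<alpha> < real r")
    case True
    then show ?thesis using Holder_approx_below_order[OF assms(1,3) \<alpha>] by blast
  next
    case False
    then have "\<alpha> = real r" "k = r" using assms(4) by auto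
    then show ?thesis using Holder_approx_at_order[OF assms(1,2)] by blast
  qed
  then obtain C where C: "0 < C" and core: "\<And>F \<Theta> n. smooth_upto p k \<alpha> \<Theta> (1 / (2 * real n)) F \<Longrightarrow> 0 < \<Theta> \<Longrightarrow> 1 \<le> n \<Longrightarrow>
    (\<exists>T\<in>trig_polys n. Holder_norm p r \<alpha> (\<lambda>x. F x - T x) \<le> ennreal (C * \<Theta>))"
    by blast
  define C' where "C' = C * 2 powr \<alpha>"
  have C': "0 < C'" using C by (simp add: C'_def)
  show ?thesis
  proof (intro exI[of _ C'] conjI C' ballI allI impI)
    fix f n assume f: "f \<in> Holder_space p r \<alpha>" and n: "1 \<le> (n::nat)"
    obtain F where F: "torus_fun F" "Lp_norm p F < \<infinity>" "p = \<infinity> \<longrightarrow> continuous_on UNIV F"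
      and eq: "\<And>k \<delta> T. Lp_norm p (difference k \<delta> (\<lambda>x. f x - T x)) = Lp_norm p (difference k \<delta> (\<lambda>x. F x - T x))"
      using Holder_space_representative[OF f] by blast
    have eq0: "Lp_norm p (\<lambda>x. f x - T x) = Lp_norm p (\<lambda>x. F x - T x)" for T
      using eq[of 0 0 T] by simp
    have Holder_eq: "Holder_norm p r \<alpha> (\<lambda>x. f x - T x) = Holder_norm p r \<alpha> (\<lambda>x. F x - T x)" for T
      by (simp add: Holder_norm_def Holder_seminorm_def eq eq0)
    show "best_approx n f p r \<alpha> \<le> ennreal C' * theta k \<alpha> f (1 / real n) p"
    proof (cases "theta k \<alpha> f (1 / real n) p")
      case top
      then show ?thesis using C' by (simp add: ennreal_mult_top)
    next
      case (real \<theta>)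
      \<comment> \<open>The modulus at \<open>h\<close> involves steps strictly below \<open>h\<close>; taking \<open>h = 2 \<delta>\<close> costs a factor \<open>2\<^sup>\<alpha>\<close>.\<close>
      have bound: "Lp_norm p (difference k \<delta> F) \<le> ennreal (2 powr \<alpha> * \<theta> * \<delta> powr \<alpha>)"
        if \<delta>: "0 < \<delta>" "\<delta> \<le> 1 / (2 * real n)" for \<delta>
      proof -
        have "2 * \<delta> \<le> 1 / real n" using \<delta> n by (simp add: field_simps)
        then have "ennreal ((2 * \<delta>) powr - \<alpha>) * modulus k f (2 * \<delta>) p \<le> theta k \<alpha> f (1 / real n) p"
          unfolding theta_def using \<delta> by (intro SUP_upper2[of "2 * \<delta>"]) auto
        moreover have "Lp_norm p (difference k \<delta> f) \<le> modulus k f (2 * \<delta>) p"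
          unfolding modulus_def using \<delta> by (intro SUP_upper2[of \<delta>]) auto
        ultimately have "ennreal ((2 * \<delta>) powr - \<alpha>) * Lp_norm p (difference k \<delta> f) \<le> ennreal \<theta>"
          unfolding real(2) by (meson mult_left_mono order_trans zero_le)
        then have "ennreal ((2 * \<delta>) powr \<alpha>) * (ennreal ((2 * \<delta>) powr - \<alpha>) * Lp_norm p (difference k \<delta> f)) \<le> ennreal ((2 * \<delta>) powr \<alpha>) * ennreal \<theta>"
          by (intro mult_left_mono) auto
        moreover have "ennreal ((2 * \<delta>) powr \<alpha>) * ennreal ((2 * \<delta>) powr - \<alpha>) = 1"
          using \<delta> by (simp add: ennreal_mult'[symmetric] powr_minus)
        ultimately have "Lp_norm p (difference k \<delta> f) \<le> ennreal ((2 * \<delta>) powr \<alpha> * \<theta>)"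
          using real(1) by (simp add: mult.assoc[symmetric] ennreal_mult'[symmetric])
        moreover have "(2 * \<delta>) powr \<alpha> * \<theta> = 2 powr \<alpha> * \<theta> * \<delta> powr \<alpha>"
          using \<delta> by (simp add: powr_mult)
        ultimately show ?thesis using eq[of k \<delta> "\<lambda>x. 0"] by simp
      qed
      have "best_approx n f p r \<alpha> \<le> ennreal (C' * \<theta>) + ennreal \<epsilon>" if \<epsilon>: "0 < \<epsilon>" for \<epsilon>
      proof -
        \<comment> \<open>The summand \<open>\<epsilon> / C\<close> makes \<open>\<Theta>\<close> positive even if \<open>\<theta> = 0\<close>.\<close>
        define \<Theta> where "\<Theta> = 2 powr \<alpha> * \<theta> + \<epsilon> / C"
        have \<Theta>: "0 < \<Theta>" using real(1) \<epsilon> C by (simp add: \<Theta>_def add_nonneg_pos)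
        have "smooth_upto p k \<alpha> \<Theta> (1 / (2 * real n)) F"
          unfolding smooth_upto_def
        proof (intro conjI F allI impI)
          fix \<delta> :: real assume \<delta>: "0 < \<delta>" "\<delta> \<le> 1 / (2 * real n)"
          have "2 powr \<alpha> * \<theta> * \<delta> powr \<alpha> \<le> \<Theta> * \<delta> powr \<alpha>"
            using \<epsilon> C by (intro mult_right_mono) (auto simp: \<Theta>_def)
          then show "Lp_norm p (difference k \<delta> F) \<le> ennreal (\<Theta> * \<delta> powr \<alpha>)"
            using bound[OF \<delta>] by (meson ennreal_leI order_trans)
        qed
        then obtain T where T: "T \<in> trig_polys n" "Holder_norm p r \<alpha> (\<lambda>x. F x - T x) \<le> ennreal (C * \<Theta>)"
          using core \<Theta> n by blast
        have "best_approx n f p r \<alpha> \<le> Holder_norm p r \<alpha> (\<lambda>x. f x - T x)"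
          unfolding best_approx_def by (rule INF_lower[OF T(1)])
        also have "\<dots> \<le> ennreal (C * \<Theta>)" using T(2) by (simp add: Holder_eq)
        also have "C * \<Theta> = C' * \<theta> + \<epsilon>" using C by (simp add: \<Theta>_def C'_def algebra_simps)
        also have "ennreal (C' * \<theta> + \<epsilon>) = ennreal (C' * \<theta>) + ennreal \<epsilon>"
          using C' real(1) \<epsilon> by (intro ennreal_plus) auto
        finally show ?thesis .
      qed
      then have "best_approx n f p r \<alpha> \<le> ennreal (C' * \<theta>)" by (rule ennreal_le_epsilon)
      then show ?thesis using C' real by (simp add: ennreal_mult')
    qed
  qed
qed

end
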